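(* Let $\chi$ be a Dirichlet character modulo a positive integer $j$. For every positive integer $r$ and every complex $s$ with $\mathrm{Re}(s)>1$, $$J_r(s,\chi)=\prod_{m=1}^{\infty}\ \prod_{p\ \mathrm{prime}}\big(1-\chi(p)^m p^{-ms}\big)^{-\min\{m,r\}}=\prod_{m=1}^{\infty}L(ms,\chi^m)^{\min\{m,r\}},$$ and $$J_\infty(s,\chi)=\prod_{m=1}^{\infty}\ \prod_{p\ \mathrm{prime}}\big(1-\chi(p)^m p^{-ms}\big)^{-m}=\prod_{m=1}^{\infty}L(ms,\chi^m)^{m}.$$ Here the products converge absolutely for $\mathrm{Re}(s)>1$.
   Context: For an isomorphism class $G$ of finite Abelian groups, a group-partition of $G$ is a sequence $(G_1,G_2,G_3,\dots)$ of isomorphism classes of finite Abelian groups (all but finitely many trivial) such that $G=G_1\oplus G_2\oplus G_3\oplus\cdots$ and $G_1\supseteq G_2\supseteq G_3\supseteq\cdots$, where $G_i\supseteq G_{i+1}$ means that $G_{i+1}$ is isomorphic to a subgroup of $G_i$. For a positive integer $r$, $\pi_r(G)$ is the number of group-partitions of $G$ with at most $r$ factors (i.e. at most $r$ nontrivial $G_i$), and $\pi_\infty(G)$ is the number of all group-partitions of $G$. For $n\ge 1$ and $r\in\{1,2,3,\dots\}\cup\{\infty\}$, put $a_r(n):=\sum_{|G|=n}\pi_r(G)$, where $G$ runs over the isomorphism classes of Abelian groups of order $n$. For a Dirichlet character $\chi$ modulo $j$, $J_r(s,\chi):=\sum_{n=1}^{\infty}\chi(n)a_r(n)n^{-s}$,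 a series which converges absolutely for $\mathrm{Re}(s)>1$. $L(s,\chi)=\sum_{n=1}^\infty\chi(n)n^{-s}$ is the Dirichlet $L$-function, and $\chi^m$ is the character $n\mapsto\chi(n)^m$ modulo $j$. *)

theory Defs
  imports "HOL-Analysis.Analysis" "HOL-Algebra.Product_Groups"
    "HOL-Computational_Algebra.Primes"
begin

section \<open>Isomorphism classes of finite Abelian groups\<close>

text \<open>Every finite group is isomorphic to one whose elements are natural numbers, so the
  isomorphism classes of finite Abelian groups are represented by the isomorphism classes of
  finite Abelian groups on subsets of the natural numbers.\<close>

definition fin_ab_groups :: "nat monoid set" where
  "fin_ab_groups = {G. comm_group G \<and> finite (carrier G)}"

definition fin_ab_iso :: "(nat monoid \<times> nat monoid) set" where
  "fin_ab_iso = {(G, H). G \<in> fin_ab_groups \<and> H \<in> fin_ab_groups \<and> G \<cong> H}"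

lemma equiv_fin_ab_iso: "equiv fin_ab_groups fin_ab_iso"
proof (rule equivI)
  show "fin_ab_iso \<subseteq> fin_ab_groups \<times> fin_ab_groups"
    by (auto simp: fin_ab_iso_def)
  show "refl_on fin_ab_groups fin_ab_iso"
    by (auto simp: refl_on_def fin_ab_iso_def)
  show "sym fin_ab_iso"
    by (simp add: sym_def fin_ab_iso_def fin_ab_groups_def comm_group_def group.iso_sym)
  show "trans fin_ab_iso"
    unfolding trans_def fin_ab_iso_def using iso_trans by blast
qed

definition fin_ab_classes :: "nat monoid set set" where
  "fin_ab_classes = fin_ab_groups // fin_ab_iso"

definition trivial_class :: "nat monoid set" where
  "trivial_class = {G \<in> fin_ab_groups. trivial_group G}"

lemma trivial_class_in_fin_ab_classes: "trivial_class \<in> fin_ab_classes"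
proof -
  have S: "singleton_group (0::nat) \<in> fin_ab_groups"
    by (simp add: fin_ab_groups_def)
  have iso: "singleton_group (0::nat) \<cong> G" if "trivial_group G" for G :: "nat monoid"
  proof (rule is_isoI)
    show "(\<lambda>_. \<one>\<^bsub>G\<^esub>) \<in> iso (singleton_group (0::nat)) G"
      using that group.is_monoid[of G] monoid.l_one[of G "\<one>\<^bsub>G\<^esub>"] monoid.one_closed[of G]
      by (simp add: iso_def hom_def bij_betw_def trivial_group_def singleton_group_def)
  qed
  have triv: "trivial_group G" if "singleton_group (0::nat) \<cong> G" "comm_group G"
    for G :: "nat monoid"
    by (rule isomorphic_group_triviality1[OF that(1) comm_group.axioms(2)[OF that(2)]]) simp
  have "trivial_class = fin_ab_iso `` {singleton_group 0}"
    using S iso triv by (auto simp: trivial_class_def fin_ab_iso_def fin_ab_groups_def)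
  with S show ?thesis
    by (auto simp: fin_ab_classes_def quotient_def)
qed

definition classes_of_order :: "nat \<Rightarrow> nat monoid set set" where
  "classes_of_order n = {A \<in> fin_ab_classes. \<forall>G\<in>A. card (carrier G) = n}"

definition class_direct_sum :: "(nat \<Rightarrow> nat monoid set) \<Rightarrow> nat monoid set" where
  "class_direct_sum X =
     {H \<in> fin_ab_groups. \<exists>G. (\<forall>i. G i \<in> X i) \<and> H \<cong> sum_group UNIV G}"

definition class_supseteq :: "nat monoid set \<Rightarrow> nat monoid set \<Rightarrow> bool" where
  "class_supseteq A B \<longleftrightarrow>
     (\<exists>G\<in>A. \<exists>H\<in>B. \<exists>K. subgroup K G \<and> H \<cong> G\<lparr>carrier := K\<rparr>)"


section \<open>Group-partitions\<close>

text \<open>Sequences are indexed from \<open>0\<close>: the factor \<open>G\<^sub>i\<close> is \<open>X (i - 1)\<close>.\<close>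

definition group_partition :: "nat monoid set \<Rightarrow> (nat \<Rightarrow> nat monoid set) \<Rightarrow> bool" where
  "group_partition A X \<longleftrightarrow>
     (\<forall>i. X i \<in> fin_ab_classes) \<and>
     finite {i. X i \<noteq> trivial_class} \<and>
     A = class_direct_sum X \<and>
     (\<forall>i. class_supseteq (X i) (X (Suc i)))"

definition num_partitions :: "enat \<Rightarrow> nat monoid set \<Rightarrow> nat" where
  "num_partitions r A =
     card {X. group_partition A X \<and> enat (card {i. X i \<noteq> trivial_class}) \<le> r}"

definition a_coeff :: "enat \<Rightarrow> nat \<Rightarrow> nat" where
  "a_coeff r n = (\<Sum>A\<in>classes_of_order n. num_partitions r A)"


section \<open>Dirichlet characters and Dirichlet series\<close>

definition dirichlet_character :: "nat \<Rightarrow> (int \<Rightarrow> complex) \<Rightarrow> bool" where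
  "dirichlet_character j chi \<longleftrightarrow>
     j > 0 \<and>
     (\<forall>a b. chi (a * b) = chi a * chi b) \<and>
     (\<forall>a. chi (a + int j) = chi a) \<and>
     (\<forall>a. chi a \<noteq> 0 \<longleftrightarrow> coprime a (int j))"

text \<open>Both series start at \<open>n = 1\<close>; the term functions are indexed by \<open>n - 1\<close>.\<close>

definition dirichlet_L :: "complex \<Rightarrow> (int \<Rightarrow> complex) \<Rightarrow> complex" where
  "dirichlet_L s chi = (\<Sum>n. chi (int (Suc n)) * of_nat (Suc n) powr (- s))"

definition J_term :: "enat \<Rightarrow> complex \<Rightarrow> (int \<Rightarrow> complex) \<Rightarrow> nat \<Rightarrow> complex" where
  "J_term r s chi n =
     chi (int (Suc n)) * of_nat (a_coeff r (Suc n)) * of_nat (Suc n) powr (- s)"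

definition J :: "enat \<Rightarrow> complex \<Rightarrow> (int \<Rightarrow> complex) \<Rightarrow> complex" where
  "J r s chi = (\<Sum>n. J_term r s chi n)"


section \<open>Products over primes and absolute convergence\<close>

definition prime_prodinf :: "(nat \<Rightarrow> complex) \<Rightarrow> complex" where
  "prime_prodinf f = (\<Prod>p. if prime p then f p else 1)"

definition euler_term :: "complex \<Rightarrow> (int \<Rightarrow> complex) \<Rightarrow> nat \<Rightarrow> nat \<Rightarrow> complex" where
  "euler_term s chi m p = 1 - chi (int p) ^ m * of_nat p powr (- (of_nat m * s))"

text \<open>Absolute convergence of a product over an arbitrary index set.  For sequences this is the
  notion of the library, as the next lemma shows.\<close>

definition abs_convergent_prod_on :: "('a \<Rightarrow> complex) \<Rightarrow> 'a set \<Rightarrow> bool" where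
  "abs_convergent_prod_on f I \<longleftrightarrow> (\<lambda>x. norm (f x - 1)) summable_on I"

lemma abs_convergent_prod_on_UNIV_nat:
  "abs_convergent_prod_on f UNIV \<longleftrightarrow> abs_convergent_prod f"
  by (simp add: abs_convergent_prod_on_def abs_convergent_prod_conv_summable
      summable_on_UNIV_nonneg_real_iff)

end

theory Submission
  imports Defs "HOL-Algebra.Multiplicative_Group"
begin

text \<open>A finite Abelian group is classified by its invariant factors, a chain \<open>d\<^sub>0, d\<^sub>1, \<dots>\<close> of positive
  integers with \<open>d\<^sub>i\<^sub>+\<^sub>1\<close> dividing \<open>d\<^sub>i\<close>, and one group embeds into another iff the invariant
  factors divide each other termwise. Hence \<open>a\<^sub>r(n)\<close> counts the multiplicative plane partitions of \<open>n\<close>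
  with at most \<open>r\<close> rows: arrays of positive integers with product \<open>n\<close> in which every entry is divisible
  by its right and lower neighbours. The toggle description of the RSK correspondence works in any
  lattice-ordered group; with gcd and lcm in place of minimum and maximum it turns these arrays
  bijectively into arbitrary arrays \<open>(A\<^sub>a\<^sub>t)\<close> of positive integers with at most \<open>r\<close> rows and
  \<open>\<Prod> A\<^sub>a\<^sub>t\<^bsup>a + t + 1\<^esup> = n\<close> (indices from 0). As \<open>min {m, r}\<close> cells satisfy \<open>a + t + 1 = m\<close>, this gives
  \<open>J\<^sub>r(s, \<chi>) = \<Prod> L(ms, \<chi>\<^sup>m)\<^bsup>min {m, r}\<^esup>\<close> without going through the primes; the Euler product is only
  needed for each \<open>L\<close>-function separately.\<close>

section \<open>Toggling interlacing sequences\<close>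

text \<open>Let \<mu> and \<rho> interlace below \<kappa>. Toggling gives a sequence \<tau>
  interlacing below both; the first entry of \<kappa> has no counterpart in \<tau>, and its quotient
  by an lcm, the corner, is the free integer that is released. Because gcd times lcm is the product,
  the sizes satisfy |\<kappa>| |\<tau>| = corner |\<mu>| |\<rho>|, and iterating this law over all
  diagonals is what produces the exponent a + t + 1. The obstacle on the analytic side is that
  infinitely many cells contribute. The arrays are therefore cut to the triangle a + t < M. There
  the generating series is a finite product of L-functions, every m up to M occurs with its full
  multiplicity, and the n-th coefficient is already correct for n <= M. The same identity for the
  absolute values |chi(n) n^(-s)| bounds the partial sums of the series uniformly, which makes it
  absolutely convergent and justifies letting M tend to infinity. The multiplicities grow at most
  like m, but L(ms, chi^m) - 1 is O(2^(-m)).\<close>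

definition support_prod :: "('a \<Rightarrow> nat) \<Rightarrow> nat" where
  "support_prod f = prod f {a. f a \<noteq> 1}"

lemma support_prod_superset: "finite A \<Longrightarrow> {a. f a \<noteq> 1} \<subseteq> A \<Longrightarrow> support_prod f = prod f A"
  unfolding support_prod_def by (rule prod.mono_neutral_left) auto

text \<open>For neighbouring diagonals, \<open>\<mu>\<close> being the one further from the main
  diagonal, one divisibility runs along the rows of the plane partition and the other along its
  columns.\<close>

definition interlace :: "(nat \<Rightarrow> nat) \<Rightarrow> (nat \<Rightarrow> nat) \<Rightarrow> bool" where
  "interlace \<mu> \<kappa> \<longleftrightarrow> (\<forall>k. \<mu> k dvd \<kappa> k \<and> \<kappa> (Suc k) dvd \<mu> k)"

text \<open>In a strip, \<open>x t\<close> is the \<open>t\<close>-th diagonal above the main one of a multiplicative plane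
  partition; the diagonals below it are a second strip with the same \<open>x 0\<close>.\<close>

definition strips :: "nat \<Rightarrow> (nat \<Rightarrow> nat \<Rightarrow> nat) set" where
  "strips N = {x. (\<forall>t k. 0 < x t k) \<and> (\<forall>t. interlace (x (Suc t)) (x t)) \<and> (\<forall>t\<ge>N. x t = (\<lambda>_. 1))}"

definition seqs :: "nat \<Rightarrow> (nat \<Rightarrow> nat) set" where
  "seqs N = {a. (\<forall>t. 0 < a t) \<and> (\<forall>t\<ge>N. a t = 1)}"

text \<open>\<open>\<kappa> (Suc k)\<close> lies, for divisibility, between the lcm and the gcd
  occurring here; toggling reflects it in this interval, the multiplicative form of x \<mapsto> min
  + max - x, and lowers its index by one.\<close>

definition toggle :: "(nat \<Rightarrow> nat) \<Rightarrow> (nat \<Rightarrow> nat) \<Rightarrow> (nat \<Rightarrow> nat) \<Rightarrow> nat \<Rightarrow> nat" where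
  "toggle \<kappa> \<mu> \<rho> k = gcd (\<mu> k) (\<rho> k) * lcm (\<mu> (Suc k)) (\<rho> (Suc k)) div \<kappa> (Suc k)"

definition corner :: "(nat \<Rightarrow> nat) \<Rightarrow> (nat \<Rightarrow> nat) \<Rightarrow> (nat \<Rightarrow> nat) \<Rightarrow> nat" where
  "corner \<kappa> \<mu> \<rho> = \<kappa> 0 div lcm (\<mu> 0) (\<rho> 0)"

text \<open>The same reflection with the index raised by one; the entry at 0, which toggling loses,
  is rebuilt from the corner \<open>a\<close>.\<close>

definition untoggle :: "(nat \<Rightarrow> nat) \<Rightarrow> (nat \<Rightarrow> nat) \<Rightarrow> (nat \<Rightarrow> nat) \<Rightarrow> nat \<Rightarrow> nat \<Rightarrow> nat" where
  "untoggle \<kappa> \<mu> \<rho> a = case_nat (a * lcm (\<mu> 0) (\<rho> 0))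
     (\<lambda>k. gcd (\<mu> k) (\<rho> k) * lcm (\<mu> (Suc k)) (\<rho> (Suc k)) div \<kappa> k)"

text \<open>\<open>\<rho>\<close> is the first diagonal on the other side of the main diagonal
  \<open>x 0\<close>. The toggled main diagonal lies below both \<open>x 1\<close> and
  \<open>\<rho>\<close>, so it can play the role of \<open>\<rho>\<close> for the rest of the strip.
  In the result \<open>\<rho>\<close> is the main diagonal.\<close>

primrec shrink :: "nat \<Rightarrow> (nat \<Rightarrow> nat \<Rightarrow> nat) \<Rightarrow> (nat \<Rightarrow> nat) \<Rightarrow> (nat \<Rightarrow> nat \<Rightarrow> nat) \<times> (nat \<Rightarrow> nat)" where
  "shrink 0 x \<rho> = (\<lambda>_ _. 1, \<lambda>_. 1)"
| "shrink (Suc N) x \<rho> =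
     (let (x', a) = shrink N (\<lambda>t. x (Suc t)) (toggle (x 0) (x 1) \<rho>)
      in (case_nat \<rho> x', case_nat (corner (x 0) (x 1) \<rho>) a))"

primrec grow :: "nat \<Rightarrow> (nat \<Rightarrow> nat \<Rightarrow> nat) \<Rightarrow> (nat \<Rightarrow> nat) \<Rightarrow> (nat \<Rightarrow> nat \<Rightarrow> nat)" where
  "grow 0 x a = (\<lambda>_ _. 1)"
| "grow (Suc N) x a =
     (let z = grow N (\<lambda>t. x (Suc t)) (\<lambda>t. a (Suc t))
      in case_nat (untoggle (x 1) (z 0) (x 0) (a 0)) z)"

context
  fixes \<kappa> \<mu> \<rho> :: "nat \<Rightarrow> nat"
  assumes pos: "\<And>k. 0 < \<kappa> k" "\<And>k. 0 < \<mu> k" "\<And>k. 0 < \<rho> k"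
begin

lemma toggle_props:
  assumes "interlace \<mu> \<kappa>" "interlace \<rho> \<kappa>"
  shows "interlace (toggle \<kappa> \<mu> \<rho>) \<mu>" "interlace (toggle \<kappa> \<mu> \<rho>) \<rho>" "0 < toggle \<kappa> \<mu> \<rho> k"
    "0 < corner \<kappa> \<mu> \<rho>" "untoggle (toggle \<kappa> \<mu> \<rho>) \<mu> \<rho> (corner \<kappa> \<mu> \<rho>) = \<kappa>"
    "toggle \<kappa> \<mu> \<rho> k * \<kappa> (Suc k) = gcd (\<mu> k) (\<rho> k) * lcm (\<mu> (Suc k)) (\<rho> (Suc k))"
    "corner \<kappa> \<mu> \<rho> * lcm (\<mu> 0) (\<rho> 0) = \<kappa> 0"
proof -
  have l: "lcm (\<mu> k) (\<rho> k) dvd \<kappa> k" for k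
    using assms by (simp add: interlace_def)
  have g: "\<kappa> (Suc k) dvd gcd (\<mu> k) (\<rho> k)" for k
    using assms by (simp add: interlace_def)
  have e: "toggle \<kappa> \<mu> \<rho> k * \<kappa> (Suc k) = gcd (\<mu> k) (\<rho> k) * lcm (\<mu> (Suc k)) (\<rho> (Suc k))" for k
    unfolding toggle_def by (rule dvd_div_mult_self) (use g in \<open>simp add: dvd_mult2\<close>)
  show "toggle \<kappa> \<mu> \<rho> k * \<kappa> (Suc k) = gcd (\<mu> k) (\<rho> k) * lcm (\<mu> (Suc k)) (\<rho> (Suc k))" by (rule e)
  have p: "0 < toggle \<kappa> \<mu> \<rho> k" for k
    using e[of k] pos(2,3) by (metis gr0I lcm_eq_0_iff gcd_eq_0_iff mult_eq_0_iff nat_less_le)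
  then show "0 < toggle \<kappa> \<mu> \<rho> k" .
  \<comment> \<open>Both bounds on the reflected entry come from multiplying by
    \<open>\<kappa> (Suc k)\<close> and cancelling, so that \<open>div\<close> never has to be
    handled.\<close>
  have d1: "toggle \<kappa> \<mu> \<rho> k dvd gcd (\<mu> k) (\<rho> k)" for k
  proof -
    have "toggle \<kappa> \<mu> \<rho> k * \<kappa> (Suc k) dvd gcd (\<mu> k) (\<rho> k) * \<kappa> (Suc k)"
      unfolding e by (intro mult_dvd_mono l) simp
    then show ?thesis using pos(1)[of "Suc k"] by simp
  qed
  have d2: "lcm (\<mu> (Suc k)) (\<rho> (Suc k)) dvd toggle \<kappa> \<mu> \<rho> k" for k
  proof -
    have "\<kappa> (Suc k) * lcm (\<mu> (Suc k)) (\<rho> (Suc k)) dvd toggle \<kappa> \<mu> \<rho> k * \<kappa> (Suc k)"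
      unfolding e by (intro mult_dvd_mono g) simp
    then show ?thesis using pos(1)[of "Suc k"] by (simp add: mult.commute)
  qed
  show "interlace (toggle \<kappa> \<mu> \<rho>) \<mu>" "interlace (toggle \<kappa> \<mu> \<rho>) \<rho>"
    using d1 d2 by (auto simp: interlace_def)
  show c: "corner \<kappa> \<mu> \<rho> * lcm (\<mu> 0) (\<rho> 0) = \<kappa> 0"
    unfolding corner_def by (rule dvd_div_mult_self[OF l])
  show "0 < corner \<kappa> \<mu> \<rho>"
    using c pos(1)[of 0] by (metis gr0I mult_0 less_irrefl)
  show "untoggle (toggle \<kappa> \<mu> \<rho>) \<mu> \<rho> (corner \<kappa> \<mu> \<rho>) = \<kappa>"
  proof
    fix k show "untoggle (toggle \<kappa> \<mu> \<rho>) \<mu> \<rho> (corner \<kappa> \<mu> \<rho>) k = \<kappa> k"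
    proof (cases k)
      case 0 then show ?thesis using c by (simp add: untoggle_def)
    next
      case (Suc j)
      then show ?thesis using p[of j] by (simp add: untoggle_def flip: e)
    qed
  qed
qed

text \<open>Here \<^term>\<open>\<kappa>\<close> plays the role of the toggled sequence.\<close>
lemma untoggle_props:
  assumes "interlace \<kappa> \<mu>" "interlace \<kappa> \<rho>" and a: "0 < a"
  defines "\<sigma> \<equiv> untoggle \<kappa> \<mu> \<rho> a"
  shows "interlace \<mu> \<sigma>" "interlace \<rho> \<sigma>" "0 < \<sigma> k" "toggle \<sigma> \<mu> \<rho> = \<kappa>" "corner \<sigma> \<mu> \<rho> = a"
proof -
  have g: "\<kappa> k dvd gcd (\<mu> k) (\<rho> k)" for k
    using assms by (simp add: interlace_def)
  have l: "lcm (\<mu> (Suc k)) (\<rho> (Suc k)) dvd \<kappa> k" for k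
    using assms by (simp add: interlace_def)
  have e: "\<sigma> (Suc k) * \<kappa> k = gcd (\<mu> k) (\<rho> k) * lcm (\<mu> (Suc k)) (\<rho> (Suc k))" for k
    unfolding \<sigma>_def untoggle_def nat.case
    by (rule dvd_div_mult_self) (use g in \<open>simp add: dvd_mult2\<close>)
  have z: "\<sigma> 0 = a * lcm (\<mu> 0) (\<rho> 0)"
    by (simp add: \<sigma>_def untoggle_def)
  have p: "0 < \<sigma> k" for k
  proof (cases k)
    case 0 then show ?thesis using a pos z by (simp add: lcm_pos_nat)
  next
    case (Suc j)
    then show ?thesis using e[of j] pos(2,3) by (metis gr0I lcm_eq_0_iff gcd_eq_0_iff mult_eq_0_iff nat_less_le)
  qed
  then show "0 < \<sigma> k" .
  have d1: "\<sigma> (Suc k) dvd gcd (\<mu> k) (\<rho> k)" for k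
  proof -
    have "\<sigma> (Suc k) * \<kappa> k dvd gcd (\<mu> k) (\<rho> k) * \<kappa> k"
      unfolding e by (intro mult_dvd_mono l) simp
    then show ?thesis using pos(1)[of k] by simp
  qed
  have d2: "lcm (\<mu> k) (\<rho> k) dvd \<sigma> k" for k
  proof (cases k)
    case 0 then show ?thesis by (simp add: z)
  next
    case (Suc j)
    have "\<kappa> j * lcm (\<mu> (Suc j)) (\<rho> (Suc j)) dvd \<sigma> (Suc j) * \<kappa> j"
      unfolding e by (intro mult_dvd_mono g) simp
    then show ?thesis using pos(1)[of j] Suc by (simp add: mult.commute)
  qed
  show "interlace \<mu> \<sigma>" "interlace \<rho> \<sigma>"
    using d1 d2 by (auto simp: interlace_def)
  show "toggle \<sigma> \<mu> \<rho> = \<kappa>"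
    using p by (auto simp: fun_eq_iff toggle_def simp flip: e)
  show "corner \<sigma> \<mu> \<rho> = a"
    using pos by (simp add: corner_def z)
qed

end

lemma strips_Suc_iff:
  "x \<in> strips (Suc N) \<longleftrightarrow>
     (\<forall>k. 0 < x 0 k) \<and> interlace (x 1) (x 0) \<and> (\<lambda>t. x (Suc t)) \<in> strips N"
proof -
  have "(\<forall>t k. 0 < x t k) \<longleftrightarrow> (\<forall>k. 0 < x 0 k) \<and> (\<forall>t k. 0 < x (Suc t) k)"
    by (metis not0_implies_Suc)
  moreover have "(\<forall>t. interlace (x (Suc t)) (x t)) \<longleftrightarrow>
      interlace (x 1) (x 0) \<and> (\<forall>t. interlace (x (Suc (Suc t))) (x (Suc t)))"
    by (metis not0_implies_Suc One_nat_def)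
  moreover have "(\<forall>t\<ge>Suc N. x t = (\<lambda>_. 1)) \<longleftrightarrow> (\<forall>t\<ge>N. x (Suc t) = (\<lambda>_. 1))"
    by (metis Suc_le_D Suc_le_mono)
  ultimately show ?thesis
    unfolding strips_def by auto
qed

lemma seqs_Suc_iff: "a \<in> seqs (Suc N) \<longleftrightarrow> 0 < a 0 \<and> (\<lambda>t. a (Suc t)) \<in> seqs N"
proof -
  have "(\<forall>t. 0 < a t) \<longleftrightarrow> 0 < a 0 \<and> (\<forall>t. 0 < a (Suc t))"
    by (metis not0_implies_Suc)
  moreover have "(\<forall>t\<ge>Suc N. a t = 1) \<longleftrightarrow> (\<forall>t\<ge>N. a (Suc t) = 1)"
    by (metis Suc_le_D Suc_le_mono)
  ultimately show ?thesis
    unfolding seqs_def by auto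
qed

lemma case_nat_Suc_eta: "case_nat (x 0) (\<lambda>t. x (Suc t)) = x"
  by (auto simp: fun_eq_iff split: nat.splits)

text \<open>Entry \<open>k\<close> of diagonal \<open>t\<close> sits in column \<open>t + k\<close>
  (in row \<open>t + k\<close> for the strip below the main diagonal); interlacing spreads the bound
  on the number of diagonals to a bound on the columns.\<close>

lemma strips_eq_1: "x \<in> strips N \<Longrightarrow> N \<le> t + k \<Longrightarrow> x t k = 1"
proof (induction k arbitrary: t)
  case 0
  then show ?case by (auto simp: strips_def)
next
  case (Suc k)
  have "x (Suc t) k = 1" using Suc.IH[of "Suc t"] Suc.prems by simp
  moreover have "x t (Suc k) dvd x (Suc t) k"
    using Suc.prems by (auto simp: strips_def interlace_def)
  ultimately show ?case by simp
qed

lemma strips_0: "strips 0 = {\<lambda>_ _. 1}"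
  by (auto simp: strips_def interlace_def)

lemma seqs_0: "seqs 0 = {\<lambda>_. 1}"
  by (auto simp: seqs_def)

lemma interlace_1: "interlace \<rho> (\<lambda>_. Suc 0) \<longleftrightarrow> \<rho> = (\<lambda>_. Suc 0)"
  by (auto simp: interlace_def fun_eq_iff)

lemma shrink_grow:
  assumes "x \<in> strips N" "\<And>k. 0 < \<rho> k" "interlace \<rho> (x 0)" "shrink N x \<rho> = (x', a)"
  shows "x' \<in> strips N \<and> a \<in> seqs N \<and> x' 0 = \<rho> \<and> grow N x' a = x"
  using assms
proof (induction N arbitrary: x \<rho> x' a)
  case 0
  then show ?case by (auto simp: strips_0 seqs_0 interlace_1)
next
  case (Suc N)
  let ?\<kappa> = "x 0" and ?\<mu> = "x 1"
  have x: "\<And>k. 0 < ?\<kappa> k" "interlace ?\<mu> ?\<kappa>" "(\<lambda>t. x (Suc t)) \<in> strips N"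
    using Suc.prems(1) by (auto simp: strips_Suc_iff)
  have m: "0 < ?\<mu> k" for k
    using Suc.prems(1) by (auto simp: strips_def)
  note T = toggle_props[OF x(1) m Suc.prems(2) x(2) Suc.prems(3)]
  obtain x'' a'' where s: "shrink N (\<lambda>t. x (Suc t)) (toggle ?\<kappa> ?\<mu> \<rho>) = (x'', a'')"
    by fastforce
  have IH: "x'' \<in> strips N \<and> a'' \<in> seqs N \<and> x'' 0 = toggle ?\<kappa> ?\<mu> \<rho> \<and> grow N x'' a'' = (\<lambda>t. x (Suc t))"
    using Suc.IH[OF x(3) T(3) _ s] T(1) by simp
  have "x' = case_nat \<rho> x''" "a = case_nat (corner ?\<kappa> ?\<mu> \<rho>) a''"
    using Suc.prems(4) s by auto
  then show ?case
    using IH T Suc.prems(2) case_nat_Suc_eta[of x] by (auto simp: strips_Suc_iff seqs_Suc_iff)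
qed

lemma grow_shrink:
  assumes "x \<in> strips N" "a \<in> seqs N"
  shows "grow N x a \<in> strips N \<and> interlace (x 0) (grow N x a 0) \<and> shrink N (grow N x a) (x 0) = (x, a)"
  using assms
proof (induction N arbitrary: x a)
  case 0
  then show ?case by (auto simp: strips_0 seqs_0 interlace_1)
next
  case (Suc N)
  have x: "\<And>k. 0 < x 0 k" "interlace (x 1) (x 0)" "(\<lambda>t. x (Suc t)) \<in> strips N"
    using Suc.prems(1) by (auto simp: strips_Suc_iff)
  have a: "0 < a 0" "(\<lambda>t. a (Suc t)) \<in> seqs N"
    using Suc.prems(2) by (auto simp: seqs_Suc_iff)
  have m: "0 < x 1 k" for k
    using Suc.prems(1) by (auto simp: strips_def)
  define z where "z = grow N (\<lambda>t. x (Suc t)) (\<lambda>t. a (Suc t))"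
  have IH: "z \<in> strips N" "interlace (x 1) (z 0)" "shrink N z (x 1) = (\<lambda>t. x (Suc t), \<lambda>t. a (Suc t))"
    using Suc.IH[OF x(3) a(2)] by (auto simp: z_def)
  have zp: "0 < z 0 k" for k
    using IH(1) by (auto simp: strips_def)
  note T = untoggle_props[OF m zp x(1) IH(2) x(2) a(1)]
  have g: "grow (Suc N) x a = case_nat (untoggle (x 1) (z 0) (x 0) (a 0)) z"
    by (simp add: z_def Let_def)
  show ?case
    unfolding g using T IH case_nat_Suc_eta[of x] case_nat_Suc_eta[of a]
    by (simp add: strips_Suc_iff)
qed

section \<open>Weights under toggling\<close>

lemma support_prod_eq: "(\<And>k. K \<le> k \<Longrightarrow> f k = 1) \<Longrightarrow> support_prod f = prod f {..<K}" for f :: "nat \<Rightarrow> nat"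
  by (rule support_prod_superset) (auto, meson leI)

lemma support_prod_pos: "(\<And>u. 0 < f u) \<Longrightarrow> 0 < support_prod f"
  by (simp add: support_prod_def prod_pos)

text \<open>The product of the toggle equations contains the gcds from index 0 on but the lcms only
  from index 1 on; the corner equation supplies the missing lcm at 0, and then gcd times lcm gives
  the two products.\<close>

lemma support_prod_toggle:
  assumes pos: "\<And>k. 0 < \<kappa> k" "\<And>k. 0 < \<mu> k" "\<And>k. 0 < \<rho> k"
    and il: "interlace \<mu> \<kappa>" "interlace \<rho> \<kappa>"
    and fin: "\<And>k. K \<le> k \<Longrightarrow> \<kappa> k = 1"
  shows "support_prod \<kappa> * support_prod (toggle \<kappa> \<mu> \<rho>) = corner \<kappa> \<mu> \<rho> * support_prod \<mu> * support_prod \<rho>"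
proof -
  note T = toggle_props[OF pos il]
  have fin': "\<mu> k = 1" "\<rho> k = 1" if "K \<le> k" for k
    using fin[OF that] il unfolding interlace_def by (metis nat_dvd_1_iff_1)+
  have fint: "toggle \<kappa> \<mu> \<rho> k = 1" if "K \<le> k" for k
    using fin[of "Suc k"] fin'[of "Suc k"] fin'[of k] that by (simp add: toggle_def)
  have K: "support_prod f = prod f {..<Suc K}" if "\<And>k. K \<le> k \<Longrightarrow> f k = 1" for f :: "nat \<Rightarrow> nat"
    using that by (intro support_prod_eq) auto
  have "support_prod \<kappa> * support_prod (toggle \<kappa> \<mu> \<rho>) = \<kappa> 0 * (\<Prod>k<K. toggle \<kappa> \<mu> \<rho> k * \<kappa> (Suc k))"
  proof -
    have "support_prod \<kappa> = \<kappa> 0 * (\<Prod>k<K. \<kappa> (Suc k))"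
      unfolding prod.lessThan_Suc_shift[symmetric] by (rule K) (rule fin)
    moreover have "support_prod (toggle \<kappa> \<mu> \<rho>) = (\<Prod>k<K. toggle \<kappa> \<mu> \<rho> k)"
      by (rule support_prod_eq) (rule fint)
    ultimately show ?thesis
      by (simp add: prod.distrib mult_ac)
  qed
  also have "\<dots> = corner \<kappa> \<mu> \<rho> * ((\<Prod>k<K. gcd (\<mu> k) (\<rho> k)) * (lcm (\<mu> 0) (\<rho> 0) * (\<Prod>k<K. lcm (\<mu> (Suc k)) (\<rho> (Suc k)))))"
    unfolding T(6) T(7)[symmetric] by (simp add: prod.distrib mult_ac)
  also have "lcm (\<mu> 0) (\<rho> 0) * (\<Prod>k<K. lcm (\<mu> (Suc k)) (\<rho> (Suc k))) = (\<Prod>k<Suc K. lcm (\<mu> k) (\<rho> k))"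
    by (simp add: prod.lessThan_Suc_shift del: prod.lessThan_Suc)
  also have "\<dots> = (\<Prod>k<K. lcm (\<mu> k) (\<rho> k))"
    using fin'[of K] by simp
  also have "(\<Prod>k<K. gcd (\<mu> k) (\<rho> k)) * \<dots> = (\<Prod>k<K. \<mu> k * \<rho> k)"
    by (simp flip: prod.distrib)
  moreover have "support_prod \<mu> = prod \<mu> {..<K}" "support_prod \<rho> = prod \<rho> {..<K}"
    by (rule support_prod_eq, rule fin', assumption)+
  ultimately show ?thesis
    by (simp add: prod.distrib)
qed

text \<open>The exponent of the first diagonal is a parameter because it goes up by one whenever an
  induction passes to the tail of the strip or to the next row.\<close>

definition strip_weight :: "nat \<Rightarrow> nat \<Rightarrow> (nat \<Rightarrow> nat \<Rightarrow> nat) \<Rightarrow> nat" where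
  "strip_weight c N x = support_prod (x 0) ^ c * (\<Prod>t<N. support_prod (x (Suc t)))"

text \<open>The \<open>c\<close>-th power of the toggle law trades
  \<open>support_prod (x 0) ^ c\<close> for, among others, \<open>support_prod (x 1) ^ c\<close>.
  Together with the factor of \<open>x 1\<close> already present, the tail has weight parameter
  \<open>Suc c\<close>; hence the exponent \<open>t + c\<close> of the \<open>t\<close>-th released
  integer.\<close>

lemma strip_weight_shrink:
  assumes "x \<in> strips N" "\<And>k. 0 < \<rho> k" "interlace \<rho> (x 0)" "shrink N x \<rho> = (x', a)"
  shows "strip_weight c N x = (\<Prod>t<N. a t ^ (t + c)) * strip_weight c N x'"
  using assms
proof (induction N arbitrary: x \<rho> x' a c)
  case 0
  then show ?case by (auto simp: strips_0 strip_weight_def)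
next
  case (Suc N)
  let ?\<kappa> = "x 0" and ?\<mu> = "x 1"
  let ?\<tau> = "toggle ?\<kappa> ?\<mu> \<rho>"
  have x: "\<And>k. 0 < ?\<kappa> k" "interlace ?\<mu> ?\<kappa>" "(\<lambda>t. x (Suc t)) \<in> strips N"
    using Suc.prems(1) by (auto simp: strips_Suc_iff)
  have m: "0 < ?\<mu> k" for k
    using Suc.prems(1) by (auto simp: strips_def)
  note T = toggle_props[OF x(1) m Suc.prems(2) x(2) Suc.prems(3)]
  obtain x'' a'' where s: "shrink N (\<lambda>t. x (Suc t)) ?\<tau> = (x'', a'')"
    by fastforce
  have x''0: "x'' 0 = ?\<tau>"
    using shrink_grow[OF x(3) T(3) _ s] T(1) by simp
  have IH: "strip_weight (Suc c) N (\<lambda>t. x (Suc t)) =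
      (\<Prod>t<N. a'' t ^ (t + Suc c)) * strip_weight (Suc c) N x''"
    using Suc.IH[OF x(3) T(3) _ s] T(1) by simp
  have eqs: "x' = case_nat \<rho> x''" "a = case_nat (corner ?\<kappa> ?\<mu> \<rho>) a''"
    using Suc.prems(4) s by auto
  have sz: "support_prod ?\<kappa> * support_prod ?\<tau> = corner ?\<kappa> ?\<mu> \<rho> * support_prod ?\<mu> * support_prod \<rho>"
    by (rule support_prod_toggle[where K = "Suc N"])
      (use x m Suc.prems strips_eq_1[OF Suc.prems(1), of 0] in auto)
  have tp: "0 < support_prod ?\<tau>" using support_prod_pos[OF T(3)] .
  let ?R = "\<Prod>t<N. support_prod (x (Suc (Suc t)))" and ?R' = "\<Prod>t<N. support_prod (x'' (Suc t))"
    and ?a = "\<Prod>t<N. a'' t ^ (t + Suc c)"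
  have IH': "support_prod ?\<mu> ^ Suc c * ?R = ?a * (support_prod ?\<tau> ^ Suc c * ?R')"
    using IH x''0 by (simp add: strip_weight_def)
  \<comment> \<open>This positive factor lets the toggle law be used without division; it is
    cancelled at the end.\<close>
  have "support_prod ?\<tau> ^ c * strip_weight c (Suc N) x = (support_prod ?\<kappa> * support_prod ?\<tau>) ^ c * (support_prod ?\<mu> * ?R)"
    by (simp add: strip_weight_def prod.lessThan_Suc_shift power_mult_distrib mult_ac del: prod.lessThan_Suc)
  also have "\<dots> = corner ?\<kappa> ?\<mu> \<rho> ^ c * support_prod \<rho> ^ c * (support_prod ?\<mu> ^ Suc c * ?R)"
    unfolding sz by (simp add: power_mult_distrib mult_ac)
  also have "\<dots> = support_prod ?\<tau> ^ c * (corner ?\<kappa> ?\<mu> \<rho> ^ c * ?a * (support_prod \<rho> ^ c * (support_prod ?\<tau> * ?R')))"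
    unfolding IH' by (simp add: mult_ac)
  also have "corner ?\<kappa> ?\<mu> \<rho> ^ c * ?a * (support_prod \<rho> ^ c * (support_prod ?\<tau> * ?R')) =
      (\<Prod>t<Suc N. a t ^ (t + c)) * strip_weight c (Suc N) x'"
    by (simp add: strip_weight_def eqs x''0 prod.lessThan_Suc_shift mult_ac del: prod.lessThan_Suc)
  finally show ?case
    using tp by simp
qed

section \<open>From pairs of strips to arbitrary arrays\<close>

definition strip_pairs :: "nat \<Rightarrow> nat \<Rightarrow> ((nat \<Rightarrow> nat \<Rightarrow> nat) \<times> (nat \<Rightarrow> nat \<Rightarrow> nat)) set" where
  "strip_pairs r N = {(x, y). x \<in> strips N \<and> y \<in> strips r \<and> x 0 = y 0}"

definition arrays :: "nat \<Rightarrow> nat \<Rightarrow> (nat \<Rightarrow> nat \<Rightarrow> nat) set" where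
  "arrays r N = {A. (\<forall>a t. 0 < A a t) \<and> (\<forall>a t. r \<le> a \<or> N \<le> t \<longrightarrow> A a t = 1)}"

lemma arrays_Suc_iff: "A \<in> arrays (Suc r) N \<longleftrightarrow> A 0 \<in> seqs N \<and> (\<lambda>a. A (Suc a)) \<in> arrays r N"
proof -
  have "(\<forall>a t. 0 < A a t) \<longleftrightarrow> (\<forall>t. 0 < A 0 t) \<and> (\<forall>a t. 0 < A (Suc a) t)"
    by (metis not0_implies_Suc)
  moreover have "(\<forall>a t. Suc r \<le> a \<or> N \<le> t \<longrightarrow> A a t = 1) \<longleftrightarrow>
      (\<forall>t\<ge>N. A 0 t = 1) \<and> (\<forall>a t. r \<le> a \<or> N \<le> t \<longrightarrow> A (Suc a) t = 1)"
    by (metis not0_implies_Suc Suc_le_mono not_less_eq_eq zero_le)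
  ultimately show ?thesis
    unfolding arrays_def seqs_def by auto
qed

text \<open>One row of the box is removed: \<open>y 1\<close> becomes the common main diagonal, and
  the toggles release one free row of \<open>N\<close> integers.\<close>

lemma strip_pairs_Suc_bij:
  "bij_betw (\<lambda>(x, y). case shrink N x (y 1) of (x', a) \<Rightarrow> ((x', \<lambda>t. y (Suc t)), a))
     (strip_pairs (Suc r) N) (strip_pairs r N \<times> seqs N)" (is "bij_betw ?f ?A ?B")
proof -
  let ?g = "\<lambda>((x', y'), a). (grow N x' a, case_nat (grow N x' a 0) y')"
  have 1: "?f p \<in> ?B \<and> ?g (?f p) = p" if "p \<in> ?A" for p
  proof -
    obtain x y where p: "p = (x, y)"
      by fastforce
    with that have p: "p = (x, y)" "x \<in> strips N" "y \<in> strips (Suc r)" "x 0 = y 0"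
      by (simp_all add: strip_pairs_def)
    obtain x' a where s: "shrink N x (y 1) = (x', a)" by fastforce
    have y: "interlace (y 1) (x 0)" "(\<lambda>t. y (Suc t)) \<in> strips r" "\<And>k. 0 < y 1 k"
      using p(3,4) by (simp_all add: strips_Suc_iff) (simp add: strips_def)
    show ?thesis
      using shrink_grow[OF p(2) y(3,1) s] s y(2) case_nat_Suc_eta[of y]
      by (simp add: strip_pairs_def p(1,4))
  qed
  have 2: "?g q \<in> ?A \<and> ?f (?g q) = q" if q: "q \<in> ?B" for q
  proof -
    obtain x y a where "q = ((x, y), a)"
      by (metis surj_pair)
    with q have q: "q = ((x, y), a)" "x \<in> strips N" "y \<in> strips r" "x 0 = y 0" "a \<in> seqs N"
      by (simp_all add: strip_pairs_def)
    note G = grow_shrink[OF q(2,5)]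
    then have "0 < grow N x a 0 k" for k
      by (simp add: strips_def)
    with G q show ?thesis
      by (simp add: strip_pairs_def strips_Suc_iff)
  qed
  show ?thesis
    by (rule bij_betw_byWitness[where f' = ?g]) (use 1 2 in blast)+
qed

text \<open>When a row is removed, the factor of \<open>y 1\<close> passes from the lower strip to
  the new main diagonal and turns \<open>strip_weight c\<close> into
  \<open>strip_weight (Suc c)\<close>. So the row index is added to the exponent, and the induction
  needs all \<open>c\<close> at once. The case \<open>c = 1\<close> is the product of all
  entries.\<close>

theorem strip_pairs_arrays:
  "\<exists>f. bij_betw f (strip_pairs r N) (arrays r N) \<and>
     (\<forall>p\<in>strip_pairs r N. \<forall>c. strip_weight c N (fst p) * (\<Prod>t<r. support_prod (snd p (Suc t)))
        = (\<Prod>a<r. \<Prod>t<N. f p a t ^ (a + t + c)))"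
proof (induction r)
  case 0
  have "strip_pairs 0 N = {(\<lambda>_ _. 1, \<lambda>_ _. 1)}"
  proof -
    have "x = (\<lambda>_ _. 1)" if x: "x \<in> strips N" and x0: "x 0 = (\<lambda>_. 1)" for x
    proof -
      have "x t = (\<lambda>_. 1)" for t
      proof (induction t)
        case (Suc t)
        have "interlace (x (Suc t)) (x t)"
          using x by (simp add: strips_def)
        then show ?case
          using Suc by (simp add: interlace_1)
      qed (rule x0)
      then show ?thesis by auto
    qed
    moreover have "(\<lambda>_ _. 1) \<in> strips N"
      by (auto simp: strips_def interlace_def)
    ultimately have "(x, y) \<in> strip_pairs 0 N \<longleftrightarrow> (x, y) = (\<lambda>_ _. 1, \<lambda>_ _. 1)" for x y
      unfolding strip_pairs_def strips_0 by fastforce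
    then show ?thesis
      by auto
  qed
  moreover have "arrays 0 N = {\<lambda>_ _. 1}"
    by (auto simp: arrays_def fun_eq_iff)
  ultimately show ?case
    by (intro exI[of _ "\<lambda>_ _ _. 1"]) (auto simp: strip_weight_def support_prod_def)
next
  case (Suc r)
  then obtain f where f: "bij_betw f (strip_pairs r N) (arrays r N)"
    and w: "\<And>p c. p \<in> strip_pairs r N \<Longrightarrow> strip_weight c N (fst p) * (\<Prod>t<r. support_prod (snd p (Suc t)))
        = (\<Prod>a<r. \<Prod>t<N. f p a t ^ (a + t + c))"
    by blast
  let ?g = "\<lambda>(x, y). case shrink N x (y 1) of (x', a) \<Rightarrow> ((x', \<lambda>t. y (Suc t)), a :: nat \<Rightarrow> nat)"
  note g = strip_pairs_Suc_bij[of N r]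
  have h: "bij_betw (\<lambda>(A, a). case_nat a A) (arrays r N \<times> seqs N) (arrays (Suc r) N)"
    by (rule bij_betw_byWitness[where f' = "\<lambda>A. (\<lambda>a. A (Suc a), A 0)"])
      (auto simp: arrays_Suc_iff case_nat_Suc_eta)
  let ?F = "(\<lambda>(A, a). case_nat a A) \<circ> (map_prod f id \<circ> ?g)"
  have "bij_betw ?F (strip_pairs (Suc r) N) (arrays (Suc r) N)"
    by (intro bij_betw_trans[OF bij_betw_trans[OF g bij_betw_map_prod] h] f bij_betw_id)
  moreover have "strip_weight c N (fst p) * (\<Prod>t<Suc r. support_prod (snd p (Suc t)))
        = (\<Prod>a<Suc r. \<Prod>t<N. ?F p a t ^ (a + t + c))" if p: "p \<in> strip_pairs (Suc r) N" for p c
  proof -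
    obtain x y where "p = (x, y)"
      by fastforce
    with p have xy: "p = (x, y)" "x \<in> strips N" "y \<in> strips (Suc r)" "x 0 = y 0"
      by (simp_all add: strip_pairs_def)
    obtain x' a where s: "shrink N x (y 1) = (x', a)" by fastforce
    have y: "interlace (y 1) (x 0)" "\<And>k. 0 < y 1 k"
      using xy(3,4) by (simp_all add: strips_Suc_iff) (simp add: strips_def)
    let ?p = "(x', \<lambda>t. y (Suc t))"
    have p': "?p \<in> strip_pairs r N"
      using bij_betwE[OF g] p xy s by fastforce
    have x'0: "x' 0 = y 1"
      using shrink_grow[OF xy(2) y(2,1) s] by simp
    have "strip_weight c N x * (\<Prod>t<Suc r. support_prod (y (Suc t))) =
       (\<Prod>t<N. a t ^ (t + c)) * (strip_weight (Suc c) N x' * (\<Prod>t<r. support_prod (y (Suc (Suc t)))))"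
      unfolding strip_weight_shrink[OF xy(2) y(2,1) s] prod.lessThan_Suc_shift
      by (simp add: strip_weight_def x'0 mult_ac)
    also have "\<dots> = (\<Prod>t<N. a t ^ (t + c)) * (\<Prod>a<r. \<Prod>t<N. f ?p a t ^ (a + t + Suc c))"
      using w[OF p', of "Suc c"] by simp
    also have "\<dots> = (\<Prod>a<Suc r. \<Prod>t<N. ?F p a t ^ (a + t + c))"
      unfolding prod.lessThan_Suc_shift using s by (simp add: xy)
    finally show ?thesis by (simp add: xy)
  qed
  ultimately show ?case by blast
qed

section \<open>Plane partitions in a box\<close>

definition planes :: "nat \<Rightarrow> nat \<Rightarrow> (nat \<Rightarrow> nat \<Rightarrow> nat) set" where
  "planes r N = {D. (\<forall>i j. 0 < D i j) \<and> (\<forall>i j. D i (Suc j) dvd D i j) \<and>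
     (\<forall>i j. D (Suc i) j dvd D i j) \<and> (\<forall>i j. r \<le> i \<or> N \<le> j \<longrightarrow> D i j = 1)}"

lemma strips_dvd_0: "x \<in> strips N \<Longrightarrow> x t k dvd x 0 k"
proof (induction t)
  case (Suc t)
  have "x (Suc t) k dvd x t k"
    using Suc.prems by (simp add: strips_def interlace_def)
  then show ?case
    using Suc dvd_trans by blast
qed simp

text \<open>The \<open>case\<close> expression repeats the inverse map of
  \<open>planes_strip_pairs_bij\<close> literally. The condition \<open>x 0 = y 0\<close> glues the
  two halves along the main diagonal.\<close>

lemma planes_of_strip_pair:
  assumes "(x, y) \<in> strip_pairs r N"
  shows "(case (x, y) of (x, y) \<Rightarrow> \<lambda>i j. if i \<le> j then x (j - i) i else y (i - j) j) \<in> planes r N"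
proof -
  have x: "x \<in> strips N" and y: "y \<in> strips r" and 0: "y 0 = x 0"
    using assms by (simp_all add: strip_pairs_def)
  have pos: "0 < x t k" "0 < y t k" for t k
    using x y by (simp_all add: strips_def)
  have dx: "x (Suc t) k dvd x t k" "x t (Suc k) dvd x (Suc t) k" for t k
    using x by (simp_all add: strips_def interlace_def)
  have dy: "y (Suc t) k dvd y t k" "y t (Suc k) dvd y (Suc t) k" for t k
    using y by (simp_all add: strips_def interlace_def)
  let ?D = "\<lambda>i j. if i \<le> j then x (j - i) i else y (i - j) j"
  have 1: "?D i (Suc j) dvd ?D i j" for i j
  proof -
    consider "i \<le> j" | "i = Suc j" | k where "i = Suc (Suc j) + k"
      by (metis le_Suc_eq less_natE not_less_eq_eq add_Suc linorder_not_le)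
    then show ?thesis
    proof cases
      case 1 then show ?thesis using dx(1)[of "j - i" i] by (simp add: Suc_diff_le)
    next
      case 2 then show ?thesis using dy(2)[of 0 j] by (simp add: 0)
    next
      case 3 then show ?thesis using dy(2)[of "Suc k" j] by (simp add: Suc_diff_le)
    qed
  qed
  have 2: "?D (Suc i) j dvd ?D i j" for i j
  proof -
    consider "j < i" | "i = j" | k where "j = Suc i + k"
      by (metis less_iff_Suc_add linorder_neqE_nat add_Suc)
    then show ?thesis
    proof cases
      case 1 then show ?thesis using dy(1)[of "i - j" j] by (simp add: Suc_diff_le)
    next
      case 2 then show ?thesis using dy(1)[of 0 j] by (simp add: 0)
    next
      case 3 then show ?thesis using dx(2)[of k i] by (simp add: Suc_diff_le)
    qed
  qed
  \<comment> \<open>Each strip bounds only one of the two directions by itself. The other bound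
    passes through the main diagonal: its entry is 1 by the bound of the opposite strip, and all
    entries with that index divide it.\<close>
  have 3: "?D i j = 1" if "r \<le> i \<or> N \<le> j" for i j
  proof (cases "i \<le> j")
    case True
    have "x (j - i) i = 1"
    proof (cases "N \<le> j")
      case False
      then show ?thesis
        using that strips_dvd_0[OF x, of "j - i" i] strips_eq_1[OF y, of 0 i] 0 by simp
    qed (use strips_eq_1[OF x] True in simp)
    with True show ?thesis by simp
  next
    case False
    have "y (i - j) j = 1"
    proof (cases "r \<le> i")
      case True
      then show ?thesis using strips_eq_1[OF y] False by simp
    next
      case r: False
      then show ?thesis
        using that strips_dvd_0[OF y, of "i - j" j] strips_eq_1[OF x, of 0 j] 0 by simp
    qed
    with False show ?thesis by simp
  qed
  show ?thesis
    unfolding planes_def prod.case using 1 2 3 pos by simp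
qed

lemma planes_strip_pairs_bij:
  "bij_betw (\<lambda>D. (\<lambda>t k. D k (k + t), \<lambda>t k. D (k + t) k)) (planes r N) (strip_pairs r N)"
  (is "bij_betw ?f _ _")
proof (rule bij_betw_byWitness)
  let ?g = "\<lambda>(x, y) i j. if i \<le> j then x (j - i) i else y (i - j) j"
  show "\<forall>D\<in>planes r N. ?g (?f D) = D"
    by (auto simp: fun_eq_iff)
  show "\<forall>p\<in>strip_pairs r N. ?f (?g p) = p"
  proof
    fix p assume p: "p \<in> strip_pairs r N"
    obtain x y where "p = (x, y)" by fastforce
    with p have "p = (x, y)" "\<And>k. x 0 k = y 0 k"
      by (simp_all add: strip_pairs_def)
    then show "?f (?g p) = p"
      by (auto simp: fun_eq_iff)
  qed
  show "?f ` planes r N \<subseteq> strip_pairs r N"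
  proof (rule image_subsetI)
    fix D assume D: "D \<in> planes r N"
    then have "interlace (\<lambda>k. D k (k + Suc t)) (\<lambda>k. D k (k + t))"
      "interlace (\<lambda>k. D (k + Suc t) k) (\<lambda>k. D (k + t) k)" for t
      by (auto simp: planes_def interlace_def)
    with D show "?f D \<in> strip_pairs r N"
      by (auto simp: strip_pairs_def strips_def planes_def)
  qed
  show "?g ` strip_pairs r N \<subseteq> planes r N"
  proof (rule image_subsetI)
    fix p assume "p \<in> strip_pairs r N"
    then show "?g p \<in> planes r N"
      using planes_of_strip_pair[of "fst p" "snd p" r N] by (simp only: prod.collapse)
  qed
qed

lemma support_prod_box:
  fixes f :: "nat \<Rightarrow> nat \<Rightarrow> nat"
  assumes "\<And>i j. M \<le> i \<or> N \<le> j \<Longrightarrow> f i j = 1"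
  shows "support_prod (\<lambda>(i, j). f i j) = (\<Prod>i<M. \<Prod>j<N. f i j)"
proof -
  have "support_prod (\<lambda>(i, j). f i j) = (\<Prod>(i, j)\<in>{..<M} \<times> {..<N}. f i j)"
    by (rule support_prod_superset) (use assms not_le in auto)
  then show ?thesis
    by (simp add: prod.cartesian_product)
qed

text \<open>The triangle is exchanged for a parallelogram that differs from it only in entries equal
  to 1; sheared along the diagonals, the parallelogram is a rectangle.\<close>

lemma prod_upper_diagonals:
  fixes D :: "nat \<Rightarrow> nat \<Rightarrow> nat"
  assumes M: "N < M" and one: "\<And>i j. D i j \<noteq> Suc 0 \<Longrightarrow> j < N"
  shows "(\<Prod>(i, j)\<in>{(i, j). i < M \<and> j < M \<and> i \<le> j}. D i j) = (\<Prod>(t, k)\<in>{..<Suc N} \<times> {..<M}. D k (k + t))"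
proof -
  let ?U = "{(i, j). i < M \<and> j < M \<and> i \<le> j}" and ?V = "{(i, j). i < M \<and> i \<le> j \<and> j \<le> i + N}"
  have "(\<Prod>u\<in>?U. case_prod D u) = (\<Prod>u\<in>?V. case_prod D u)"
  proof (rule prod.mono_neutral_cong)
    show "finite ?U"
      by (rule finite_subset[of _ "{..<M} \<times> {..<M}"]) auto
    show "finite ?V"
      by (rule finite_subset[of _ "{..<M} \<times> {..<M+N}"]) auto
    show "\<And>u. u \<in> ?V - ?U \<Longrightarrow> case_prod D u = 1" "\<And>u. u \<in> ?U - ?V \<Longrightarrow> case_prod D u = 1"
      using M by (auto dest!: one)
  qed simp
  also have "\<dots> = (\<Prod>u\<in>{..<Suc N} \<times> {..<M}. case u of (t, k) \<Rightarrow> D k (k + t))"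
    by (rule prod.reindex_bij_witness[where i = "\<lambda>(t, k). (k, k + t)" and j = "\<lambda>(i, j). (j - i, i)"]) auto
  finally show ?thesis .
qed

lemma prod_lower_diagonals:
  fixes D :: "nat \<Rightarrow> nat \<Rightarrow> nat"
  assumes M: "r < M" and one: "\<And>i j. D i j \<noteq> Suc 0 \<Longrightarrow> i < r"
  shows "(\<Prod>(i, j)\<in>{(i, j). i < M \<and> j < M \<and> j < i}. D i j) = (\<Prod>(t, k)\<in>{..<r} \<times> {..<M}. D (k + Suc t) k)"
proof -
  let ?U = "{(i, j). i < M \<and> j < M \<and> j < i}" and ?V = "{(i, j). j < M \<and> j < i \<and> i \<le> j + r}"
  have "(\<Prod>u\<in>?U. case_prod D u) = (\<Prod>u\<in>?V. case_prod D u)"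
  proof (rule prod.mono_neutral_cong)
    show "finite ?U"
      by (rule finite_subset[of _ "{..<M} \<times> {..<M}"]) auto
    show "finite ?V"
      by (rule finite_subset[of _ "{..<M+r} \<times> {..<M}"]) auto
    show "\<And>u. u \<in> ?V - ?U \<Longrightarrow> case_prod D u = 1" "\<And>u. u \<in> ?U - ?V \<Longrightarrow> case_prod D u = 1"
      using M by (auto dest!: one)
  qed simp
  also have "\<dots> = (\<Prod>u\<in>{..<r} \<times> {..<M}. case u of (t, k) \<Rightarrow> D (k + Suc t) k)"
    by (rule prod.reindex_bij_witness[where i = "\<lambda>(t, k). (k + Suc t, k)" and j = "\<lambda>(i, j). (i - Suc j, j)"]) auto
  finally show ?thesis .
qed
text \<open>The entries are multiplied diagonal by diagonal. The main diagonal is counted in the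
  upper strip only, hence the parameter 1 and the shift \<open>Suc t\<close> in the lower
  one.\<close>

lemma planes_weight:
  assumes D: "D \<in> planes r N"
  shows "support_prod (\<lambda>(i, j). D i j) =
    strip_weight 1 N (\<lambda>t k. D k (k + t)) * (\<Prod>t<r. support_prod (\<lambda>k. D (k + Suc t) k))"
proof -
  \<comment> \<open>Any square that exceeds the box in both directions would do: all entries outside
    the box are 1.\<close>
  define M where "M = Suc (r + N)"
  have M: "r < M" "N < M"
    by (simp_all add: M_def)
  have one: "D i j = 1" if "r \<le> i \<or> N \<le> j" for i j
    using D that by (auto simp: planes_def)
  have one': "D i j \<noteq> 1 \<Longrightarrow> i < r \<and> j < N" for i j
    using one by (meson not_le)
  let ?U = "{(i, j). i < M \<and> j < M \<and> i \<le> j}" and ?L = "{(i, j). i < M \<and> j < M \<and> j < i}"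
  have fin: "finite ?U" "finite ?L"
    by (rule finite_subset[of _ "{..<M} \<times> {..<M}"]; auto)+
  have "support_prod (\<lambda>(i, j). D i j) = (\<Prod>(i, j)\<in>{..<M} \<times> {..<M}. D i j)"
    by (subst support_prod_box[where M = M and N = M]) (use M in \<open>auto simp: one prod.cartesian_product\<close>)
  also have "\<dots> = (\<Prod>(i, j)\<in>?U \<union> ?L. D i j)"
    by (rule prod.cong) auto
  also have "\<dots> = (\<Prod>(i, j)\<in>?U. D i j) * (\<Prod>(i, j)\<in>?L. D i j)"
    by (rule prod.union_disjoint[OF fin]) auto
  also have "(\<Prod>(i, j)\<in>?U. D i j) = (\<Prod>(t, k)\<in>{..<Suc N} \<times> {..<M}. D k (k + t))"
    by (rule prod_upper_diagonals) (use M one' in auto)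
  also have "(\<Prod>(i, j)\<in>?L. D i j) = (\<Prod>(t, k)\<in>{..<r} \<times> {..<M}. D (k + Suc t) k)"
    by (rule prod_lower_diagonals) (use M one' in auto)
  finally have "support_prod (\<lambda>(i, j). D i j) =
      (\<Prod>t<Suc N. \<Prod>k<M. D k (k + t)) * (\<Prod>t<r. \<Prod>k<M. D (k + Suc t) k)"
    unfolding prod.cartesian_product .
  moreover have "support_prod (\<lambda>k. D k (k + t)) = (\<Prod>k<M. D k (k + t))" for t
    by (rule support_prod_eq) (use M in \<open>simp add: one\<close>)
  moreover have "support_prod (\<lambda>k. D (k + Suc t) k) = (\<Prod>k<M. D (k + Suc t) k)" for t
    by (rule support_prod_eq) (use M in \<open>simp add: one\<close>)
  moreover have "strip_weight 1 N (\<lambda>t k. D k (k + t)) = (\<Prod>t<Suc N. support_prod (\<lambda>k. D k (k + t)))"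
    unfolding prod.lessThan_Suc_shift strip_weight_def by simp
  ultimately show ?thesis
    by (simp only:)
qed

lemma card_weight_bij:
  assumes "bij_betw g X Y" "\<And>x. x \<in> X \<Longrightarrow> w (g x) = v x"
  shows "card {x \<in> X. v x = n} = card {y \<in> Y. w y = n}"
proof -
  have "bij_betw g {x \<in> X. v x = n} {y \<in> Y. w y = n}"
    using assms unfolding bij_betw_def inj_on_def by force
  then show ?thesis
    by (rule bij_betw_same_card)
qed

theorem card_planes:
  "card {D \<in> planes r N. support_prod (\<lambda>(i, j). D i j) = n} =
   card {A \<in> arrays r N. support_prod (\<lambda>(a, t). A a t ^ (a + t + 1)) = n}"
proof -
  obtain f where f: "bij_betw f (strip_pairs r N) (arrays r N)"
    and w: "\<And>p. p \<in> strip_pairs r N \<Longrightarrow> strip_weight 1 N (fst p) * (\<Prod>t<r. support_prod (snd p (Suc t)))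
        = (\<Prod>a<r. \<Prod>t<N. f p a t ^ (a + t + 1))"
    using strip_pairs_arrays[of r N] by blast
  define g where "g D = f (\<lambda>t k. D k (k + t), \<lambda>t k. D (k + t) k)" for D :: "nat \<Rightarrow> nat \<Rightarrow> nat"
  have g: "bij_betw g (planes r N) (arrays r N)"
    using bij_betw_trans[OF planes_strip_pairs_bij f] by (simp add: g_def[abs_def] o_def)
  have w': "support_prod (\<lambda>(a, t). g D a t ^ (a + t + 1)) = support_prod (\<lambda>(i, j). D i j)"
    if D: "D \<in> planes r N" for D
  proof -
    have "support_prod (\<lambda>(a, t). g D a t ^ (a + t + 1)) = (\<Prod>a<r. \<Prod>t<N. g D a t ^ (a + t + 1))"
      by (rule support_prod_box) (use bij_betwE[OF g] D in \<open>auto simp: arrays_def\<close>)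
    also have "\<dots> = support_prod (\<lambda>(i, j). D i j)"
      using w[OF bij_betwE[OF planes_strip_pairs_bij, rule_format, OF D]]
      by (simp add: planes_weight[OF D] g_def)
    finally show ?thesis .
  qed
  show ?thesis
    by (rule card_weight_bij[OF g]) (rule w')
qed

section \<open>Plane partitions with bounded number of rows\<close>

definition plane_partitions :: "enat \<Rightarrow> (nat \<Rightarrow> nat \<Rightarrow> nat) set" where
  "plane_partitions r = {D. (\<forall>i j. 0 < D i j) \<and> (\<forall>i j. D i (Suc j) dvd D i j) \<and>
     (\<forall>i j. D (Suc i) j dvd D i j) \<and> finite {(i, j). D i j \<noteq> 1} \<and>
     (\<forall>i j. r \<le> enat i \<longrightarrow> D i j = 1)}"

definition pos_funs :: "'a set \<Rightarrow> ('a \<Rightarrow> nat) set" where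
  "pos_funs S = {A. (\<forall>u. 0 < A u) \<and> (\<forall>u. u \<notin> S \<longrightarrow> A u = 1)}"

lemma dvd_support_prod:
  fixes f :: "'a \<Rightarrow> nat"
  assumes "finite {u. f u \<noteq> 1}"
  shows "f u dvd support_prod f"
proof (cases "f u = 1")
  case False
  with assms show ?thesis
    unfolding support_prod_def by (intro dvd_prodI) auto
qed simp

lemma less_of_power_le: "2 ^ k \<le> (n::nat) \<Longrightarrow> k < n"
  by (meson less_exp order_less_le_trans)

text \<open>A nontrivial entry makes all entries above it and to its left nontrivial, hence at least
  2, so 2^(i+1) and 2^(j+1) are at most \<open>n\<close>.\<close>

lemma plane_partition_support:
  assumes D: "D \<in> plane_partitions r" "D i j \<noteq> 1" "support_prod (\<lambda>(i, j). D i j) = n"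
  shows "i < n" "j < n"
proof -
  let ?f = "\<lambda>(i, j). D i j"
  have pos: "0 < D i j" for i j
    using D(1) by (simp add: plane_partitions_def)
  have fin: "finite {u. ?f u \<noteq> 1}"
    using D(1) by (simp add: plane_partitions_def case_prod_unfold)
  have le: "2 ^ card S \<le> n" if S: "\<And>u. u \<in> S \<Longrightarrow> ?f u \<noteq> 1" for S
  proof -
    have f: "finite S"
      using S by (intro finite_subset[OF _ fin]) auto
    have "2 ^ card S = (\<Prod>u\<in>S. 2 :: nat)"
      by simp
    also have "\<dots> \<le> (\<Prod>u\<in>S. ?f u)"
    proof (intro prod_mono conjI)
      fix u assume "u \<in> S"
      obtain i j where [simp]: "u = (i, j)" by fastforce
      show "2 \<le> ?f u" using S[OF \<open>u \<in> S\<close>] pos[of i j] by simp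
    qed simp
    also have "\<dots> \<le> support_prod ?f"
      unfolding support_prod_def
      by (rule dvd_imp_le[OF prod_dvd_prod_subset]) (use fin S pos in \<open>auto intro!: prod_pos\<close>)
    finally show ?thesis
      using D(3) by simp
  qed
  have "D (i' + k) j dvd D i' j" for i' k
    by (induction k) (use D(1) dvd_trans in \<open>auto simp: plane_partitions_def\<close>)
  then have 1: "D i' j \<noteq> 1" if "i' \<le> i" for i'
    using that D(2) by (metis nat_dvd_1_iff_1 le_iff_add)
  have "D i (j' + k) dvd D i j'" for j' k
    by (induction k) (use D(1) dvd_trans in \<open>auto simp: plane_partitions_def\<close>)
  then have 2: "D i j' \<noteq> 1" if "j' \<le> j" for j'
    using that D(2) by (metis nat_dvd_1_iff_1 le_iff_add)
  have "2 ^ card ((\<lambda>i'. (i', j)) ` {..i}) \<le> n" "2 ^ card ((\<lambda>j'. (i, j')) ` {..j}) \<le> n"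
    using 1 2 by (auto intro!: le)
  moreover have "card ((\<lambda>i'. (i', j)) ` {..i}) = Suc i" "card ((\<lambda>j'. (i, j')) ` {..j}) = Suc j"
    by (subst card_image; simp add: inj_on_def)+
  ultimately show "i < n" "j < n"
    using less_of_power_le Suc_lessD by metis+
qed

lemma pos_funs_support:
  fixes w :: "'a \<Rightarrow> nat"
  assumes "A \<in> pos_funs S" "finite {u. A u \<noteq> 1}" "support_prod (\<lambda>u. A u ^ w u) = n" "A u \<noteq> 1"
  shows "w u < n"
proof -
  have pos: "0 < A u" for u
    using assms(1) by (simp add: pos_funs_def)
  have "A u ^ w u dvd support_prod (\<lambda>u. A u ^ w u)"
    by (rule dvd_support_prod) (rule finite_subset[OF _ assms(2)], auto)
  moreover have "0 < support_prod (\<lambda>u. A u ^ w u)"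
    using pos by (intro support_prod_pos) simp
  ultimately have "A u ^ w u \<le> n"
    using assms(3) by (auto dest: dvd_imp_le)
  moreover have "2 ^ w u \<le> A u ^ w u"
    using pos[of u] assms(4) by (intro power_mono) auto
  ultimately show ?thesis
    using less_of_power_le by simp
qed

text \<open>Weight \<open>n\<close> confines both kinds of arrays to a finite box, where
  \<open>card_planes\<close> applies. On the right the cells form a triangle and not the box, so
  that each exponent up to \<open>M\<close> is later met with its full multiplicity.\<close>

theorem card_plane_partitions:
  fixes r :: enat
  assumes "n \<le> M"
  defines "S \<equiv> {(a, t). enat a < r \<and> a + t < M}"
  shows "finite {D \<in> plane_partitions r. support_prod (\<lambda>(i, j). D i j) = n}"
   "card {D \<in> plane_partitions r. support_prod (\<lambda>(i, j). D i j) = n} =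
    card {A \<in> pos_funs S. support_prod (\<lambda>(a, t). A (a, t) ^ (a + t + 1)) = n}"
proof -
  \<comment> \<open>The minimum of \<open>r\<close> and \<open>n\<close>, in a form that treats
    finite and infinite \<open>r\<close> alike.\<close>
  obtain R where R: "\<And>i. i < R \<longleftrightarrow> enat i < r \<and> i < n"
  proof (cases r)
    case (enat r')
    then show ?thesis using that[of "min r' n"] by auto
  next
    case infinity
    then show ?thesis using that[of n] by auto
  qed
  have eq: "D \<in> plane_partitions r \<and> support_prod (\<lambda>(i, j). D i j) = n \<longleftrightarrow>
     D \<in> planes R n \<and> support_prod (\<lambda>(i, j). D i j) = n" for D
  proof (rule iffI; elim conjE)
    assume D: "D \<in> plane_partitions r" "support_prod (\<lambda>(i, j). D i j) = n"
    have "D i j = 1" if "R \<le> i \<or> n \<le> j" for i j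
    proof (rule ccontr)
      assume "D i j \<noteq> 1"
      then have "i < n" "j < n" "\<not> r \<le> enat i"
        using plane_partition_support[OF D(1) _ D(2), of i j] D(1)
        by (auto simp: plane_partitions_def)
      with that R[of i] show False
        by auto
    qed
    with D show "D \<in> planes R n \<and> support_prod (\<lambda>(i, j). D i j) = n"
      unfolding planes_def plane_partitions_def by simp
  next
    assume D: "D \<in> planes R n" "support_prod (\<lambda>(i, j). D i j) = n"
    then have one: "D i j = 1" if "R \<le> i \<or> n \<le> j" for i j
      using that unfolding planes_def by auto
    have "{(i, j). D i j \<noteq> 1} \<subseteq> {..<R} \<times> {..<n}"
      using one by (auto simp: not_le[symmetric])
    then have "finite {(i, j). D i j \<noteq> 1}"
      by (rule finite_subset) simp
    moreover have "D i j = 1" if "r \<le> enat i" for i j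
    proof -
      have "R \<le> i"
        using that R[of i] by auto
      then show ?thesis
        using one by simp
    qed
    ultimately show "D \<in> plane_partitions r \<and> support_prod (\<lambda>(i, j). D i j) = n"
      using D unfolding planes_def plane_partitions_def by simp
  qed
  have eq1: "{D \<in> plane_partitions r. support_prod (\<lambda>(i, j). D i j) = n} =
     {D \<in> planes R n. support_prod (\<lambda>(i, j). D i j) = n}"
    using eq by simp
  have finS: "finite S"
    unfolding S_def by (rule finite_subset[of _ "{..<M} \<times> {..<M}"]) auto
  let ?w = "\<lambda>u :: nat \<times> nat. fst u + snd u + 1"
  have pos: "A \<in> pos_funs S \<and> support_prod (\<lambda>u. A u ^ ?w u) = n \<longleftrightarrow>
    curry A \<in> arrays R n \<and> support_prod (\<lambda>u. A u ^ ?w u) = n" for A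
  proof (rule iffI; elim conjE)
    assume A: "A \<in> pos_funs S" "support_prod (\<lambda>u. A u ^ ?w u) = n"
    have "A (a, t) = 1" if "R \<le> a \<or> n \<le> t" for a t
    proof (rule ccontr)
      assume *: "A (a, t) \<noteq> 1"
      have "finite {u. A u \<noteq> 1}"
        using A(1) by (intro finite_subset[OF _ finS]) (auto simp: pos_funs_def)
      from pos_funs_support[OF A(1) this A(2) *] have "a + t + 1 < n"
        by simp
      moreover have "(a, t) \<in> S"
        using * A(1) by (auto simp: pos_funs_def)
      ultimately show False
        using that R[of a] by (auto simp: S_def)
    qed
    with A show "curry A \<in> arrays R n \<and> support_prod (\<lambda>u. A u ^ ?w u) = n"
      by (simp add: arrays_def pos_funs_def)
  next
    assume A: "curry A \<in> arrays R n" "support_prod (\<lambda>u. A u ^ ?w u) = n"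
    have one: "A (a, t) = 1" if "R \<le> a \<or> n \<le> t" for a t
      using A(1) that by (auto simp: arrays_def)
    have sub: "{u. A u \<noteq> 1} \<subseteq> {..<R} \<times> {..<n}"
      using one by (auto simp: not_le[symmetric])
    have U: "A \<in> pos_funs UNIV"
      using A(1) by (simp add: arrays_def pos_funs_def)
    have "A (a, t) = 1" if "(a, t) \<notin> S" for a t
    proof (rule ccontr)
      assume *: "A (a, t) \<noteq> 1"
      then have "a < R"
        using one by (meson not_le)
      moreover have "a + t + 1 < n"
        using pos_funs_support[OF U finite_subset[OF sub] A(2) *] by simp
      ultimately show False
        using that \<open>n \<le> M\<close> R[of a] by (auto simp: S_def)
    qed
    with U A(2) show "A \<in> pos_funs S \<and> support_prod (\<lambda>u. A u ^ ?w u) = n"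
      by (simp add: pos_funs_def)
  qed
  have w: "(\<lambda>(a, t). A (a, t) ^ (a + t + 1)) = (\<lambda>u. A u ^ ?w u)" for A :: "nat \<times> nat \<Rightarrow> nat"
    by (auto simp: fun_eq_iff)
  have "bij_betw curry UNIV UNIV"
    by (rule bij_betw_byWitness[where f' = case_prod]) auto
  then have "bij_betw curry {A. curry A \<in> arrays R n} (arrays R n)"
    by (auto simp: bij_betw_def inj_on_def)
  then have "card {A \<in> {A. curry A \<in> arrays R n}. support_prod (\<lambda>u. A u ^ ?w u) = n} =
      card {A \<in> arrays R n. support_prod (\<lambda>(a, t). A a t ^ (a + t + 1)) = n}"
    by (rule card_weight_bij) (simp add: case_prod_unfold)
  then show "card {D \<in> plane_partitions r. support_prod (\<lambda>(i, j). D i j) = n} =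
      card {A \<in> pos_funs S. support_prod (\<lambda>(a, t). A (a, t) ^ (a + t + 1)) = n}"
    unfolding eq1 card_planes w pos by simp
  show "finite {D \<in> plane_partitions r. support_prod (\<lambda>(i, j). D i j) = n}"
  proof (rule finite_subset)
    let ?B = "{..<n} \<times> {..<n}"
    let ?g = "\<lambda>f i j. if (i, j) \<in> ?B then f (i, j) else 1"
    show "{D \<in> plane_partitions r. support_prod (\<lambda>(i, j). D i j) = n} \<subseteq> ?g ` (\<Pi>\<^sub>E u\<in>?B. {..n})"
    proof
      fix D assume "D \<in> {D \<in> plane_partitions r. support_prod (\<lambda>(i, j). D i j) = n}"
      then have D: "D \<in> plane_partitions r" "support_prod (\<lambda>(i, j). D i j) = n"
        by simp_all
      let ?f = "restrict (\<lambda>(i, j). D i j) ?B"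
      have "D i j \<le> n" for i j
      proof -
        have "(case (i, j) of (i, j) \<Rightarrow> D i j) dvd support_prod (\<lambda>(i, j). D i j)"
          by (rule dvd_support_prod) (use D(1) in \<open>simp add: plane_partitions_def case_prod_unfold\<close>)
        moreover have "0 < support_prod (\<lambda>(i, j). D i j)"
          by (rule support_prod_pos) (use D(1) in \<open>simp add: plane_partitions_def case_prod_unfold\<close>)
        ultimately show ?thesis
          using D(2) by (simp add: dvd_imp_le)
      qed
      then have "?f \<in> (\<Pi>\<^sub>E u\<in>?B. {..n})"
        by auto
      moreover have "D i j = ?g ?f i j" for i j
        using plane_partition_support[OF D(1) _ D(2), of i j] by auto
      then have "D = ?g ?f"
        by blast
      ultimately show "D \<in> ?g ` (\<Pi>\<^sub>E u\<in>?B. {..n})"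
        by blast
    qed
    show "finite ((\<lambda>f i j. if (i, j) \<in> ?B then f (i, j) else 1) ` (\<Pi>\<^sub>E u\<in>?B. {..n}))"
      by (intro finite_imageI finite_PiE) auto
  qed
qed

section \<open>Direct sums of cyclic groups\<close>

lemma comm_group_sum_group:
  assumes "\<And>i. comm_group (G i)"
  shows "comm_group (sum_group UNIV G)"
proof (rule group.group_comm_groupI)
  have g: "\<And>i. group (G i)"
    using assms by (simp add: comm_group_def)
  then show "group (sum_group UNIV G)"
    by simp
  show "x \<otimes>\<^bsub>sum_group UNIV G\<^esub> y = y \<otimes>\<^bsub>sum_group UNIV G\<^esub> x"
    if "x \<in> carrier (sum_group UNIV G)" "y \<in> carrier (sum_group UNIV G)" for x y
  proof -
    have "x i \<otimes>\<^bsub>G i\<^esub> y i = y i \<otimes>\<^bsub>G i\<^esub> x i" for i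
      using that assms[of i] by (intro comm_monoid.m_comm) (auto simp: carrier_sum_group g comm_group_def)
    then show ?thesis
      by simp
  qed
qed

lemma pow_sum_group:
  "(x [^]\<^bsub>sum_group UNIV G\<^esub> (n::nat)) i = x i [^]\<^bsub>G i\<^esub> n"
  by (induction n) (simp_all add: nat_pow_def)

text \<open>With almost all summands trivial, the finite-support condition holds automatically;
  restriction to the indices below \<open>K\<close> identifies the direct sum with a finite
  product.\<close>

lemma
  fixes G :: "nat \<Rightarrow> ('a, 'b) monoid_scheme" and K :: nat
  assumes grp: "\<And>i. group (G i)" and fin: "\<And>i. finite (carrier (G i))"
    and triv: "\<And>i. K \<le> i \<Longrightarrow> card (carrier (G i)) = 1"
  shows finite_sum_group: "finite (carrier (sum_group UNIV G))"
    and card_sum_group: "card (carrier (sum_group UNIV G)) = (\<Prod>i<K. card (carrier (G i)))"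
    and carrier_sum_group_trivial: "carrier (sum_group UNIV G) = {x. \<forall>i. x i \<in> carrier (G i)}"
proof -
  have one: "carrier (G i) = {\<one>\<^bsub>G i\<^esub>}" if "K \<le> i" for i
    using triv[OF that] grp[of i] by (metis card_1_singletonE group.is_monoid monoid.one_closed singletonD)
  show C: "carrier (sum_group UNIV G) = {x. \<forall>i. x i \<in> carrier (G i)}"
  proof -
    have "finite {i. x i \<noteq> \<one>\<^bsub>G i\<^esub>}" if x: "\<And>i. x i \<in> carrier (G i)" for x
    proof (rule finite_subset)
      have "x i = \<one>\<^bsub>G i\<^esub>" if "K \<le> i" for i
        using one[OF that] x[of i] by simp
      then have "i < K" if "x i \<noteq> \<one>\<^bsub>G i\<^esub>" for i
        using that by (cases "K \<le> i") auto
      then show "{i. x i \<noteq> \<one>\<^bsub>G i\<^esub>} \<subseteq> {..<K}"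
        by auto
    qed simp
    then show ?thesis
      by (auto simp: carrier_sum_group grp)
  qed
  have "bij_betw (\<lambda>x. restrict x {..<K}) {x. \<forall>i. x i \<in> carrier (G i)} (\<Pi>\<^sub>E i\<in>{..<K}. carrier (G i))"
  proof (rule bij_betw_byWitness[where f' = "\<lambda>x i. if i < K then x i else \<one>\<^bsub>G i\<^esub>"])
    show "\<forall>x\<in>{x. \<forall>i. x i \<in> carrier (G i)}. (\<lambda>i. if i < K then restrict x {..<K} i else \<one>\<^bsub>G i\<^esub>) = x"
      using one by (auto simp: fun_eq_iff not_less) (metis singletonD)
    show "\<forall>x\<in>\<Pi>\<^sub>E i\<in>{..<K}. carrier (G i). restrict (\<lambda>i. if i < K then x i else \<one>\<^bsub>G i\<^esub>) {..<K} = x"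
      by (auto simp: fun_eq_iff PiE_def extensional_def)
    show "(\<lambda>x. restrict x {..<K}) ` {x. \<forall>i. x i \<in> carrier (G i)} \<subseteq> (\<Pi>\<^sub>E i\<in>{..<K}. carrier (G i))"
      by (auto split: if_splits)
    show "(\<lambda>x i. if i < K then x i else \<one>\<^bsub>G i\<^esub>) ` (\<Pi>\<^sub>E i\<in>{..<K}. carrier (G i)) \<subseteq> {x. \<forall>i. x i \<in> carrier (G i)}"
      using grp by (auto simp: PiE_def Group.group_def intro: monoid.one_closed)
  qed
  note b = this[folded C]
  have "finite (\<Pi>\<^sub>E i\<in>{..<K}. carrier (G i))"
    using fin by (intro finite_PiE) auto
  then show "finite (carrier (sum_group UNIV G))"
    using bij_betw_finite[OF b] by blast
  show "card (carrier (sum_group UNIV G)) = (\<Prod>i<K. card (carrier (G i)))"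
    using bij_betw_same_card[OF b] by (simp add: card_PiE)
qed

definition divisor_chain :: "(nat \<Rightarrow> nat) \<Rightarrow> bool" where
  "divisor_chain d \<longleftrightarrow> (\<forall>i. 0 < d i) \<and> (\<forall>i. d (Suc i) dvd d i) \<and> finite {i. d i \<noteq> 1}"

definition cyclic_sum :: "(nat \<Rightarrow> nat) \<Rightarrow> (nat \<Rightarrow> int) monoid" where
  "cyclic_sum d = sum_group UNIV (\<lambda>i. integer_mod_group (d i))"

lemma card_integer_mod_group: "0 < n \<Longrightarrow> card (carrier (integer_mod_group n)) = n"
  by (simp add: carrier_integer_mod_group)

lemma divisor_chain_dvd:
  assumes "divisor_chain d" "i \<le> j"
  shows "d j dvd d i"
  using assms(2) by (induction rule: dec_induct) (use assms(1) in \<open>auto simp: divisor_chain_def intro: dvd_trans\<close>)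

context
  fixes d :: "nat \<Rightarrow> nat"
  assumes d: "divisor_chain d"
begin

lemma divisor_chain_pos: "0 < d i"
  using d by (simp add: divisor_chain_def)

lemma divisor_chain_bound: "\<exists>K. \<forall>i\<ge>K. d i = 1"
proof -
  have "finite {i. d i \<noteq> 1}" using d by (simp add: divisor_chain_def)
  then obtain K where "{i. d i \<noteq> 1} \<subseteq> {..<K}"
    using finite_nat_bounded by blast
  then show ?thesis
    by (intro exI[of _ K]) (auto simp: subset_iff leD)
qed

lemma comm_group_cyclic_sum: "comm_group (cyclic_sum d)"
  unfolding cyclic_sum_def by (rule comm_group_sum_group) simp

lemma group_cyclic_sum: "group (cyclic_sum d)"
  using comm_group_cyclic_sum by (simp add: comm_group_def)

lemma carrier_cyclic_sum: "carrier (cyclic_sum d) = {x. \<forall>i. 0 \<le> x i \<and> x i < int (d i)}"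
  and finite_cyclic_sum: "finite (carrier (cyclic_sum d))"
  and card_cyclic_sum: "card (carrier (cyclic_sum d)) = support_prod d"
proof -
  obtain K where K: "\<And>i. K \<le> i \<Longrightarrow> d i = 1"
    using divisor_chain_bound by blast
  let ?G = "\<lambda>i. integer_mod_group (d i)"
  have 1: "group (?G i)" "finite (carrier (?G i))" for i
    using divisor_chain_pos[of i] by (simp_all add: carrier_integer_mod_group)
  have 2: "card (carrier (?G i)) = 1" if "K \<le> i" for i
    using K[OF that] by (simp add: carrier_integer_mod_group)
  have "carrier (cyclic_sum d) = {x. \<forall>i. x i \<in> carrier (?G i)}"
    unfolding cyclic_sum_def by (rule carrier_sum_group_trivial[of ?G K]) (rule 1 2, assumption?)+
  then show "carrier (cyclic_sum d) = {x. \<forall>i. 0 \<le> x i \<and> x i < int (d i)}"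
    using divisor_chain_pos by (simp add: carrier_integer_mod_group)
  show "finite (carrier (cyclic_sum d))"
    unfolding cyclic_sum_def by (rule finite_sum_group[of ?G K]) (rule 1 2, assumption?)+
  have "support_prod d = (\<Prod>i<K. d i)"
    by (rule support_prod_superset) (use K not_le in auto)
  moreover have "card (carrier (cyclic_sum d)) = (\<Prod>i<K. card (carrier (?G i)))"
    unfolding cyclic_sum_def by (rule card_sum_group[of ?G K]) (rule 1 2, assumption?)+
  ultimately show "card (carrier (cyclic_sum d)) = support_prod d"
    using divisor_chain_pos by (simp add: card_integer_mod_group)
qed

end

lemma one_cyclic_sum: "\<one>\<^bsub>cyclic_sum d\<^esub> = (\<lambda>i. 0)"
  by (simp add: cyclic_sum_def restrict_def)

lemma mult_cyclic_sum: "x \<otimes>\<^bsub>cyclic_sum d\<^esub> y = (\<lambda>i. (x i + y i) mod int (d i))"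
  by (simp add: cyclic_sum_def restrict_def)

lemma pow_cyclic_sum: "x [^]\<^bsub>cyclic_sum d\<^esub> (n::nat) = (\<lambda>i. (int n * x i) mod int (d i))"
  by (simp add: cyclic_sum_def pow_sum_group fun_eq_iff)

text \<open>Injective homomorphisms in place of subgroups, so that groups over different element
  types can be compared.\<close>

definition embeds :: "('a, 'c) monoid_scheme \<Rightarrow> ('b, 'd) monoid_scheme \<Rightarrow> bool" where
  "embeds H G \<longleftrightarrow> (\<exists>f\<in>hom H G. inj_on f (carrier H))"

lemma embeds_trans: "embeds H G \<Longrightarrow> embeds G F \<Longrightarrow> embeds H F"
  unfolding embeds_def
proof (elim bexE)
  fix f g assume *: "f \<in> hom H G" "inj_on f (carrier H)" "g \<in> hom G F" "inj_on g (carrier G)"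
  then have "f ` carrier H \<subseteq> carrier G"
    by (auto simp: hom_def)
  with * show "\<exists>f\<in>hom H F. inj_on f (carrier H)"
    by (intro bexI[of _ "g \<circ> f"]) (auto intro: comp_inj_on inj_on_subset hom_compose)
qed

lemma iso_imp_embeds: "G \<cong> H \<Longrightarrow> embeds G H"
  by (auto simp: embeds_def is_iso_def iso_def bij_betw_def)

text \<open>Multiplication by \<open>d i div e i\<close> embeds the integers modulo
  \<open>e i\<close> into those modulo \<open>d i\<close>.\<close>

lemma embeds_cyclic_sum:
  assumes d: "divisor_chain d" and e: "divisor_chain e" and dvd: "\<And>i. e i dvd d i"
  shows "embeds (cyclic_sum e) (cyclic_sum d)"
proof -
  define q where "q i = int (d i div e i)" for i
  have dq: "int (d i) = int (e i) * q i" for i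
    unfolding q_def using dvd[of i] by (simp flip: of_nat_mult)
  have q: "0 < q i" for i
  proof -
    have "q i \<noteq> 0"
      using dq[of i] divisor_chain_pos[OF d, of i] by auto
    then show ?thesis
      by (simp add: q_def)
  qed
  let ?f = "\<lambda>x i. x i * q i"
  have "?f \<in> hom (cyclic_sum e) (cyclic_sum d)"
  proof (rule homI)
    fix x assume "x \<in> carrier (cyclic_sum e)"
    then show "?f x \<in> carrier (cyclic_sum d)"
      using q by (auto simp: carrier_cyclic_sum d e dq less_imp_le)
  next
    fix x y
    show "?f (x \<otimes>\<^bsub>cyclic_sum e\<^esub> y) = ?f x \<otimes>\<^bsub>cyclic_sum d\<^esub> ?f y"
      by (simp add: mult_cyclic_sum fun_eq_iff dq mult_mod_left distrib_right)
  qed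
  moreover have "inj_on ?f (carrier (cyclic_sum e))"
    using q by (auto simp: inj_on_def fun_eq_iff less_le)
  ultimately show ?thesis
    unfolding embeds_def by blast
qed

text \<open>The elements of order dividing \<open>p\<close> among the \<open>q\<close>-th powers; for \<open>q = p ^ (k - 1)\<close> they count
  the cyclic summands of order divisible by \<open>p ^ k\<close>.\<close>

definition power_torsion :: "nat \<Rightarrow> nat \<Rightarrow> ('a, 'b) monoid_scheme \<Rightarrow> 'a set" where
  "power_torsion p q G =
     {x \<in> carrier G. x [^]\<^bsub>G\<^esub> p = \<one>\<^bsub>G\<^esub> \<and> (\<exists>y\<in>carrier G. y [^]\<^bsub>G\<^esub> q = x)}"

lemma card_power_torsion_embeds:
  assumes "group H" "group G" "embeds H G" "finite (carrier G)"
  shows "card (power_torsion p q H) \<le> card (power_torsion p q G)"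
proof -
  obtain f where f: "f \<in> hom H G" "inj_on f (carrier H)"
    using assms by (auto simp: embeds_def)
  interpret group_hom H G f
    using assms f by (simp add: group_hom_def group_hom_axioms_def)
  show ?thesis
  proof (rule card_inj_on_le[where f = f])
    show "inj_on f (power_torsion p q H)"
      by (rule inj_on_subset[OF f(2)]) (auto simp: power_torsion_def)
    show "f ` power_torsion p q H \<subseteq> power_torsion p q G"
    proof (rule image_subsetI)
      fix x assume "x \<in> power_torsion p q H"
      then obtain y where y: "x \<in> carrier H" "x [^]\<^bsub>H\<^esub> p = \<one>\<^bsub>H\<^esub>" "y \<in> carrier H" "y [^]\<^bsub>H\<^esub> q = x"
        by (auto simp: power_torsion_def)
      have "f x [^]\<^bsub>G\<^esub> p = \<one>\<^bsub>G\<^esub>" "f y [^]\<^bsub>G\<^esub> q = f x"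
        using hom_nat_pow[of x p] hom_nat_pow[of y q] y by simp_all
      with y show "f x \<in> power_torsion p q G"
        by (auto simp: power_torsion_def)
    qed
    show "finite (power_torsion p q G)"
      using assms(4) by (simp add: power_torsion_def)
  qed
qed

text \<open>In each of the coordinates 0 to \<open>i\<close>, the \<open>p\<close> multiples of e_j
  / p are killed by \<open>p\<close> and are \<open>q\<close> times the corresponding multiples of
  e_j / (p q). The coordinates vary independently.\<close>

lemma power_torsion_lower:
  assumes e: "divisor_chain e" and pq: "0 < p" "0 < q" "p * q dvd e i"
  shows "p ^ Suc i \<le> card (power_torsion p q (cyclic_sum e))"
proof -
  have dvd: "p * q dvd e j" if "j \<le> i" for j
    using divisor_chain_dvd[OF e that] pq(3) dvd_trans by blast
  define u where "u j = int (e j div (p * q))" for j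
  have u: "int (e j) = int p * (int q * u j)" if "j \<le> i" for j
    unfolding u_def mult.assoc[symmetric] using dvd[OF that] by (simp flip: of_nat_mult)
  have u0: "0 < u j" if "j \<le> i" for j
  proof -
    have "u j \<noteq> 0"
      using u[OF that] divisor_chain_pos[OF e, of j] by auto
    then show ?thesis
      by (simp add: u_def)
  qed
  let ?x = "\<lambda>c j. if j \<le> i then int (c j) * (int q * u j) else 0"
  have "card (\<Pi>\<^sub>E j\<in>{..i}. {..<p}) \<le> card (power_torsion p q (cyclic_sum e))"
  proof (rule card_inj_on_le[where f = ?x])
    show "inj_on ?x (\<Pi>\<^sub>E j\<in>{..i}. {..<p})"
    proof (rule inj_onI, rule PiE_ext)
      fix c c' j assume eq: "?x c = ?x c'" and j: "j \<in> {..i}"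
      from fun_cong[OF eq, of j] j u0[of j] pq show "c j = c' j"
        by auto
    qed
    show "?x ` (\<Pi>\<^sub>E j\<in>{..i}. {..<p}) \<subseteq> power_torsion p q (cyclic_sum e)"
    proof (rule image_subsetI)
      fix c assume c: "c \<in> (\<Pi>\<^sub>E j\<in>{..i}. {..<p})"
      let ?y = "\<lambda>j. if j \<le> i then int (c j) * u j else 0"
      have cj: "int (c j) < int p" if "j \<le> i" for j
        using c that by auto
      have x: "?x c \<in> carrier (cyclic_sum e)"
        using cj u u0 pq divisor_chain_pos[OF e] by (auto simp: carrier_cyclic_sum e less_imp_le)
      moreover have "?y \<in> carrier (cyclic_sum e)"
      proof -
        have "int (c j) * u j < int (e j)" if "j \<le> i" for j
        proof -
          have "int (c j) * u j \<le> int (c j) * (int q * u j)"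
            using pq(2) u0[OF that] by (intro mult_left_mono) (auto simp: mult_le_cancel_right1)
          also have "\<dots> < int (e j)"
            using cj[OF that] u[OF that] u0[OF that] pq(2) by simp
          finally show ?thesis .
        qed
        then show ?thesis
          using u0 divisor_chain_pos[OF e] by (auto simp: carrier_cyclic_sum e less_imp_le)
      qed
      moreover have "?y [^]\<^bsub>cyclic_sum e\<^esub> q = ?x c"
      proof
        fix j
        have "\<forall>j. 0 \<le> ?x c j \<and> ?x c j < int (e j)"
          using x unfolding carrier_cyclic_sum[OF e] by (rule CollectD)
        note xj = spec[OF this, of j]
        have "int q * ?y j = ?x c j"
          by simp
        moreover have "0 \<le> ?x c j" "?x c j < int (e j)"
          using xj by (rule conjunct1, rule conjunct2)
        ultimately show "(?y [^]\<^bsub>cyclic_sum e\<^esub> q) j = ?x c j"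
          by (simp only: pow_cyclic_sum mod_pos_pos_trivial)
      qed
      moreover have "?x c [^]\<^bsub>cyclic_sum e\<^esub> p = \<one>\<^bsub>cyclic_sum e\<^esub>"
        using u by (auto simp: pow_cyclic_sum one_cyclic_sum fun_eq_iff mult_ac)
      ultimately show "?x c \<in> power_torsion p q (cyclic_sum e)"
        by (auto simp: power_torsion_def)
    qed
    show "finite (power_torsion p q (cyclic_sum e))"
      using finite_cyclic_sum[OF e] by (simp add: power_torsion_def)
  qed
  then show ?thesis
    by (simp add: card_PiE)
qed

text \<open>Only the coordinates below \<open>i\<close> can be nonzero, and each of them is a
  \<open>p\<close>-torsion element of a cyclic group, so it takes at most \<open>p\<close>
  values.\<close>

lemma power_torsion_upper:
  assumes d: "divisor_chain d" and p: "prime p" and ndvd: "\<not> p * p ^ k dvd d i"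
  shows "card (power_torsion p (p ^ k) (cyclic_sum d)) \<le> p ^ i"
proof -
  \<comment> \<open>If x_j = p^k y_j is killed by p, then d_j divides p^(k+1) y_j, and so it divides
    gcd(d_j, p^(k+1)) |y_j|. As p^(k+1) does not divide d_j, this gcd divides p^k, and d_j divides
    p^k y_j.\<close>
  have zero: "x j = 0" if x: "x \<in> power_torsion p (p ^ k) (cyclic_sum d)" and j: "i \<le> j" for x j
  proof -
    have nd: "\<not> p ^ Suc k dvd d j"
      using ndvd divisor_chain_dvd[OF d j] dvd_trans by auto
    have "gcd (d j) (p ^ Suc k) dvd p ^ Suc k"
      by simp
    then obtain v where v: "v \<le> Suc k" "gcd (d j) (p ^ Suc k) = p ^ v"
      using divides_primepow_nat[OF p] by blast
    with nd have "v \<noteq> Suc k"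
      by (metis gcd_dvd1)
    with v have "gcd (d j) (p ^ Suc k) dvd p ^ k"
      by (auto simp: le_imp_power_dvd)
    then have g: "gcd (int (d j)) (int (p ^ Suc k)) dvd int (p ^ k)"
      unfolding gcd_int_int_eq of_nat_dvd_iff .
    obtain y where y: "x = (\<lambda>j. (int (p ^ k) * y j) mod int (d j))" and x0: "\<And>j. (int p * x j) mod int (d j) = 0"
    proof -
      from x obtain y where "y [^]\<^bsub>cyclic_sum d\<^esub> (p ^ k) = x" "x [^]\<^bsub>cyclic_sum d\<^esub> p = \<one>\<^bsub>cyclic_sum d\<^esub>"
        by (auto simp: power_torsion_def)
      then have "x = (\<lambda>j. (int (p ^ k) * y j) mod int (d j))" "\<And>j. (int p * x j) mod int (d j) = 0"
        unfolding pow_cyclic_sum one_cyclic_sum by (simp, meson)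
      then show thesis
        by (rule that)
    qed
    have "int (d j) dvd int p * (int (p ^ k) * y j)"
      using x0[of j] unfolding y by (simp add: mod_mult_right_eq dvd_eq_mod_eq_0)
    then have "int (d j) dvd int (p ^ Suc k) * y j"
      by (simp add: mult.assoc)
    then have "int (d j) dvd gcd (int (d j) * y j) (int (p ^ Suc k) * y j)"
      by simp
    also have "\<dots> = gcd (int (d j)) (int (p ^ Suc k)) * \<bar>y j\<bar>"
      by (simp only: gcd_mult_right) (simp add: gcd.commute abs_mult)
    also have "\<dots> dvd int (p ^ k) * y j"
      by (intro mult_dvd_mono g) simp
    finally show ?thesis
      unfolding y by simp
  qed
  \<comment> \<open>A torsion coordinate x_j is determined by the quotient of p x_j by d_j, an
    integer from 0 to p - 1.\<close>
  let ?f = "\<lambda>x. restrict (\<lambda>j. nat ((int p * x j) div int (d j))) {..<i}"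
  have p0: "0 < p" using p prime_gt_0_nat by blast
  have car: "0 \<le> x j" "x j < int (d j)" "int (d j) * ((int p * x j) div int (d j)) = int p * x j"
    if "x \<in> power_torsion p (p ^ k) (cyclic_sum d)" for x j
  proof -
    show "0 \<le> x j" "x j < int (d j)"
      using that by (auto simp: power_torsion_def carrier_cyclic_sum d)
    have "(int p * x j) mod int (d j) = 0"
      using that by (auto simp: power_torsion_def pow_cyclic_sum one_cyclic_sum fun_eq_iff)
    then show "int (d j) * ((int p * x j) div int (d j)) = int p * x j"
      by auto
  qed
  have bounds: "0 \<le> (int p * x j) div int (d j)" "(int p * x j) div int (d j) < int p"
    if x: "x \<in> power_torsion p (p ^ k) (cyclic_sum d)" for x j
  proof -
    have dp: "0 < int (d j)" using divisor_chain_pos[OF d, of j] by simp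
    show "0 \<le> (int p * x j) div int (d j)"
      using car(1)[OF x, of j] dp by (simp add: pos_imp_zdiv_nonneg_iff)
    have "int p * x j < int p * int (d j)"
      using car(2)[OF x, of j] p0 by simp
    then have "int (d j) * ((int p * x j) div int (d j)) < int (d j) * int p"
      unfolding car(3)[OF x, of j] by (simp add: mult.commute)
    then show "(int p * x j) div int (d j) < int p"
      using dp by (simp only: mult_less_cancel_left_pos)
  qed
  have "card (power_torsion p (p ^ k) (cyclic_sum d)) \<le> card (\<Pi>\<^sub>E j\<in>{..<i}. {..<p})"
  proof (rule card_inj_on_le[where f = ?f])
    show "inj_on ?f (power_torsion p (p ^ k) (cyclic_sum d))"
    proof (rule inj_onI, rule ext)
      fix x y j
      assume x: "x \<in> power_torsion p (p ^ k) (cyclic_sum d)" and y: "y \<in> power_torsion p (p ^ k) (cyclic_sum d)"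
        and eq: "?f x = ?f y"
      show "x j = y j"
      proof (cases "j < i")
        case True
        with fun_cong[OF eq, of j] have "nat ((int p * x j) div int (d j)) = nat ((int p * y j) div int (d j))"
          by simp
        then have "(int p * x j) div int (d j) = (int p * y j) div int (d j)"
          using bounds(1)[OF x, of j] bounds(1)[OF y, of j] by simp
        then have "int p * x j = int p * y j"
          using car(3)[OF x, of j] car(3)[OF y, of j] by metis
        then show ?thesis
          using p0 by simp
      next
        case False
        then show ?thesis
          using zero[OF x, of j] zero[OF y, of j] by simp
      qed
    qed
    show "?f ` power_torsion p (p ^ k) (cyclic_sum d) \<subseteq> (\<Pi>\<^sub>E j\<in>{..<i}. {..<p})"
      using bounds p0 by (auto simp: nat_less_iff split: if_splits)
    show "finite (\<Pi>\<^sub>E j\<in>{..<i}. {..<p})"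
      by (intro finite_PiE) auto
  qed
  then show ?thesis
    by (simp add: card_PiE)
qed

text \<open>If p^(k+1) divided e_i but not d_i, an embedding would give p^(i+1) <= p^i for the
  torsion counts.\<close>

theorem embeds_cyclic_sum_iff:
  assumes d: "divisor_chain d" and e: "divisor_chain e"
  shows "embeds (cyclic_sum e) (cyclic_sum d) \<longleftrightarrow> (\<forall>i. e i dvd d i)"
proof (intro iffI allI)
  fix i assume emb: "embeds (cyclic_sum e) (cyclic_sum d)"
  show "e i dvd d i"
  proof (rule multiplicity_le_imp_dvd)
    show "e i \<noteq> 0"
      using divisor_chain_pos[OF e, of i] by simp
    fix p :: nat assume p: "prime p"
    show "multiplicity p (e i) \<le> multiplicity p (d i)"
    proof (cases "multiplicity p (e i)")
      case (Suc k)
      have "p * p ^ k dvd d i"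
      proof (rule ccontr)
        assume n: "\<not> p * p ^ k dvd d i"
        have "p * p ^ k dvd e i"
          using multiplicity_dvd[of p "e i"] Suc by simp
        then have "p ^ Suc i \<le> card (power_torsion p (p ^ k) (cyclic_sum e))"
          using p prime_gt_0_nat by (intro power_torsion_lower[OF e]) auto
        also have "\<dots> \<le> card (power_torsion p (p ^ k) (cyclic_sum d))"
          by (intro card_power_torsion_embeds group_cyclic_sum finite_cyclic_sum d e emb)
        also have "\<dots> \<le> p ^ i"
          by (rule power_torsion_upper[OF d p n])
        finally show False
          using prime_gt_1_nat[OF p] by simp
      qed
      then show ?thesis
        using Suc p divisor_chain_pos[OF d, of i] by (intro multiplicity_geI) (auto simp: not_prime_unit)
    qed simp
  qed
qed (use embeds_cyclic_sum d e in blast)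

section \<open>Invariant factors of finite Abelian groups\<close>

context comm_group
begin

lemma ord_mult_coprime:
  assumes x: "x \<in> carrier G" and y: "y \<in> carrier G" and cop: "coprime (ord x) (ord y)"
  shows "ord (x \<otimes> y) = ord x * ord y"
proof (rule dvd_antisym)
  have aux: "ord a dvd ord (a \<otimes> b)" if ab: "a \<in> carrier G" "b \<in> carrier G" "coprime (ord a) (ord b)" for a b
  proof -
    let ?n = "ord (a \<otimes> b)"
    have "\<one> = (a \<otimes> b) [^] (?n * ord b)"
      using ab by (simp add: nat_pow_pow[symmetric])
    also have "\<dots> = a [^] (?n * ord b) \<otimes> b [^] (?n * ord b)"
      using ab by (simp add: nat_pow_distrib)
    also have "b [^] (?n * ord b) = \<one>"
      using ab by (simp add: pow_eq_id)
    finally have "a [^] (?n * ord b) = \<one>"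
      using ab by simp
    then have "ord a dvd ?n * ord b"
      using ab by (simp add: pow_eq_id)
    then show ?thesis
      using ab(3) by (simp add: coprime_dvd_mult_left_iff)
  qed
  show "ord (x \<otimes> y) dvd ord x * ord y"
    using x y by (rule abelian_ord_mul_divides)
  have "ord y dvd ord (x \<otimes> y)"
    using aux[OF y x] cop x y by (simp add: m_comm coprime_commute)
  then show "ord x * ord y dvd ord (x \<otimes> y)"
    using aux[OF x y cop] cop by (simp add: divides_mult)
qed

text \<open>An element of maximal order works: if the order of \<open>y\<close> contained a higher
  power of some prime, exchanging the \<open>p\<close>-part of \<open>x\<close> for that of
  \<open>y\<close> would produce a larger order.\<close>

lemma exists_exponent_element:
  assumes fin: "finite (carrier G)"
  shows "\<exists>x\<in>carrier G. \<forall>y\<in>carrier G. y [^] ord x = \<one>"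
proof -
  obtain x where x: "x \<in> carrier G" and "Max (ord ` carrier G) = ord x"
    using obtains_MAX[OF fin, of ord] one_closed by blast
  then have max: "ord y \<le> ord x" if "y \<in> carrier G" for y
    using fin that by (metis Max_ge finite_imageI imageI)
  have pos: "0 < ord y" if "y \<in> carrier G" for y
    using ord_ge_1[OF fin that] by simp
  have "ord y dvd ord x" if y: "y \<in> carrier G" for y
  proof (rule multiplicity_le_imp_dvd)
    show "ord y \<noteq> 0" using pos[OF y] by simp
    fix p :: nat assume p: "prime p"
    define a b where "a = multiplicity p (ord x)" and "b = multiplicity p (ord y)"
    have "b \<le> a"
    proof (rule ccontr)
      assume "\<not> b \<le> a"
      obtain u where u: "ord x = p ^ a * u" "\<not> p dvd u"
        unfolding a_def
        using multiplicity_decompose'[of "ord x" p] pos[OF x] p by (metis not_prime_unit less_irrefl)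
      obtain v where v: "ord y = p ^ b * v"
        using multiplicity_dvd[of p "ord y"] unfolding b_def by (auto elim: dvdE)
      have p0: "0 < p" using p prime_gt_0_nat by blast
      have v0: "v \<noteq> 0" using v pos[OF y] by auto
      \<comment> \<open>\<open>?x\<close> has the \<open>p\<close>-free part \<open>u\<close> of the
        order of \<open>x\<close> as its order, and \<open>?y\<close> has order
        \<open>p ^ b\<close>; as these are coprime, the orders multiply.\<close>
      let ?x = "x [^] (p ^ a)" and ?y = "y [^] v"
      have ox: "ord ?x = u"
        using ord_pow[OF x, of "p ^ a"] u p0 by simp
      have oy: "ord ?y = p ^ b"
        using ord_pow[OF y, of v] v v0 by simp
      have "coprime (ord ?x) (ord ?y)"
        unfolding ox oy using u(2) p by (metis coprime_commute coprime_power_left_iff prime_imp_coprime)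
      then have "ord (?x \<otimes> ?y) = u * p ^ b"
        using ord_mult_coprime[of ?x ?y] x y ox oy by simp
      then have "u * p ^ b \<le> ord x"
        using max[of "?x \<otimes> ?y"] x y by simp
      also have "\<dots> = u * p ^ a"
        using u(1) by simp
      also have "\<dots> < u * p ^ b"
        using \<open>\<not> b \<le> a\<close> u pos[OF x] prime_gt_1_nat[OF p] by (intro mult_strict_left_mono power_strict_increasing) auto
      finally show False by simp
    qed
    then show "multiplicity p (ord y) \<le> multiplicity p (ord x)"
      by (simp add: a_def b_def)
  qed
  then show ?thesis
    using x by (auto simp: pow_eq_id)
qed

text \<open>A complement of a cyclic subgroup \<open>\<langle>x\<rangle>\<close> of maximal order is obtained as a maximal subgroup
  \<open>K\<close> meeting \<open>\<langle>x\<rangle>\<close> trivially: if \<open>\<langle>x\<rangle>K\<close> were proper, some \<open>g\<close> outside it would have a prime power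
  \<open>g\<^sup>p = x\<^sup>a k\<close> inside it, the exponent forces \<open>p\<close> to divide \<open>a\<close>, and \<open>h = g x\<^sup>-\<^sup>a\<^sup>/\<^sup>p\<close> enlarges \<open>K\<close>.\<close>

lemma exists_complement:
  assumes fin: "finite (carrier G)" and x: "x \<in> carrier G"
    and exp: "\<And>y. y \<in> carrier G \<Longrightarrow> y [^] ord x = \<one>"
  shows "\<exists>K. subgroup K G \<and> K \<inter> generate G {x} = {\<one>} \<and> generate G {x} <#> K = carrier G"
proof -
  let ?C = "generate G {x}" and ?n = "ord x"
  have C: "subgroup ?C G"
    using x by (intro generate_is_subgroup) auto
  have powC: "x [^] (k::nat) \<in> ?C" for k
    using generate_pow_on_finite_carrier[OF fin x] by blast
  have n0: "0 < ?n"
    using ord_ge_1[OF fin x] by simp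
  let ?S = "{K. subgroup K G \<and> K \<inter> ?C = {\<one>}}"
  have "finite ?S"
    by (rule finite_subset[of _ "Pow (carrier G)"]) (use fin subgroup.subset in auto)
  moreover have "{\<one>} \<in> ?S"
    using triv_subgroup subgroup.one_closed[OF C] by auto
  ultimately obtain K where K: "K \<in> ?S" and "\<forall>K'\<in>?S. K \<subseteq> K' \<longrightarrow> K = K'"
    using finite_has_maximal[of ?S] by blast
  then have max: "\<And>K'. K' \<in> ?S \<Longrightarrow> K \<subseteq> K' \<Longrightarrow> K = K'"
    by blast
  from K have sK: "subgroup K G" and KC: "K \<inter> ?C = {\<one>}"
    by auto
  define P where "P = ?C <#> K"
  have P: "subgroup P G"
    unfolding P_def by (rule mult_subgroups[OF C sK])
  have Pcar: "P \<subseteq> carrier G"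
    using P subgroup.subset by blast
  have CP: "c \<otimes> k \<in> P" if "c \<in> ?C" "k \<in> K" for c k
    using that by (auto simp: P_def set_mult_def)
  have Kcar: "K \<subseteq> carrier G" and Ccar: "?C \<subseteq> carrier G"
    using sK C subgroup.subset by auto
  have KP: "K \<subseteq> P"
    using CP[OF subgroup.one_closed[OF C]] Kcar by (metis l_one subsetD subsetI)
  have powcl: "a [^] (k::nat) \<in> H" if "subgroup H G" "a \<in> H" for a k H
    using that by (induction k) (auto intro: subgroup.one_closed subgroup.m_closed)
  \<comment> \<open>By Bezout, \<open>g\<close> is a quotient of powers of two elements of
    \<open>P\<close>.\<close>
  have coprime_pow: "g \<in> P" if g: "g \<in> carrier G" "g [^] a \<in> P" "g [^] b \<in> P" "coprime a b" "0 < a"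
    for g and a b :: nat
  proof -
    obtain u v where uv: "a * u = b * v + 1"
      using bezout_nat[of a b] g(4,5) by auto
    have pu: "g [^] (a * u) \<in> P" and pv: "g [^] (b * v) \<in> P"
      using powcl[OF P g(2), of u] powcl[OF P g(3), of v] g(1) by (simp_all add: nat_pow_pow)
    have "g [^] (a * u) = g [^] (b * v) \<otimes> g"
      using uv by simp
    then have "inv (g [^] (b * v)) \<otimes> g [^] (a * u) = g"
      using g(1) by (simp add: m_assoc[symmetric])
    then show ?thesis
      using subgroup.m_closed[OF P subgroup.m_inv_closed[OF P pv] pu] by simp
  qed
  have "carrier G \<subseteq> P"
  proof (rule ccontr)
    assume "\<not> carrier G \<subseteq> P"
    then obtain g0 where g0: "g0 \<in> carrier G" "g0 \<notin> P" by blast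
    have "\<exists>j>0. g0 [^] (j::nat) \<in> P"
      using exp[OF g0(1)] n0 subgroup.one_closed[OF P] by auto
    \<comment> \<open>The least positive exponent that brings \<open>g0\<close> into
      \<open>P\<close>. For a prime \<open>p\<close> dividing \<open>j\<close>, the power of
      \<open>g0\<close> with exponent j / p is still outside \<open>P\<close>, but its
      \<open>p\<close>-th power is inside.\<close>
    define j where "j = (LEAST j::nat. j > 0 \<and> g0 [^] j \<in> P)"
    have j: "j > 0" "g0 [^] j \<in> P"
      using LeastI_ex[OF \<open>\<exists>j>0. g0 [^] (j::nat) \<in> P\<close>] by (simp_all add: j_def)
    have jmin: "g0 [^] i \<notin> P" if "0 < i" "i < j" for i
      using that not_less_Least[of i "\<lambda>j. j > 0 \<and> g0 [^] j \<in> P"] by (auto simp: j_def)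
    have "j \<noteq> 1"
      using j(2) g0 by auto
    then obtain p where p: "prime p" "p dvd j"
      using prime_factor_nat by blast
    obtain i where i: "j = i * p"
      using p(2) by (metis dvd_def mult.commute)
    define g where "g = g0 [^] i"
    have g: "g \<in> carrier G" "g \<notin> P" "g [^] p \<in> P"
    proof -
      have "0 < i" "i < j"
        using i j(1) prime_gt_1_nat[OF p(1)] by auto
      then show "g \<in> carrier G" "g \<notin> P" "g [^] p \<in> P"
        using jmin g0(1) j(2) by (simp_all add: g_def nat_pow_pow i)
    qed
    have "p dvd ?n"
    proof (rule ccontr)
      assume "\<not> p dvd ?n"
      then have "coprime p ?n"
        using p(1) by (simp add: prime_imp_coprime)
      moreover have "g [^] ?n \<in> P"
        using exp[OF g(1)] subgroup.one_closed[OF P] by simp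
      ultimately show False
        using coprime_pow[OF g(1,3)] g(2) prime_gt_0_nat[OF p(1)] by blast
    qed
    then obtain n' where n': "?n = p * n'" by blast
    obtain c k where ck: "g [^] p = c \<otimes> k" "c \<in> ?C" "k \<in> K"
      using g(3) by (auto simp: P_def set_mult_def)
    obtain a :: nat where a: "c = x [^] a"
      using ck(2) generate_pow_on_finite_carrier[OF fin x] by blast
    have kcar: "k \<in> carrier G" using ck(3) Kcar by blast
    \<comment> \<open>Raising g^p = x^a k to the power n' shows that x^(a n') is in both
      \<open>K\<close> and \<open>?C\<close>, hence trivial. So p n' divides a n', and p divides
      a.\<close>
    have "\<one> = g [^] ?n"
      using exp[OF g(1)] by simp
    also have "\<dots> = (g [^] p) [^] n'"
      using g(1) by (simp add: nat_pow_pow n')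
    also have "\<dots> = x [^] (a * n') \<otimes> k [^] n'"
      using x kcar by (simp add: ck(1) a nat_pow_distrib nat_pow_pow)
    finally have "x [^] (a * n') = inv (k [^] n')"
      using x kcar by (intro inv_equality[symmetric]) auto
    moreover have "inv (k [^] n') \<in> K"
      using powcl[OF sK ck(3)] sK by (simp add: subgroup.m_inv_closed)
    ultimately have "x [^] (a * n') = \<one>"
      using powC[of "a * n'"] KC by auto
    then have "?n dvd a * n'"
      using x by (simp add: pow_eq_id)
    then have "p dvd a"
      using n0 unfolding n' by simp
    then obtain b where b: "a = p * b" by blast
    define h where "h = g \<otimes> inv (x [^] b)"
    have h: "h \<in> carrier G"
      using g(1) x by (simp add: h_def)
    have hp: "h [^] p = k"
    proof -
      have "h [^] p = g [^] p \<otimes> inv (x [^] (b * p))"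
        using g(1) x by (simp add: h_def nat_pow_distrib nat_pow_inv nat_pow_pow)
      also have "\<dots> = k"
        using x kcar unfolding ck(1) a b by (simp add: m_comm[of _ k] m_assoc mult.commute)
      finally show ?thesis .
    qed
    have hP: "h \<notin> P"
    proof
      assume "h \<in> P"
      moreover have "x [^] b \<in> P"
        using CP[OF powC subgroup.one_closed[OF sK]] x by simp
      ultimately have "h \<otimes> x [^] b \<in> P"
        using P by (simp add: subgroup.m_closed)
      then show False
        using g x by (simp add: h_def m_assoc)
    qed
    define K' where "K' = K <#> generate G {h}"
    have gh: "subgroup (generate G {h}) G"
      using h by (intro generate_is_subgroup) auto
    have sK': "subgroup K' G"
      unfolding K'_def by (rule mult_subgroups[OF sK gh])
    have KK': "K \<subseteq> K'"
      unfolding K'_def set_mult_def using subgroup.one_closed[OF gh] Kcar by force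
    have hK': "h \<in> K'"
      unfolding K'_def set_mult_def using subgroup.one_closed[OF sK] generate.incl[of h "{h}"] h by force
    have "y = \<one>" if y: "y \<in> K'" "y \<in> ?C" for y
    proof -
      obtain l and i :: nat where l: "y = l \<otimes> h [^] i" "l \<in> K"
        using y(1) generate_pow_on_finite_carrier[OF fin h] by (auto simp: K'_def set_mult_def)
      have lc: "l \<in> carrier G" using l(2) Kcar by blast
      \<comment> \<open>If \<open>p\<close> divides \<open>i\<close>, then h^i is a power of
        \<open>k\<close> and \<open>y\<close> is already in \<open>K\<close>. Otherwise h^i and h^p
        = k both lie in \<open>P\<close>, and coprimality would force \<open>h\<close> into
        \<open>P\<close>.\<close>
      show ?thesis
      proof (cases "p dvd i")
        case True
        then obtain i' where "i = p * i'" by blast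
        then have "h [^] i = k [^] i'"
          using h hp by (simp add: nat_pow_pow[symmetric])
        then have "y \<in> K"
          using l powcl[OF sK ck(3)] sK by (simp add: subgroup.m_closed)
        then show ?thesis
          using y(2) KC by blast
      next
        case False
        then have cop: "coprime p i"
          using p(1) by (simp add: prime_imp_coprime)
        have "h [^] i = y \<otimes> inv l"
          using l lc h by (simp add: m_comm[of l] m_assoc)
        then have "h [^] i \<in> P"
          using CP[OF y(2), of "inv l"] l(2) sK by (simp add: subgroup.m_inv_closed)
        moreover have "h [^] p \<in> P"
          using hp ck(3) KP by auto
        ultimately show ?thesis
          using coprime_pow[OF h _ _ cop] hP prime_gt_0_nat[OF p(1)] by blast
      qed
    qed
    then have "K' \<inter> ?C = {\<one>}"
      using subgroup.one_closed[OF sK'] subgroup.one_closed[OF C] by blast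
    then have "K = K'"
      using sK' by (intro max[OF _ KK']) simp
    then show False
      using hK' hP KP by blast
  qed
  then have "?C <#> K = carrier G"
    using Pcar by (auto simp: P_def)
  then show ?thesis
    using sK KC by blast
qed

end

lemma divisor_chain_case_nat:
  assumes "divisor_chain d" "0 < n" "d 0 dvd n"
  shows "divisor_chain (case_nat n d)"
proof -
  have "{i. case_nat n d i \<noteq> 1} \<subseteq> insert 0 (Suc ` {i. d i \<noteq> 1})"
  proof
    fix i assume "i \<in> {i. case_nat n d i \<noteq> 1}"
    then show "i \<in> insert 0 (Suc ` {i. d i \<noteq> 1})"
      by (cases i) auto
  qed
  then have "finite {i. case_nat n d i \<noteq> 1}"
    by (rule finite_subset) (use assms in \<open>simp add: divisor_chain_def\<close>)
  with assms show ?thesis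
    by (auto simp: divisor_chain_def split: nat.splits)
qed

lemma divisor_chain_1: "divisor_chain (\<lambda>_. 1)"
  by (simp add: divisor_chain_def)

text \<open>The clause \<open>d 0 dvd m\<close> carries the induction: used for the complement with
  \<open>m\<close> the order of \<open>x\<close>, it allows this order to be put in front of the
  chain of the complement.\<close>

theorem finite_comm_group_iso_cyclic_sum:
  fixes G :: "('a, 'b) monoid_scheme"
  assumes "comm_group G" "finite (carrier G)" "0 < m" "\<And>x. x \<in> carrier G \<Longrightarrow> x [^]\<^bsub>G\<^esub> m = \<one>\<^bsub>G\<^esub>"
  shows "\<exists>d. divisor_chain d \<and> d 0 dvd m \<and> G \<cong> cyclic_sum d"
  using assms
proof (induction "card (carrier G)" arbitrary: G m rule: less_induct)
  case less
  interpret comm_group G by fact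
  note fin = less.prems(2)
  show ?case
  proof (cases "carrier G = {\<one>\<^bsub>G\<^esub>}")
    case True
    have c: "carrier (cyclic_sum (\<lambda>_. 1)) = {\<one>\<^bsub>cyclic_sum (\<lambda>_. 1)\<^esub>}"
    proof -
      have "0 \<le> k \<and> k < 1 \<longleftrightarrow> k = 0" for k :: int
        by presburger
      then show ?thesis
        unfolding carrier_cyclic_sum[OF divisor_chain_1] one_cyclic_sum by (simp add: fun_eq_iff set_eq_iff)
    qed
    have "(\<lambda>_. \<one>\<^bsub>cyclic_sum (\<lambda>_. 1)\<^esub>) \<in> iso G (cyclic_sum (\<lambda>_. 1))"
      unfolding iso_def hom_def bij_betw_def True c
      by (simp add: mult_cyclic_sum one_cyclic_sum)
    then have "G \<cong> cyclic_sum (\<lambda>_. 1)"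
      by (rule is_isoI)
    then show ?thesis
      using divisor_chain_1 by (intro exI[of _ "\<lambda>_. 1"]) simp
  next
    case False
    obtain x where x: "x \<in> carrier G" and exp: "\<And>y. y \<in> carrier G \<Longrightarrow> y [^]\<^bsub>G\<^esub> ord x = \<one>\<^bsub>G\<^esub>"
      using exists_exponent_element[OF fin] by blast
    define n where "n = ord x"
    have n0: "0 < n"
      using ord_ge_1[OF fin x] by (simp add: n_def)
    have "x \<noteq> \<one>\<^bsub>G\<^esub>"
    proof
      assume "x = \<one>\<^bsub>G\<^esub>"
      then have "ord x = 1" by simp
      then have "y = \<one>\<^bsub>G\<^esub>" if "y \<in> carrier G" for y
        using exp[OF that] that by simp
      with False show False
        using one_closed by blast
    qed
    let ?C = "generate G {x}"
    obtain K where K: "subgroup K G" "K \<inter> ?C = {\<one>\<^bsub>G\<^esub>}" "?C <#>\<^bsub>G\<^esub> K = carrier G"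
      using exists_complement[OF fin x exp] by blast
    have Kcar: "K \<subseteq> carrier G"
      using K(1) subgroup.subset by blast
    let ?K = "G\<lparr>carrier := K\<rparr>"
    have xC: "x [^]\<^bsub>G\<^esub> (i::int) \<in> ?C" for i
      using generate_pow[OF x] by blast
    have "x \<notin> K"
      using xC[of 1] x \<open>x \<noteq> \<one>\<^bsub>G\<^esub>\<close> K(2) by auto
    then have "card (carrier ?K) < card (carrier G)"
      using Kcar x fin by (auto intro!: psubset_card_mono)
    moreover have "comm_group ?K"
      using Kcar m_comm by (intro group.group_comm_groupI subgroup_imp_group[OF K(1)]) auto
    moreover have "finite (carrier ?K)"
      using fin Kcar finite_subset by auto
    moreover have "y [^]\<^bsub>?K\<^esub> n = \<one>\<^bsub>?K\<^esub>" if "y \<in> carrier ?K" for y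
      using exp[of y] that Kcar nat_pow_consistent[of y n K] by (auto simp: n_def)
    ultimately obtain d where d: "divisor_chain d" "d 0 dvd n" "?K \<cong> cyclic_sum d"
      using less.hyps[of ?K n] n0 by auto
    obtain \<phi> where \<phi>: "\<phi> \<in> iso (cyclic_sum d) ?K"
      using group.iso_sym[OF subgroup_imp_group[OF K(1)] d(3)] by (auto simp: is_iso_def)
    have \<phi>K: "\<phi> z \<in> K" if "z \<in> carrier (cyclic_sum d)" for z
      using \<phi> that by (auto simp: iso_def hom_def)
    have \<phi>m: "\<phi> (z \<otimes>\<^bsub>cyclic_sum d\<^esub> w) = \<phi> z \<otimes>\<^bsub>G\<^esub> \<phi> w"
      if "z \<in> carrier (cyclic_sum d)" "w \<in> carrier (cyclic_sum d)" for z w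
      using \<phi> that by (auto simp: iso_def hom_def)
    have \<phi>inj: "inj_on \<phi> (carrier (cyclic_sum d))" and \<phi>sur: "\<phi> ` carrier (cyclic_sum d) = K"
      using \<phi> by (auto simp: iso_def bij_betw_def)
    let ?d = "case_nat n d"
    have cd: "divisor_chain ?d"
      by (rule divisor_chain_case_nat[OF d(1) n0 d(2)])
    have car: "z \<in> carrier (cyclic_sum ?d) \<longleftrightarrow> 0 \<le> z 0 \<and> z 0 < int n \<and> (\<lambda>i. z (Suc i)) \<in> carrier (cyclic_sum d)" for z
    proof -
      have "(\<forall>i. 0 \<le> z i \<and> z i < int (?d i)) \<longleftrightarrow>
          (0 \<le> z 0 \<and> z 0 < int n) \<and> (\<forall>i. 0 \<le> z (Suc i) \<and> z (Suc i) < int (d i))"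
        by (metis nat.case not0_implies_Suc)
      then show ?thesis
        by (simp add: carrier_cyclic_sum[OF cd] carrier_cyclic_sum[OF d(1)])
    qed
    let ?F = "\<lambda>z. x [^]\<^bsub>G\<^esub> (z 0 :: int) \<otimes>\<^bsub>G\<^esub> \<phi> (\<lambda>i. z (Suc i))"
    have xmod: "x [^]\<^bsub>G\<^esub> (i mod int n) = x [^]\<^bsub>G\<^esub> i" for i :: int
      using int_pow_eq[OF x, of "i mod int n" i] by (simp add: n_def minus_mod_eq_mult_div)
    have hom: "?F \<in> hom (cyclic_sum ?d) G"
    proof (rule homI)
      fix z assume "z \<in> carrier (cyclic_sum ?d)"
      then show "?F z \<in> carrier G"
        using x \<phi>K Kcar by (auto simp: car)
    next
      fix z w assume zw: "z \<in> carrier (cyclic_sum ?d)" "w \<in> carrier (cyclic_sum ?d)"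
      let ?z = "\<lambda>i. z (Suc i)" and ?w = "\<lambda>i. w (Suc i)"
      have mem: "\<phi> ?z \<in> carrier G" "\<phi> ?w \<in> carrier G"
        using zw \<phi>K Kcar by (auto simp: car)
      have "?F (z \<otimes>\<^bsub>cyclic_sum ?d\<^esub> w) = x [^]\<^bsub>G\<^esub> (z 0 + w 0) \<otimes>\<^bsub>G\<^esub> \<phi> (?z \<otimes>\<^bsub>cyclic_sum d\<^esub> ?w)"
        by (simp add: mult_cyclic_sum xmod)
      also have "\<dots> = (x [^]\<^bsub>G\<^esub> z 0 \<otimes>\<^bsub>G\<^esub> x [^]\<^bsub>G\<^esub> w 0) \<otimes>\<^bsub>G\<^esub> (\<phi> ?z \<otimes>\<^bsub>G\<^esub> \<phi> ?w)"
        using zw x by (simp add: car \<phi>m int_pow_mult)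
      also have "\<dots> = ?F z \<otimes>\<^bsub>G\<^esub> ?F w"
        using x mem by (simp add: m_ac)
      finally show "?F (z \<otimes>\<^bsub>cyclic_sum ?d\<^esub> w) = ?F z \<otimes>\<^bsub>G\<^esub> ?F w" .
    qed
    interpret F: group_hom "cyclic_sum ?d" G ?F
      using hom group_cyclic_sum[OF cd] by (simp add: group_hom_def group_hom_axioms_def)
    have "inj_on ?F (carrier (cyclic_sum ?d))"
    proof (subst F.inj_on_one_iff, intro allI impI)
      fix z assume z: "z \<in> carrier (cyclic_sum ?d)" and 1: "?F z = \<one>\<^bsub>G\<^esub>"
      let ?z = "\<lambda>i. z (Suc i)"
      have zc: "?z \<in> carrier (cyclic_sum d)" "0 \<le> z 0" "z 0 < int n"
        using z by (simp_all add: car)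
      \<comment> \<open>In the kernel the cyclic component is the inverse of an element of
        \<open>K\<close>, so it lies in the trivial intersection of the two factors.\<close>
      have "x [^]\<^bsub>G\<^esub> z 0 = inv\<^bsub>G\<^esub> (\<phi> ?z)"
        using 1 x \<phi>K[OF zc(1)] Kcar by (intro inv_equality[symmetric]) auto
      also have "\<dots> \<in> K"
        using \<phi>K[OF zc(1)] K(1) by (simp add: subgroup.m_inv_closed)
      finally have x1: "x [^]\<^bsub>G\<^esub> z 0 = \<one>\<^bsub>G\<^esub>"
        using xC[of "z 0"] K(2) by blast
      then have "int n dvd z 0"
        using x by (simp add: int_pow_eq_id n_def)
      then have z0: "z 0 = 0"
        using zc(2,3) zdvd_not_zless[of "z 0" "int n"] by (cases "0 < z 0") auto
      have "\<phi> ?z = \<one>\<^bsub>G\<^esub>"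
        using 1 x1 \<phi>K[OF zc(1)] Kcar by auto
      moreover have "\<phi> (\<lambda>_. 0) = \<one>\<^bsub>G\<^esub>"
        using hom_one[of \<phi> "cyclic_sum d" ?K] \<phi> group_cyclic_sum[OF d(1)] subgroup_imp_group[OF K(1)]
        by (simp add: iso_def one_cyclic_sum)
      moreover have "(\<lambda>_. 0) \<in> carrier (cyclic_sum d)"
        using divisor_chain_pos[OF d(1)] by (simp add: carrier_cyclic_sum[OF d(1)])
      ultimately have "?z = (\<lambda>_. 0)"
        using \<phi>inj zc(1) by (simp add: inj_on_def)
      then have "z i = 0" for i
        using z0 by (cases i) (auto simp: fun_eq_iff)
      then show "z = \<one>\<^bsub>cyclic_sum ?d\<^esub>"
        by (auto simp: one_cyclic_sum)
    qed
    moreover have "?F ` carrier (cyclic_sum ?d) = carrier G"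
    proof
      show "?F ` carrier (cyclic_sum ?d) \<subseteq> carrier G"
        using hom by (auto simp: hom_def)
      show "carrier G \<subseteq> ?F ` carrier (cyclic_sum ?d)"
      proof
        fix y assume "y \<in> carrier G"
        then obtain c k where ck: "y = c \<otimes>\<^bsub>G\<^esub> k" "c \<in> ?C" "k \<in> K"
          unfolding K(3)[symmetric] by (auto simp: set_mult_def)
        obtain i :: int where i: "c = x [^]\<^bsub>G\<^esub> i"
          using ck(2) generate_pow[OF x] by blast
        obtain w where w: "w \<in> carrier (cyclic_sum d)" "k = \<phi> w"
          using ck(3) \<phi>sur by blast
        let ?z = "case_nat (i mod int n) w"
        have "?z \<in> carrier (cyclic_sum ?d)"
          using w n0 by (simp add: car)
        moreover have "y = ?F ?z"
          using ck w i by (simp add: xmod)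
        ultimately show "y \<in> ?F ` carrier (cyclic_sum ?d)"
          by blast
      qed
    qed
    ultimately have "?F \<in> iso (cyclic_sum ?d) G"
      using hom by (simp add: iso_def bij_betw_def)
    then have "cyclic_sum ?d \<cong> G"
      by (rule is_isoI)
    then have "G \<cong> cyclic_sum ?d"
      by (rule group.iso_sym[OF group_cyclic_sum[OF cd]])
    moreover have "?d 0 dvd m"
      using less.prems(4)[OF x] x by (simp add: pow_eq_id n_def)
    ultimately show ?thesis
      using cd by blast
  qed
qed

section \<open>Group-partitions as plane partitions\<close>

text \<open>Cyclic sums live on functions, but the classes contain only groups on
  \<open>nat\<close>; such copies ensure that the class of a cyclic sum is not empty.\<close>

lemma iso_nat_group:
  assumes G: "comm_group G" "finite (carrier G)"
  shows "\<exists>H \<in> fin_ab_groups. G \<cong> H"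
proof -
  interpret comm_group G by fact
  obtain f :: "'a \<Rightarrow> nat" where f: "inj_on f (carrier G)"
    using finite_imp_inj_to_nat_seg[OF G(2)] by blast
  let ?g = "inv_into (carrier G) f"
  let ?H = "\<lparr>carrier = f ` carrier G, mult = \<lambda>a b. f (?g a \<otimes>\<^bsub>G\<^esub> ?g b), one = f \<one>\<^bsub>G\<^esub>\<rparr>"
  have "group ?H"
    by (rule groupI) (auto simp: f m_assoc intro!: bexI[of _ "inv\<^bsub>G\<^esub> _"])
  moreover have iso: "f \<in> iso G ?H"
    using f by (auto simp: iso_def hom_def bij_betw_def)
  ultimately have "comm_group ?H"
    using iso_imp_comm_group[OF is_isoI[OF iso]] by (simp add: group.is_monoid)
  then have "?H \<in> fin_ab_groups"
    using G(2) by (simp add: fin_ab_groups_def)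
  then show ?thesis
    using is_isoI[OF iso] by blast
qed

definition iso_class :: "(nat \<Rightarrow> nat) \<Rightarrow> nat monoid set" where
  "iso_class d = {G \<in> fin_ab_groups. G \<cong> cyclic_sum d}"

lemma fin_ab_groups_group: "G \<in> fin_ab_groups \<Longrightarrow> group G"
  by (simp add: fin_ab_groups_def comm_group_def)

lemma iso_shift:
  assumes "group G" "group H" "group S" "H \<cong> S"
  shows "H \<cong> G \<longleftrightarrow> G \<cong> S"
proof
  assume "H \<cong> G"
  then have "G \<cong> H"
    by (rule group.iso_sym[OF assms(2)])
  then show "G \<cong> S"
    using assms(4) by (rule iso_trans)
next
  assume "G \<cong> S"
  then have "S \<cong> G"
    by (rule group.iso_sym[OF assms(1)])
  with assms(4) show "H \<cong> G"
    by (rule iso_trans)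
qed

lemma iso_class_eq:
  assumes "comm_group S" "finite (carrier S)"
  shows "{G \<in> fin_ab_groups. G \<cong> S} \<in> fin_ab_classes"
proof -
  interpret S: comm_group S by fact
  obtain H where H: "H \<in> fin_ab_groups" "S \<cong> H"
    using iso_nat_group[OF assms] by blast
  have "H \<cong> S"
    using S.iso_sym[OF H(2)] .
  then have "{G \<in> fin_ab_groups. G \<cong> S} = fin_ab_iso `` {H}"
    using H(1) iso_shift[OF fin_ab_groups_group fin_ab_groups_group S.is_group \<open>H \<cong> S\<close>]
    by (auto simp: fin_ab_iso_def)
  then show ?thesis
    using H(1) by (simp add: fin_ab_classes_def quotientI)
qed

lemma iso_class_in_classes: "divisor_chain d \<Longrightarrow> iso_class d \<in> fin_ab_classes"
  unfolding iso_class_def by (intro iso_class_eq comm_group_cyclic_sum finite_cyclic_sum)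

lemma class_nonempty: "A \<in> fin_ab_classes \<Longrightarrow> A \<noteq> {}"
  unfolding fin_ab_classes_def using equiv_fin_ab_iso in_quotient_imp_non_empty by blast

lemma class_eq_iso_class:
  assumes "A \<in> fin_ab_classes"
  shows "\<exists>d. divisor_chain d \<and> A = iso_class d"
proof -
  obtain G where G: "G \<in> fin_ab_groups" "A = fin_ab_iso `` {G}"
    using assms by (auto simp: fin_ab_classes_def elim: quotientE)
  then interpret G: comm_group G by (simp add: fin_ab_groups_def)
  have fin: "finite (carrier G)"
    using G by (simp add: fin_ab_groups_def)
  have "0 < order G"
    using fin G.order_gt_0_iff_finite by blast
  then obtain d where d: "divisor_chain d" "G \<cong> cyclic_sum d"
    using finite_comm_group_iso_cyclic_sum[OF G.comm_group_axioms fin, of "order G"] G.pow_order_eq_1 by blast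
  have "A = iso_class d"
    using G iso_shift[OF fin_ab_groups_group G.is_group group_cyclic_sum[OF d(1)] d(2)]
    by (auto simp: iso_class_def fin_ab_iso_def)
  with d show ?thesis by blast
qed

lemma card_iso_class: "divisor_chain d \<Longrightarrow> G \<in> iso_class d \<Longrightarrow> card (carrier G) = support_prod d"
  using iso_same_card[of G "cyclic_sum d"] by (simp add: iso_class_def card_cyclic_sum)

lemma class_supseteq_iff_embeds:
  assumes "\<And>G. G \<in> A \<Longrightarrow> group G" "\<And>H. H \<in> B \<Longrightarrow> group H"
  shows "class_supseteq A B \<longleftrightarrow> (\<exists>G\<in>A. \<exists>H\<in>B. embeds H G)"
proof -
  have "(\<exists>K. subgroup K G \<and> H \<cong> G\<lparr>carrier := K\<rparr>) \<longleftrightarrow> embeds H G" if GH: "group G" "group H"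
    for G H :: "nat monoid"
  proof
    assume "\<exists>K. subgroup K G \<and> H \<cong> G\<lparr>carrier := K\<rparr>"
    then obtain K f where K: "subgroup K G" "f \<in> iso H (G\<lparr>carrier := K\<rparr>)"
      by (auto simp: is_iso_def)
    then show "embeds H G"
      using subgroup.subset[OF K(1)] unfolding embeds_def
      by (intro bexI[of _ f]) (auto simp: iso_def hom_def bij_betw_def)
  next
    assume "embeds H G"
    then obtain f where f: "f \<in> hom H G" "inj_on f (carrier H)"
      by (auto simp: embeds_def)
    interpret group_hom H G f
      using f GH by (simp add: group_hom_def group_hom_axioms_def)
    have "f \<in> iso H (G\<lparr>carrier := f ` carrier H\<rparr>)"
      using f by (auto simp: iso_def hom_def bij_betw_def)
    then show "\<exists>K. subgroup K G \<and> H \<cong> G\<lparr>carrier := K\<rparr>"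
      using img_is_subgroup is_isoI by blast
  qed
  then show ?thesis
    using assms unfolding class_supseteq_def by meson
qed

text \<open>Embeddability is invariant under isomorphism and classes are nonempty, so the
  existential choice of representatives may be replaced by the cyclic sums themselves.\<close>

lemma class_supseteq_iso_class:
  assumes d: "divisor_chain d" and e: "divisor_chain e"
  shows "class_supseteq (iso_class d) (iso_class e) \<longleftrightarrow> (\<forall>i. e i dvd d i)"
proof -
  have grp: "group G" if "G \<in> iso_class f" for G f
    using that fin_ab_groups_group by (simp add: iso_class_def)
  have "embeds H G \<longleftrightarrow> embeds (cyclic_sum e) (cyclic_sum d)" if GH: "G \<in> iso_class d" "H \<in> iso_class e" for G H
  proof -
    have i: "G \<cong> cyclic_sum d" "H \<cong> cyclic_sum e"
      using GH by (simp_all add: iso_class_def)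
    have i': "cyclic_sum d \<cong> G" "cyclic_sum e \<cong> H"
      by (rule group.iso_sym[OF grp[OF GH(1)] i(1)], rule group.iso_sym[OF grp[OF GH(2)] i(2)])
    show ?thesis
    proof
      assume "embeds H G"
      then show "embeds (cyclic_sum e) (cyclic_sum d)"
        by (intro embeds_trans[OF iso_imp_embeds[OF i'(2)] embeds_trans[OF _ iso_imp_embeds[OF i(1)]]])
    next
      assume "embeds (cyclic_sum e) (cyclic_sum d)"
      then show "embeds H G"
        by (intro embeds_trans[OF iso_imp_embeds[OF i(2)] embeds_trans[OF _ iso_imp_embeds[OF i'(1)]]])
    qed
  qed
  then have "class_supseteq (iso_class d) (iso_class e) \<longleftrightarrow> embeds (cyclic_sum e) (cyclic_sum d)"
    using class_supseteq_iff_embeds[of "iso_class d" "iso_class e", OF grp[of _ d] grp[of _ e]]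
      class_nonempty[OF iso_class_in_classes[OF d]] class_nonempty[OF iso_class_in_classes[OF e]] by blast
  then show ?thesis
    using embeds_cyclic_sum_iff[OF d e] by simp
qed

text \<open>Uniqueness of the invariant factors comes from the embedding criterion: equal classes
  contain each other, so the two chains divide each other termwise.\<close>

lemma iso_class_inject:
  assumes d: "divisor_chain d" and e: "divisor_chain e"
  shows "iso_class d = iso_class e \<longleftrightarrow> d = e"
proof
  assume eq: "iso_class d = iso_class e"
  have "d i dvd e i" "e i dvd d i" for i
    using class_supseteq_iso_class[OF d d] class_supseteq_iso_class[OF d e] class_supseteq_iso_class[OF e d] eq by auto
  then show "d = e"
    by (auto simp: fun_eq_iff intro: dvd_antisym)
qed simp

lemma trivial_class_eq: "trivial_class = iso_class (\<lambda>_. 1)"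
proof -
  obtain d where d: "divisor_chain d" "trivial_class = iso_class d"
    using class_eq_iso_class[OF trivial_class_in_fin_ab_classes] by blast
  obtain G where G: "G \<in> iso_class d"
    using class_nonempty[OF iso_class_in_classes[OF d(1)]] by blast
  then have "trivial_group G"
    using d(2) by (auto simp: trivial_class_def)
  then have "card (carrier G) = 1"
    by (auto simp: trivial_group_def)
  then have "support_prod d = 1"
    using card_iso_class[OF d(1) G] by simp
  moreover have "d i dvd support_prod d" for i
    using d(1) by (intro dvd_support_prod) (simp add: divisor_chain_def)
  ultimately have "d = (\<lambda>_. 1)"
    by auto
  with d show ?thesis by simp
qed

text \<open>Different choices of representatives have isomorphic direct sums, so a single choice
  describes the whole class.\<close>

lemma class_direct_sum_iso_class:
  assumes D: "\<And>i. divisor_chain (D i)" and K: "\<And>i. K \<le> i \<Longrightarrow> D i = (\<lambda>_. 1)"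
  defines "A \<equiv> class_direct_sum (\<lambda>i. iso_class (D i))"
  shows "A \<in> fin_ab_classes" "\<And>G. G \<in> A \<Longrightarrow> card (carrier G) = (\<Prod>i<K. support_prod (D i))"
proof -
  define G where "G i = (SOME G. G \<in> iso_class (D i))" for i
  have G: "G i \<in> iso_class (D i)" for i
    unfolding G_def using class_nonempty[OF iso_class_in_classes[OF D[of i]]] by (simp add: some_in_eq)
  have cG: "comm_group (G i)" "finite (carrier (G i))" "group (G i)" for i
    using G[of i] by (simp_all add: iso_class_def fin_ab_groups_def comm_group_def)
  have card: "card (carrier (G i)) = support_prod (D i)" for i
    using card_iso_class[OF D G] .
  have one: "card (carrier (G i)) = 1" if "K \<le> i" for i
    unfolding card K[OF that] by (simp add: support_prod_def)
  let ?S = "sum_group UNIV G"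
  have S: "comm_group ?S" "finite (carrier ?S)" "card (carrier ?S) = (\<Prod>i<K. card (carrier (G i)))"
    by (rule comm_group_sum_group cG)+
      (rule finite_sum_group[where K = K] card_sum_group[where K = K], (rule cG one, assumption?)+)+
  have "A = {H \<in> fin_ab_groups. H \<cong> ?S}"
  proof -
    have S': "sum_group UNIV G' \<cong> ?S" if G': "\<forall>i. G' i \<in> iso_class (D i)" for G'
    proof (rule iso_sum_groupI)
      fix i
      show "group (G' i)" "group (G i)"
        using G'[rule_format, of i] fin_ab_groups_group cG by (auto simp: iso_class_def)
      have "cyclic_sum (D i) \<cong> G i"
        by (rule group.iso_sym[OF cG(3)]) (use G[of i] in \<open>simp add: iso_class_def\<close>)
      moreover have "G' i \<cong> cyclic_sum (D i)"
        using G' by (simp add: iso_class_def)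
      ultimately show "G' i \<cong> G i"
        by (rule iso_trans[rotated])
    qed
    show ?thesis
      unfolding A_def class_direct_sum_def
    proof (intro Collect_cong conj_cong refl iffI)
      fix H assume "\<exists>G'. (\<forall>i. G' i \<in> iso_class (D i)) \<and> H \<cong> sum_group UNIV G'"
      then obtain G' where G': "\<forall>i. G' i \<in> iso_class (D i)" "H \<cong> sum_group UNIV G'"
        by blast
      show "H \<cong> ?S"
        using G'(2) S'[OF G'(1)] by (rule iso_trans)
    next
      fix H assume "H \<cong> ?S"
      with G show "\<exists>G'. (\<forall>i. G' i \<in> iso_class (D i)) \<and> H \<cong> sum_group UNIV G'"
        by (intro exI[of _ G]) simp
    qed
  qed
  then show "A \<in> fin_ab_classes" "\<And>G. G \<in> A \<Longrightarrow> card (carrier G) = (\<Prod>i<K. support_prod (D i))"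
    using iso_class_eq[OF S(1,2)] S(3) by (auto simp: iso_same_card card)
qed

text \<open>Group-partitions with the total left open; those of a fixed class are a fibre of
  \<open>class_direct_sum\<close>.\<close>

definition partition_chains :: "enat \<Rightarrow> (nat \<Rightarrow> nat monoid set) set" where
  "partition_chains r = {X. (\<forall>i. X i \<in> fin_ab_classes) \<and> finite {i. X i \<noteq> trivial_class} \<and>
     (\<forall>i. class_supseteq (X i) (X (Suc i))) \<and> enat (card {i. X i \<noteq> trivial_class}) \<le> r}"

lemma num_partitions_alt:
  "num_partitions r A = card {X \<in> partition_chains r. class_direct_sum X = A}"
  unfolding num_partitions_def group_partition_def partition_chains_def
  by (rule arg_cong[where f = card]) auto

text \<open>The indices with \<open>P\<close> form an initial segment, so a bound on their number is
  a bound on their position. This turns "at most \<open>r\<close> nontrivial factors" into "at most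
  \<open>r\<close> rows".\<close>

lemma initial_segment_card_le:
  assumes "\<And>i. P (Suc i) \<Longrightarrow> P i" "finite {i. P i}"
  shows "enat (card {i. P i}) \<le> r \<longleftrightarrow> (\<forall>i. r \<le> enat i \<longrightarrow> \<not> P i)"
proof
  assume le: "enat (card {i. P i}) \<le> r"
  show "\<forall>i. r \<le> enat i \<longrightarrow> \<not> P i"
  proof (intro allI impI notI)
    fix i assume i: "r \<le> enat i" "P i"
    have "P j" if "j \<le> i" for j
      using that by (induction rule: inc_induct) (use i(2) assms(1) in auto)
    then have "card {..i} \<le> card {i. P i}"
      by (intro card_mono assms(2)) auto
    with le i(1) have "enat (Suc i) \<le> enat i"
      by (metis card_atMost enat_ord_simps(1) order_trans)
    then show False by simp
  qed
next
  assume *: "\<forall>i. r \<le> enat i \<longrightarrow> \<not> P i"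
  show "enat (card {i. P i}) \<le> r"
  proof (cases r)
    case (enat k)
    have "{i. P i} \<subseteq> {..<k}"
      using * enat by (auto simp: not_le[symmetric])
    then have "card {i. P i} \<le> card {..<k}"
      by (intro card_mono) auto
    then show ?thesis
      by (simp add: enat)
  qed simp
qed

lemma plane_partition_chain:
  assumes "D \<in> plane_partitions r"
  shows "divisor_chain (D i)"
proof -
  have "{j. D i j \<noteq> 1} = Pair i -` {(i, j). D i j \<noteq> 1}"
    by auto
  moreover have "finite (Pair i -` {(i, j). D i j \<noteq> 1})"
    by (rule finite_vimageI) (use assms in \<open>auto simp: plane_partitions_def inj_on_def\<close>)
  ultimately show ?thesis
    using assms by (simp add: divisor_chain_def plane_partitions_def)
qed

lemma iso_class_in_partition_chains_iff:
  assumes D: "\<And>i. divisor_chain (D i)"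
  shows "(\<lambda>i. iso_class (D i)) \<in> partition_chains r \<longleftrightarrow> D \<in> plane_partitions r"
proof -
  have triv: "iso_class (D i) \<noteq> trivial_class \<longleftrightarrow> D i \<noteq> (\<lambda>_. 1)" for i
    unfolding trivial_class_eq using iso_class_inject[OF D divisor_chain_1] by simp
  have fin: "finite {i. D i \<noteq> (\<lambda>_. 1)} \<longleftrightarrow> finite {(i, j). D i j \<noteq> 1}"
  proof
    assume f: "finite {i. D i \<noteq> (\<lambda>_. 1)}"
    have "{(i, j). D i j \<noteq> 1} = (SIGMA i:{i. D i \<noteq> (\<lambda>_. 1)}. {j. D i j \<noteq> 1})"
      by auto
    also have "finite \<dots>"
      using f D by (intro finite_SigmaI) (auto simp: divisor_chain_def)
    finally show "finite {(i, j). D i j \<noteq> 1}" .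
  next
    assume f: "finite {(i, j). D i j \<noteq> 1}"
    have "{i. D i \<noteq> (\<lambda>_. 1)} \<subseteq> fst ` {(i, j). D i j \<noteq> 1}"
      by (auto simp: image_iff fun_eq_iff)
    then show "finite {i. D i \<noteq> (\<lambda>_. 1)}"
      using f finite_imageI finite_subset by blast
  qed
  have sup: "class_supseteq (iso_class (D i)) (iso_class (D (Suc i))) \<longleftrightarrow> (\<forall>j. D (Suc i) j dvd D i j)" for i
    by (rule class_supseteq_iso_class[OF D D])
  have le: "enat (card {i. D i \<noteq> (\<lambda>_. 1)}) \<le> r \<longleftrightarrow> (\<forall>i. r \<le> enat i \<longrightarrow> \<not> D i \<noteq> (\<lambda>_. 1))"
    if "\<And>i j. D (Suc i) j dvd D i j" "finite {i. D i \<noteq> (\<lambda>_. 1)}"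
  proof (rule initial_segment_card_le[OF _ that(2)])
    fix i assume "D (Suc i) \<noteq> (\<lambda>_. 1)"
    then show "D i \<noteq> (\<lambda>_. 1)"
      using that(1)[of i] by (metis ext nat_dvd_1_iff_1)
  qed
  have "(\<lambda>i. iso_class (D i)) \<in> partition_chains r \<longleftrightarrow>
     finite {i. D i \<noteq> (\<lambda>_. 1)} \<and> (\<forall>i j. D (Suc i) j dvd D i j) \<and>
     enat (card {i. D i \<noteq> (\<lambda>_. 1)}) \<le> r"
    unfolding partition_chains_def triv mem_Collect_eq sup
    using iso_class_in_classes[OF D] by auto
  also have "\<dots> \<longleftrightarrow> finite {i. D i \<noteq> (\<lambda>_. 1)} \<and> (\<forall>i j. D (Suc i) j dvd D i j) \<and>
      (\<forall>i. r \<le> enat i \<longrightarrow> D i = (\<lambda>_. 1))"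
    using le by blast
  also have "\<dots> \<longleftrightarrow> D \<in> plane_partitions r"
  proof -
    have "(\<forall>i. r \<le> enat i \<longrightarrow> D i = (\<lambda>_. 1)) \<longleftrightarrow> (\<forall>i j. r \<le> enat i \<longrightarrow> D i j = 1)"
      by (auto simp: fun_eq_iff)
    then show ?thesis
      unfolding plane_partitions_def mem_Collect_eq fin using D[unfolded divisor_chain_def] by blast
  qed
  finally show ?thesis .
qed

lemma partition_chains_bij:
  "bij_betw (\<lambda>D i. iso_class (D i)) (plane_partitions r) (partition_chains r)"
  unfolding bij_betw_def
proof
  show "inj_on (\<lambda>D i. iso_class (D i)) (plane_partitions r)"
  proof (rule inj_onI, rule ext)
    fix D E i assume D: "D \<in> plane_partitions r" and E: "E \<in> plane_partitions r"
      and eq: "(\<lambda>i. iso_class (D i)) = (\<lambda>i. iso_class (E i))"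
    show "D i = E i"
      using fun_cong[OF eq, of i] iso_class_inject[OF plane_partition_chain[OF D] plane_partition_chain[OF E]]
      by blast
  qed
  show "(\<lambda>D i. iso_class (D i)) ` plane_partitions r = partition_chains r"
  proof (intro subset_antisym subsetI)
    fix X assume "X \<in> (\<lambda>D i. iso_class (D i)) ` plane_partitions r"
    then show "X \<in> partition_chains r"
      using iso_class_in_partition_chains_iff plane_partition_chain by auto
  next
    fix X assume X: "X \<in> partition_chains r"
    then have "\<forall>i. \<exists>d. divisor_chain d \<and> X i = iso_class d"
      using class_eq_iso_class by (simp add: partition_chains_def)
    then obtain D where D: "\<And>i. divisor_chain (D i)" "\<And>i. X i = iso_class (D i)"
      by metis
    then have "X = (\<lambda>i. iso_class (D i))"
      by blast
    with X D show "X \<in> (\<lambda>D i. iso_class (D i)) ` plane_partitions r"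
      using iso_class_in_partition_chains_iff[of D r] by blast
  qed
qed

lemma class_direct_sum_plane_partition:
  assumes D: "D \<in> plane_partitions r"
  defines "A \<equiv> class_direct_sum (\<lambda>i. iso_class (D i))"
  shows "A \<in> fin_ab_classes" "A \<in> classes_of_order n \<longleftrightarrow> support_prod (\<lambda>(i, j). D i j) = n"
proof -
  have "finite {(i, j). D i j \<noteq> 1}"
    using D by (simp add: plane_partitions_def)
  then have "finite (fst ` {(i, j). D i j \<noteq> 1} \<union> snd ` {(i, j). D i j \<noteq> 1})"
    by blast
  then obtain K where K: "fst ` {(i, j). D i j \<noteq> 1} \<union> snd ` {(i, j). D i j \<noteq> 1} \<subseteq> {..<K}"
    using finite_nat_bounded by blast
  have one: "D i j = 1" if "K \<le> i \<or> K \<le> j" for i j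
  proof (rule ccontr)
    assume "D i j \<noteq> 1"
    then have "i \<in> fst ` {(i, j). D i j \<noteq> 1}" "j \<in> snd ` {(i, j). D i j \<noteq> 1}"
      by force+
    with K that show False by auto
  qed
  have K1: "D i = (\<lambda>_. 1)" if "K \<le> i" for i
    using one that by auto
  note sum = class_direct_sum_iso_class[of D K, OF plane_partition_chain[OF D] K1, folded A_def]
  show A: "A \<in> fin_ab_classes"
    by (rule sum)
  have "support_prod (D i) = (\<Prod>j<K. D i j)" for i
    by (rule support_prod_superset) (use one not_le in auto)
  then have "card (carrier G) = support_prod (\<lambda>(i, j). D i j)" if "G \<in> A" for G
    using sum(2)[OF _ that] support_prod_box[of K K D] one by simp
  then show "A \<in> classes_of_order n \<longleftrightarrow> support_prod (\<lambda>(i, j). D i j) = n"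
    using A class_nonempty[OF A] by (auto simp: classes_of_order_def)
qed

text \<open>A class of order \<open>n\<close> is given by its invariant factors, which form a plane
  partition of \<open>n\<close> with one row, and there are finitely many of these.\<close>

lemma finite_classes_of_order: "finite (classes_of_order n)"
proof (rule finite_subset)
  let ?P = "{D \<in> plane_partitions 1. support_prod (\<lambda>(i, j). D i j) = n}"
  show "classes_of_order n \<subseteq> (\<lambda>D. iso_class (D 0)) ` ?P"
  proof
    fix A assume "A \<in> classes_of_order n"
    then have A: "A \<in> fin_ab_classes" "\<And>G. G \<in> A \<Longrightarrow> card (carrier G) = n"
      by (auto simp: classes_of_order_def)
    obtain d where d: "divisor_chain d" "A = iso_class d"
      using class_eq_iso_class[OF A(1)] by blast
    obtain G where "G \<in> A"
      using class_nonempty[OF A(1)] by blast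
    then have n: "support_prod d = n"
      using card_iso_class[OF d(1)] A(2) d(2) by metis
    let ?D = "\<lambda>(i::nat) j. if i = 0 then d j else 1"
    obtain K where K: "\<And>i. K \<le> i \<Longrightarrow> d i = 1"
      using divisor_chain_bound[OF d(1)] by blast
    have "{(i, j). ?D i j \<noteq> 1} \<subseteq> {0} \<times> {i. d i \<noteq> 1}"
      by auto
    then have "finite {(i, j). ?D i j \<noteq> 1}"
      by (rule finite_subset) (use d in \<open>auto simp: divisor_chain_def\<close>)
    then have "?D \<in> plane_partitions 1"
      using d(1) by (auto simp: plane_partitions_def divisor_chain_def one_enat_def)
    moreover have "support_prod (\<lambda>(i, j). ?D i j) = (\<Prod>i<1. \<Prod>j<K. ?D i j)"
      by (rule support_prod_box[of 1 K ?D]) (use K in auto)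
    moreover have "support_prod d = (\<Prod>j<K. d j)"
      by (rule support_prod_superset) (use K not_le in auto)
    ultimately have "?D \<in> ?P"
      using n by simp
    then show "A \<in> (\<lambda>D. iso_class (D 0)) ` ?P"
      unfolding d(2) by (rule rev_image_eqI) simp
  qed
  show "finite ((\<lambda>D. iso_class (D 0)) ` ?P)"
    by (intro finite_imageI card_plane_partitions(1)[of n n]) simp
qed

text \<open>Each plane partition of \<open>n\<close> lies over exactly one class of order
  \<open>n\<close>, so adding up the fibres of \<open>class_direct_sum\<close> counts all of them
  once.\<close>

theorem a_coeff_eq_card_plane_partitions:
  "a_coeff r n = card {D \<in> plane_partitions r. support_prod (\<lambda>(i, j). D i j) = n}"
proof -
  let ?P = "{D \<in> plane_partitions r. support_prod (\<lambda>(i, j). D i j) = n}"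
  let ?g = "\<lambda>D :: nat \<Rightarrow> nat \<Rightarrow> nat. class_direct_sum (\<lambda>i. iso_class (D i))"
  have fin: "finite ?P"
    by (rule card_plane_partitions(1)[of n n]) simp
  have "num_partitions r A = card {D \<in> ?P. ?g D = A}" if A: "A \<in> classes_of_order n" for A
  proof -
    have "num_partitions r A = card {D \<in> plane_partitions r. ?g D = A}"
      unfolding num_partitions_alt by (rule card_weight_bij[symmetric, OF partition_chains_bij]) simp
    also have "{D \<in> plane_partitions r. ?g D = A} = {D \<in> ?P. ?g D = A}"
      using A class_direct_sum_plane_partition(2)[of _ r n] by blast
    finally show ?thesis .
  qed
  then have "a_coeff r n = (\<Sum>A\<in>classes_of_order n. \<Sum>D\<in>{D \<in> ?P. ?g D = A}. 1)"
    by (simp add: a_coeff_def)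
  also have "\<dots> = (\<Sum>D\<in>?P. 1)"
    by (rule sum.group[OF fin finite_classes_of_order])
      (use class_direct_sum_plane_partition(2)[of _ r n] in blast)
  finally show ?thesis
    by simp
qed

section \<open>Sums over arrays of positive integers\<close>

lemma has_sum_product_norm:
  fixes f :: "'a \<Rightarrow> 'c::{real_normed_field,banach}" and g :: "'b \<Rightarrow> 'c"
  assumes f: "(f has_sum x) A" "(\<lambda>x. norm (f x)) summable_on A" and g: "(g has_sum y) B" "(\<lambda>x. norm (g x)) summable_on B"
  shows "((\<lambda>(a, b). f a * g b) has_sum x * y) (A \<times> B)" "(\<lambda>p. norm (case p of (a, b) \<Rightarrow> f a * g b)) summable_on A \<times> B"
proof -
  show abs: "(\<lambda>p. norm (case p of (a, b) \<Rightarrow> f a * g b)) summable_on A \<times> B"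
    by (rule iffD2[OF Infinite_Sum.abs_summable_on_Sigma_iff[where f = "\<lambda>(a, b). f a * g b" and A = A and B = "\<lambda>_. B"]])
      (use f(2) g(2) in \<open>auto simp: norm_mult abs_mult infsum_cmult_right intro!: summable_on_cmult_right summable_on_cmult_left\<close>)
  show "((\<lambda>(a, b). f a * g b) has_sum x * y) (A \<times> B)"
    by (rule has_sum_SigmaI[where g = "\<lambda>a. f a * y"])
      (use Infinite_Sum.abs_summable_summable[OF abs] f(1) g(1) in \<open>auto intro: has_sum_cmult_right has_sum_cmult_left\<close>)
qed

lemma pos_funs_insert_bij:
  assumes "u \<notin> S"
  shows "bij_betw (\<lambda>(n, A). A(u := n)) ({0<..} \<times> pos_funs S) (pos_funs (insert u S))"
proof (rule bij_betw_byWitness[where f' = "\<lambda>A. (A u, A(u := 1))"])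
  show "\<forall>p\<in>{0<..} \<times> pos_funs S. ((case p of (n, A) \<Rightarrow> A(u := n)) u, (case p of (n, A) \<Rightarrow> A(u := n))(u := 1)) = p"
    using assms by (auto simp: pos_funs_def fun_eq_iff)
qed (use assms in \<open>auto simp: pos_funs_def fun_eq_iff\<close>)

text \<open>Distributivity: absolute convergence allows a finite product of series to be expanded
  into one sum over all choices of an index per factor.\<close>

lemma has_sum_pos_funs:
  fixes f :: "'u \<Rightarrow> nat \<Rightarrow> 'c::{real_normed_field,banach}"
  assumes "finite S" and f: "\<And>u. u \<in> S \<Longrightarrow> (f u has_sum x u) {0<..}" "\<And>u. u \<in> S \<Longrightarrow> (\<lambda>x. norm (f u x)) summable_on {0<..}"
  shows "((\<lambda>A. \<Prod>u\<in>S. f u (A u)) has_sum (\<Prod>u\<in>S. x u)) (pos_funs S) \<and>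
    (\<lambda>A. norm (\<Prod>u\<in>S. f u (A u))) summable_on pos_funs S"
  using assms
proof (induction S rule: finite_induct)
  case empty
  have "(pos_funs {} :: ('u \<Rightarrow> nat) set) = {\<lambda>_. 1}"
    by (auto simp: pos_funs_def fun_eq_iff)
  then show ?case
    by (simp add: has_sum_finite_iff)
next
  case (insert u S)
  let ?P = "\<lambda>A. \<Prod>u\<in>S. f u (A u)"
  have IH: "(?P has_sum (\<Prod>u\<in>S. x u)) (pos_funs S)" "(\<lambda>A. norm (?P A)) summable_on pos_funs S"
    using insert.IH insert.prems by auto
  have fu: "(f u has_sum x u) {0<..}" "(\<lambda>x. norm (f u x)) summable_on {0<..}"
    using insert.prems by auto
  note b = pos_funs_insert_bij[OF insert.hyps(2)]
  have eq: "(\<Prod>v\<in>insert u S. f v ((case p of (n, A) \<Rightarrow> A(u := n)) v)) = (case p of (n, A) \<Rightarrow> f u n * ?P A)" for p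
  proof -
    have "(\<Prod>v\<in>S. f v ((A(u := n)) v)) = ?P A" for A n
      by (rule prod.cong) (use insert.hyps in auto)
    then show ?thesis
      using insert.hyps by (cases p) (simp add: prod.insert)
  qed
  have "((\<lambda>p. \<Prod>v\<in>insert u S. f v ((case p of (n, A) \<Rightarrow> A(u := n)) v)) has_sum x u * (\<Prod>u\<in>S. x u)) ({0<..} \<times> pos_funs S)"
    unfolding eq by (rule has_sum_product_norm[OF fu IH])
  then have 1: "((\<lambda>A. \<Prod>u\<in>insert u S. f u (A u)) has_sum x u * (\<Prod>u\<in>S. x u)) (pos_funs (insert u S))"
    unfolding has_sum_reindex_bij_betw[OF b, of "\<lambda>A. \<Prod>v\<in>insert u S. f v (A v)"] .
  have "(\<lambda>p. norm (\<Prod>v\<in>insert u S. f v ((case p of (n, A) \<Rightarrow> A(u := n)) v))) summable_on ({0<..} \<times> pos_funs S)"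
    unfolding eq by (rule has_sum_product_norm[OF fu IH])
  then have 2: "(\<lambda>A. norm (\<Prod>u\<in>insert u S. f u (A u))) summable_on pos_funs (insert u S)"
    unfolding summable_on_reindex_bij_betw[OF b, of "\<lambda>A. norm (\<Prod>v\<in>insert u S. f v (A v))"] .
  show ?case
    using 1 2 insert.hyps by simp
qed

lemma has_sum_by_fibres:
  fixes f :: "'b \<Rightarrow> 'c::{real_normed_field,banach}"
  assumes sum: "((\<lambda>x. f (w x)) has_sum T) X" and im: "w ` X \<subseteq> Y" and fin: "\<And>y. y \<in> Y \<Longrightarrow> finite {x \<in> X. w x = y}"
  shows "((\<lambda>y. of_nat (card {x \<in> X. w x = y}) * f y) has_sum T) Y"
proof (rule has_sum_SigmaD)
  have "bij_betw (\<lambda>(y, x). x) (SIGMA y:Y. {x \<in> X. w x = y}) X"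
    by (rule bij_betw_byWitness[where f' = "\<lambda>x. (w x, x)"]) (use im in auto)
  from has_sum_reindex_bij_betw[OF this, of "\<lambda>x. f (w x)" T]
  have "((\<lambda>p. f (w (case p of (y, x) \<Rightarrow> x))) has_sum T) (SIGMA y:Y. {x \<in> X. w x = y})"
    using sum by simp
  then show "((\<lambda>(y, x). f y) has_sum T) (SIGMA y:Y. {x \<in> X. w x = y})"
    by (subst has_sum_cong[where g = "\<lambda>p. f (w (case p of (y, x) \<Rightarrow> x))"]) auto
  show "((\<lambda>x. (\<lambda>(y, x). f y) (y, x)) has_sum of_nat (card {x \<in> X. w x = y}) * f y) {x \<in> X. w x = y}"
    if "y \<in> Y" for y
    using fin[OF that] by (simp add: has_sum_finite_iff)
qed

section \<open>Dirichlet series counting arrays by weight\<close>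

definition array_count :: "('u \<Rightarrow> nat) \<Rightarrow> 'u set \<Rightarrow> nat \<Rightarrow> nat" where
  "array_count w S n = card {A \<in> pos_funs S. support_prod (\<lambda>u. A u ^ w u) = n}"

lemma finite_array_fibre:
  assumes "finite S" "\<And>u. u \<in> S \<Longrightarrow> 0 < w u"
  shows "finite {A \<in> pos_funs S. support_prod (\<lambda>u. A u ^ w u) = (n::nat)}"
proof (rule finite_subset)
  let ?g = "\<lambda>f u. if u \<in> S then f u else 1"
  show "{A \<in> pos_funs S. support_prod (\<lambda>u. A u ^ w u) = n} \<subseteq> ?g ` (\<Pi>\<^sub>E u\<in>S. {..n})"
  proof
    fix A assume "A \<in> {A \<in> pos_funs S. support_prod (\<lambda>u. A u ^ w u) = n}"
    then have A: "A \<in> pos_funs S" "support_prod (\<lambda>u. A u ^ w u) = n"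
      by simp_all
    have pos: "0 < A u" for u
      using A(1) by (simp add: pos_funs_def)
    have "A u \<le> n" if "u \<in> S" for u
    proof -
      have "A u \<le> A u ^ w u"
        using assms(2)[OF that] pos[of u] by (simp add: self_le_power)
      also have "A u ^ w u dvd support_prod (\<lambda>u. A u ^ w u)"
        by (rule dvd_support_prod[of "\<lambda>u. A u ^ w u"])
          (rule finite_subset[OF _ assms(1)], use A(1) in \<open>auto simp: pos_funs_def\<close>)
      then have "A u ^ w u \<le> n"
        unfolding A(2)[symmetric] by (rule dvd_imp_le) (intro support_prod_pos zero_less_power pos)
      finally show ?thesis .
    qed
    then have "restrict A S \<in> (\<Pi>\<^sub>E u\<in>S. {..n})"
      by auto
    moreover have "A = ?g (restrict A S)"
      using A(1) by (auto simp: pos_funs_def fun_eq_iff)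
    ultimately show "A \<in> ?g ` (\<Pi>\<^sub>E u\<in>S. {..n})"
      by blast
  qed
  show "finite (?g ` (\<Pi>\<^sub>E u\<in>S. {..n}))"
    using assms(1) by (intro finite_imageI finite_PiE) auto
qed

lemma array_count_mono:
  assumes "finite T" "\<And>u. u \<in> T \<Longrightarrow> 0 < w u" "S \<subseteq> T"
  shows "array_count w S n \<le> array_count w T n"
  unfolding array_count_def
  by (rule card_mono[OF finite_array_fibre[OF assms(1,2)]]) (use assms(3) in \<open>auto simp: pos_funs_def\<close>)

lemma support_prod_pos_funs:
  assumes "finite S" "A \<in> pos_funs S"
  shows "support_prod (\<lambda>u. A u ^ w u :: nat) = (\<Prod>u\<in>S. A u ^ w u)"
  by (rule support_prod_superset[OF assms(1)]) (use assms(2) in \<open>auto simp: pos_funs_def\<close>)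

text \<open>Abstracts n \<mapsto> chi(n) n^(-s). The locale is closed under positive powers, which
  replace s by ms and chi by chi^m, and under taking norms, which yields the majorants; the codomain
  is kept general so that the norms are an instance too.\<close>

locale completely_multiplicative =
  fixes F :: "nat \<Rightarrow> 'a::{real_normed_field,banach}"
  assumes F_0: "F 0 = 0" and F_1: "F 1 = 1" and F_mult: "\<And>m n. F (m * n) = F m * F n"
    and F_summable: "summable (\<lambda>n. norm (F n))"
    and F_le: "\<And>n. 2 \<le> n \<Longrightarrow> norm (F n) \<le> 1 / 2"
begin

definition tail :: real where "tail = (\<Sum>n. norm (F (n + 2)))"

text \<open>For F(n) = chi(n) n^(-s) and positive m this is L(ms, chi^m).\<close>

definition power_sum :: "nat \<Rightarrow> 'a" where "power_sum m = (\<Sum>n. F (Suc n) ^ m)"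

lemma F_power: "F (n ^ k) = F n ^ k"
  using F_1 by (induction k) (simp_all add: F_mult)

lemma F_prod: "F (\<Prod>u\<in>S. g u) = (\<Prod>u\<in>S. F (g u))"
  using F_1 by (induction S rule: infinite_finite_induct) (simp_all add: F_mult)

lemma tail_nonneg: "0 \<le> tail"
  unfolding tail_def by (intro suminf_nonneg summable_ignore_initial_segment F_summable) simp

lemma norm_F_power_le: "norm (F (n + 2) ^ Suc m) \<le> (1 / 2) ^ m * norm (F (n + 2))"
proof -
  have "norm (F (n + 2)) ^ m \<le> (1 / 2) ^ m"
    using F_le[of "n + 2"] by (intro power_mono) auto
  then have "norm (F (n + 2)) ^ m * norm (F (n + 2)) \<le> (1 / 2) ^ m * norm (F (n + 2))"
    by (rule mult_right_mono) simp
  then show ?thesis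
    by (simp only: norm_power norm_mult power_Suc2)
qed

lemma summable_norm_F_power: "summable (\<lambda>n. norm (F n ^ Suc m))"
proof -
  have "summable (\<lambda>n. norm (F (n + 2)))"
    using F_summable by (rule summable_ignore_initial_segment)
  then have "summable (\<lambda>n. norm (F (n + 2) ^ Suc m))"
    by (rule summable_comparison_test'[OF summable_mult[of _ "(1 / 2) ^ m"], of _ 0]) (use norm_F_power_le in simp)
  then show ?thesis
    by (rule iffD1[OF summable_iff_shift])
qed

lemma sums_power_sum: "(\<lambda>n. F (Suc n) ^ Suc m) sums power_sum (Suc m)"
proof -
  have "summable (\<lambda>n. F n ^ Suc m)"
    using summable_norm_F_power by (rule summable_norm_cancel)
  then have "summable (\<lambda>n. F (Suc n) ^ Suc m)"
    by (subst summable_Suc_iff)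
  then show ?thesis
    unfolding power_sum_def by (rule summable_sums)
qed

text \<open>Every term except the one for n = 1, which is 1, gains a factor 2^(-m) from
  \<open>F_le\<close>. This decay outweighs the multiplicities, which grow only linearly.\<close>

lemma norm_power_sum_minus_1: "norm (power_sum (Suc m) - 1) \<le> (1 / 2) ^ m * tail"
proof -
  have s: "summable (\<lambda>n. norm (F (n + 2) ^ Suc m))"
    using summable_norm_F_power[of m] by (rule summable_ignore_initial_segment)
  have s2: "summable (\<lambda>n. norm (F (n + 2)))"
    using F_summable by (rule summable_ignore_initial_segment)
  have "power_sum (Suc m) - 1 = (\<Sum>n. F (n + 2) ^ Suc m)"
    using suminf_split_head[OF sums_summable[OF sums_power_sum[of m]]] F_1 sums_unique[OF sums_power_sum[of m]] by simp
  also have "norm \<dots> \<le> (\<Sum>n. norm (F (n + 2) ^ Suc m))"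
    by (rule summable_norm[OF s])
  also have "\<dots> \<le> (\<Sum>n. (1 / 2) ^ m * norm (F (n + 2)))"
    by (intro suminf_le norm_F_power_le s summable_mult s2)
  also have "\<dots> = (1 / 2) ^ m * tail"
    unfolding tail_def by (rule suminf_mult[OF s2])
  finally show ?thesis .
qed

lemma has_sum_power_sum:
  "((\<lambda>n. F n ^ Suc m) has_sum power_sum (Suc m)) {0<..}" "(\<lambda>n. norm (F n ^ Suc m)) summable_on {0<..}"
proof -
  have "((\<lambda>n. F (Suc n) ^ Suc m) has_sum power_sum (Suc m)) UNIV"
  proof (rule norm_summable_imp_has_sum[OF _ sums_power_sum])
    show "summable (\<lambda>n. norm (F (Suc n) ^ Suc m))"
      using summable_norm_F_power[of m] by (subst summable_Suc_iff)
  qed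
  moreover have "bij_betw Suc UNIV {0<..}"
    by (rule bij_betw_byWitness[where f' = "\<lambda>n. n - 1"]) auto
  ultimately show "((\<lambda>n. F n ^ Suc m) has_sum power_sum (Suc m)) {0<..}"
    by (simp only: has_sum_reindex_bij_betw[of Suc UNIV "{0<..}" "\<lambda>n. F n ^ Suc m"])
  have "(\<lambda>n. norm (F n ^ Suc m)) summable_on UNIV"
    using norm_summable_imp_summable_on[of "\<lambda>n. norm (F n ^ Suc m)"] summable_norm_F_power[of m] by simp
  then show "(\<lambda>n. norm (F n ^ Suc m)) summable_on {0<..}"
    by (rule summable_on_subset_banach) simp
qed

text \<open>In the expanded product, complete multiplicativity makes each term \<open>F\<close> of
  the weight of its array; collecting equal weights gives the series.\<close>

theorem sums_array_count:
  assumes S: "finite S" and w: "\<And>u. u \<in> S \<Longrightarrow> 0 < w u"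
  shows "((\<lambda>n. of_nat (array_count w S n) * F n) sums (\<Prod>u\<in>S. power_sum (w u)))"
proof -
  let ?w = "\<lambda>A :: 'b \<Rightarrow> nat. support_prod (\<lambda>u. A u ^ w u)"
  have L: "((\<lambda>n. F n ^ w u) has_sum power_sum (w u)) {0<..}" "(\<lambda>n. norm (F n ^ w u)) summable_on {0<..}" if "u \<in> S" for u
    using has_sum_power_sum[of "w u - 1"] w[OF that] by simp_all
  have "((\<lambda>A. \<Prod>u\<in>S. F (A u) ^ w u) has_sum (\<Prod>u\<in>S. power_sum (w u))) (pos_funs S)"
    using has_sum_pos_funs[of S "\<lambda>u n. F n ^ w u" "\<lambda>u. power_sum (w u)", OF S L] by blast
  also have "?this \<longleftrightarrow> ((\<lambda>A. F (?w A)) has_sum (\<Prod>u\<in>S. power_sum (w u))) (pos_funs S)"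
    by (rule has_sum_cong) (simp add: support_prod_pos_funs[OF S] F_prod F_power)
  finally have "((\<lambda>n. of_nat (card {A \<in> pos_funs S. ?w A = n}) * F n) has_sum (\<Prod>u\<in>S. power_sum (w u))) UNIV"
    by (rule has_sum_by_fibres) (use finite_array_fibre[OF S w] in auto)
  then show ?thesis
    unfolding array_count_def by (rule has_sum_imp_sums)
qed

end

section \<open>Euler products and absolute convergence\<close>

text \<open>With d = |y - 1| the left side is at most (1 + d)^c - 1 <= exp(cd) - 1 <= cd + (cd)^2,
  and cd <= 1 absorbs the square.\<close>

lemma norm_power_minus_1_le:
  fixes y :: "'a::real_normed_field"
  assumes "real c * norm (y - 1) \<le> 1"
  shows "norm (y ^ c - 1) \<le> 2 * (real c * norm (y - 1))"
proof -
  let ?d = "norm (y - 1)"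
  have y: "norm y \<le> 1 + ?d"
    using norm_triangle_ineq[of 1 "y - 1"] by simp
  have "norm (y ^ n - 1) \<le> (1 + ?d) ^ n - 1" for n
  proof (induction n)
    case (Suc n)
    have "y ^ Suc n - 1 = y * (y ^ n - 1) + (y - 1)"
      by (simp add: algebra_simps)
    then have "norm (y ^ Suc n - 1) \<le> norm y * norm (y ^ n - 1) + ?d"
      by (metis norm_mult norm_triangle_ineq)
    also have "\<dots> \<le> (1 + ?d) * ((1 + ?d) ^ n - 1) + ?d"
      by (intro add_right_mono mult_mono y Suc) simp_all
    finally show ?case
      by (simp add: algebra_simps)
  qed simp
  also have "(1 + ?d) ^ c \<le> exp ?d ^ c"
    by (intro power_mono exp_ge_add_one_self) simp
  also have "exp ?d ^ c = exp (real c * ?d)"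
    by (simp add: exp_of_nat_mult)
  also have "\<dots> \<le> 1 + real c * ?d + (real c * ?d)\<^sup>2"
    by (rule exp_bound) (use assms in auto)
  also have "(real c * ?d)\<^sup>2 \<le> real c * ?d"
    using assms by (simp add: power2_eq_square mult_left_le)
  finally show ?thesis
    by simp
qed

lemma summable_Suc_half_power: "summable (\<lambda>m. real (Suc m) * (1 / 2) ^ m)"
  using geometric_deriv_sums[of "1 / 2 :: real"] by (auto simp: sums_iff)

context completely_multiplicative
begin

lemma completely_multiplicative_power: "completely_multiplicative (\<lambda>n. F n ^ Suc m)"
proof
  show "norm (F n ^ Suc m) \<le> 1 / 2" if "2 \<le> n" for n
  proof -
    have "norm (F n) ^ Suc m \<le> (1 / 2) ^ Suc m"
      using F_le[OF that] by (intro power_mono) auto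
    also have "\<dots> \<le> 1 / 2"
      using power_le_one[of "1 / 2 :: real" m] by simp
    finally show ?thesis
      by (simp add: norm_power norm_mult)
  qed
qed (use F_1 summable_norm_F_power[of m] in \<open>simp_all add: F_0 F_mult power_mult_distrib\<close>)

lemma completely_multiplicative_norm: "completely_multiplicative (\<lambda>n. norm (F n))"
  by unfold_locales (use F_1 F_summable F_le in \<open>simp_all add: F_0 F_mult norm_mult\<close>)

definition smooth :: "nat set \<Rightarrow> nat set" where
  "smooth P = {n. 0 < n \<and> (\<forall>q. prime q \<longrightarrow> q dvd n \<longrightarrow> q \<in> P)}"

lemma F_summable_on: "F summable_on A"
  using norm_summable_imp_summable_on[OF F_summable] by (rule summable_on_subset_banach) simp

lemma one_minus_F_nonzero: "2 \<le> n \<Longrightarrow> 1 - F n \<noteq> 0"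
  using F_le[of n] by auto

text \<open>The numbers that are smooth for P with p added are those smooth for P together with p
  times the whole set itself. The resulting linear equation is solved for the sum, without expanding
  a geometric series.\<close>

lemma infsum_smooth:
  assumes "finite P" "\<And>p. p \<in> P \<Longrightarrow> prime p"
  shows "infsum F (smooth P) = (\<Prod>p\<in>P. inverse (1 - F p))"
  using assms
proof (induction P rule: finite_induct)
  case empty
  have "smooth {} = {1}"
    using prime_factor_nat by (auto simp: smooth_def)
  then show ?case
    using F_1 by simp
next
  case (insert p P)
  let ?A = "smooth (insert p P)"
  have p: "prime p" "2 \<le> p"
    using insert.prems prime_ge_2_nat by auto
  have A: "?A = smooth P \<union> (*) p ` ?A"
  proof (intro subset_antisym subsetI)
    fix n assume n: "n \<in> ?A"
    show "n \<in> smooth P \<union> (*) p ` ?A"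
    proof (cases "p dvd n")
      case True
      then obtain k where "n = p * k" by blast
      moreover from this have "k \<in> ?A"
        using n by (auto simp: smooth_def)
      ultimately show ?thesis by blast
    next
      case False
      with n show ?thesis by (auto simp: smooth_def)
    qed
  next
    fix n assume "n \<in> smooth P \<union> (*) p ` ?A"
    then show "n \<in> ?A"
      using p by (auto simp: smooth_def prime_dvd_mult_iff primes_dvd_imp_eq)
  qed
  have disj: "smooth P \<inter> (*) p ` ?A = {}"
    using insert.hyps(2) p(1) by (auto simp: smooth_def)
  have "infsum F ?A = infsum F (smooth P) + infsum F ((*) p ` ?A)"
    by (subst A) (rule infsum_Un_disjoint[OF F_summable_on F_summable_on disj])
  also have "infsum F ((*) p ` ?A) = infsum (\<lambda>k. F p * F k) ?A"
    by (subst infsum_reindex) (use p in \<open>auto simp: inj_on_def o_def F_mult\<close>)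
  also have "\<dots> = F p * infsum F ?A"
    by (rule infsum_cmult_right) (rule F_summable_on)
  finally have "infsum F ?A - infsum F ?A * F p = infsum F (smooth P)"
    by (metis add_diff_cancel_right' mult.commute)
  then have "infsum F ?A * (1 - F p) = infsum F (smooth P)"
    by (simp only: right_diff_distrib mult_1_right)
  then have "infsum F ?A = infsum F (smooth P) * inverse (1 - F p)"
    using one_minus_F_nonzero[OF p(2)] by (simp add: field_simps)
  then show ?case
    using insert by (simp add: mult.commute)
qed

lemma norm_inverse_minus_1_le:
  assumes "norm x \<le> 1 / 2"
  shows "norm (inverse (1 - x) - 1) \<le> 2 * norm (x :: 'a)"
proof -
  have h: "1 / 2 \<le> norm (1 - x)"
    using norm_triangle_ineq2[of 1 x] assms by simp
  then have "1 - x \<noteq> 0"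
    by auto
  then have "inverse (1 - x) - 1 = x / (1 - x)"
    by (simp add: field_simps)
  then have "norm (inverse (1 - x) - 1) = norm x / norm (1 - x)"
    by (simp add: norm_divide)
  also have "\<dots> \<le> norm x / (1 / 2)"
    using h by (intro divide_left_mono) auto
  finally show ?thesis by simp
qed

lemma convergent_prod_euler: "convergent_prod (\<lambda>p. if prime p then inverse (1 - F p) else 1)"
proof (rule abs_convergent_prod_imp_convergent_prod)
  have "norm ((if prime p then inverse (1 - F p) else 1) - 1) \<le> 2 * norm (F p)" for p :: nat
    using norm_inverse_minus_1_le[OF F_le[of p]] prime_ge_2_nat[of p] by auto
  then have "summable (\<lambda>p. norm ((if prime p then inverse (1 - F p) else 1) - 1))"
    by (intro summable_comparison_test'[OF summable_mult[OF F_summable, of 2], of 0]) simp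
  then show "abs_convergent_prod (\<lambda>p. if prime p then inverse (1 - F p) else 1)"
    by (simp add: abs_convergent_prod_conv_summable)
qed

lemma power_sum_1: "power_sum 1 = (\<Sum>n. F n)"
  using suminf_split_head[OF summable_norm_cancel[OF F_summable]] F_0 by (simp add: power_sum_def)

text \<open>The product over the primes up to N sums \<open>F\<close> over the N-smooth numbers.
  Every positive n is N-smooth for large N, and the norms of \<open>F\<close> are a summable
  majorant, so Tannery's theorem gives the limit.\<close>

lemma prodinf_euler: "prodinf (\<lambda>p. if prime p then inverse (1 - F p) else 1) = power_sum 1"
proof (rule LIMSEQ_unique)
  let ?g = "\<lambda>p. if prime p then inverse (1 - F p) else 1"
  show "(\<lambda>N. \<Prod>p\<le>N. ?g p) \<longlonglongrightarrow> prodinf ?g"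
    by (rule convergent_prod_LIMSEQ[OF convergent_prod_euler])
  define A where "A N = smooth {p. p \<le> N \<and> prime p}" for N
  have eq: "(\<Prod>p\<le>N. ?g p) = (\<Sum>n. if n \<in> A N then F n else 0)" for N
  proof -
    have "(\<Prod>p\<le>N. ?g p) = (\<Prod>p\<in>{p. p \<le> N \<and> prime p}. inverse (1 - F p))"
      by (rule prod.mono_neutral_cong_right) auto
    also have "\<dots> = infsum F (A N)"
      unfolding A_def by (rule infsum_smooth[symmetric]) auto
    finally have "(F has_sum (\<Prod>p\<le>N. ?g p)) (A N)"
      using F_summable_on by simp
    also have "?this \<longleftrightarrow> ((\<lambda>n. if n \<in> A N then F n else 0) has_sum (\<Prod>p\<le>N. ?g p)) UNIV"
      by (rule has_sum_cong_neutral) auto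
    finally show ?thesis
      using has_sum_imp_sums sums_unique by blast
  qed
  have "(\<lambda>N. \<Sum>n. if n \<in> A N then F n else 0) \<longlonglongrightarrow> (\<Sum>n. F n)"
  proof (rule tannerys_theorem[where M = "\<lambda>n. norm (F n)", THEN conjunct2, THEN conjunct2])
    fix n
    show "(\<lambda>N. if n \<in> A N then F n else 0) \<longlonglongrightarrow> F n"
    proof (cases "n = 0")
      case False
      have "eventually (\<lambda>N. (if n \<in> A N then F n else 0) = F n) sequentially"
        using eventually_ge_at_top[of n]
      proof eventually_elim
        case (elim N)
        then have "n \<in> A N"
          using False by (auto simp: A_def smooth_def dest: dvd_imp_le)
        then show ?case by simp
      qed
      then show ?thesis
        by (rule tendsto_eventually)
    qed (simp add: F_0 if_distrib cong: if_cong)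
  qed (auto simp: F_summable case_prod_unfold)
  then show "(\<lambda>N. \<Prod>p\<le>N. ?g p) \<longlonglongrightarrow> power_sum 1"
    unfolding eq power_sum_1 .
qed

theorem prodinf_euler_power:
  "prodinf (\<lambda>p. if prime p then inverse (1 - F p ^ Suc m) ^ c else 1) = power_sum (Suc m) ^ c"
proof -
  interpret P: completely_multiplicative "\<lambda>n. F n ^ Suc m"
    by (rule completely_multiplicative_power)
  have "(\<lambda>p :: nat. if prime p then inverse (1 - F p ^ Suc m) ^ c else 1) =
      (\<lambda>p. (if prime p then inverse (1 - F p ^ Suc m) else 1) ^ c)"
    by auto
  moreover have "P.power_sum 1 = power_sum (Suc m)"
    unfolding P.power_sum_def power_sum_def by simp
  ultimately show ?thesis
    using prodinf_power[OF P.convergent_prod_euler, of c] P.prodinf_euler by (simp only:)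
qed

theorem summable_on_euler_factors:
  assumes c: "\<And>m. c m \<le> m"
  shows "(\<lambda>(m, p). norm (inverse (1 - F p ^ m) ^ c m - 1)) summable_on ({1..} \<times> {p. prime p})"
proof (rule summable_on_comparison_test)
  \<comment> \<open>The constant collects a factor 2 for inverting 1 - F(p)^m and a factor 2 for
    raising the inverse to the power c(m).\<close>
  let ?g = "\<lambda>m. 4 * (real m * (1 / 2) ^ (m - 1))"
  have "(\<lambda>m. 4 * (real (Suc m) * (1 / 2) ^ m)) summable_on UNIV"
    using summable_mult[OF summable_Suc_half_power, of 4] by (intro norm_summable_imp_summable_on) simp
  moreover have "bij_betw Suc UNIV {1..}"
    by (rule bij_betw_byWitness[where f' = "\<lambda>n. n - 1"]) auto
  ultimately have g: "?g summable_on {1..}"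
    using summable_on_reindex_bij_betw[of Suc UNIV "{1..}" ?g] by simp
  have "(\<lambda>p. norm (F p)) summable_on UNIV"
    using norm_summable_imp_summable_on[of "\<lambda>n. norm (F n)"] F_summable by simp
  then have h: "(\<lambda>p. norm (F p)) summable_on {p. prime p}"
    by (rule summable_on_subset_banach) simp
  have "(\<lambda>u. norm (case u of (m, p) \<Rightarrow> ?g m * norm (F p))) summable_on ({1..} \<times> {p. prime p})"
    by (rule has_sum_product_norm(2)[OF has_sum_infsum[OF g] _ has_sum_infsum[OF h]]) (use g h in simp_all)
  then show "(\<lambda>(m, p). ?g m * norm (F p)) summable_on ({1..} \<times> {p. prime p})"
    by (rule Infinite_Sum.abs_summable_summable)
  fix u :: "nat \<times> nat" assume "u \<in> {1..} \<times> {p. prime p}"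
  then obtain k p where u: "u = (Suc k, p)" "prime p"
    by (cases u; cases "fst u") auto
  then have p: "2 \<le> p"
    using prime_ge_2_nat by blast
  have n: "norm (F p ^ Suc k) \<le> (1 / 2) ^ k * norm (F p)"
    using norm_F_power_le[of "p - 2" k] p by (simp only: le_add_diff_inverse2)
  have half: "(1 / 2) ^ k * norm (F p) \<le> (1 / 2) ^ Suc k"
    using F_le[OF p] by (simp add: mult_left_mono)
  have "norm (F p ^ Suc k) \<le> (1 / 2) ^ Suc k"
    using n half by (rule order_trans)
  also have "\<dots> \<le> 1 / 2"
    using power_le_one[of "1 / 2 :: real" k] by simp
  finally have y: "norm (inverse (1 - F p ^ Suc k) - 1) \<le> 2 * norm (F p ^ Suc k)"
    by (rule norm_inverse_minus_1_le)
  \<comment> \<open>Used twice: continued below, it gives the bound 1 that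
    \<open>norm_power_minus_1_le\<close> requires, by k + 1 <= 2^k; afterwards it supplies the
    majorant itself.\<close>
  have cd: "real (c (Suc k)) * norm (inverse (1 - F p ^ Suc k) - 1) \<le> real (Suc k) * (2 * ((1 / 2) ^ k * norm (F p)))"
    using c[of "Suc k"] y n by (intro mult_mono) auto
  also have "\<dots> \<le> real (Suc k) * (2 * (1 / 2) ^ Suc k)"
    using half by (intro mult_left_mono) auto
  also have "\<dots> = real (Suc k) / 2 ^ k"
    by (simp add: power_divide)
  also have "\<dots> \<le> 1"
  proof -
    have "Suc k \<le> 2 ^ k"
      by (rule Suc_leI) (rule less_exp)
    then have "real (Suc k) \<le> 2 ^ k"
      by (metis of_nat_le_iff of_nat_numeral of_nat_power)
    then show ?thesis by simp
  qed
  finally have "norm (inverse (1 - F p ^ Suc k) ^ c (Suc k) - 1) \<le>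
      2 * (real (c (Suc k)) * norm (inverse (1 - F p ^ Suc k) - 1))"
    by (rule norm_power_minus_1_le)
  also have "\<dots> \<le> 2 * (real (Suc k) * (2 * ((1 / 2) ^ k * norm (F p))))"
    by (rule mult_left_mono[OF cd]) simp
  finally show "(case u of (m, p) \<Rightarrow> norm (inverse (1 - F p ^ m) ^ c m - 1)) \<le> (case u of (m, p) \<Rightarrow> ?g m * norm (F p))"
    by (simp add: u mult_ac)
qed (auto split: prod.splits)

theorem abs_convergent_prod_power_sum:
  assumes c: "\<And>m. c m \<le> Suc m"
  shows "abs_convergent_prod (\<lambda>m. power_sum (Suc m) ^ c m)"
proof -
  let ?b = "\<lambda>m. tail * (real (Suc m) * (1 / 2) ^ m)"
  have b: "summable ?b"
    by (rule summable_mult[OF summable_Suc_half_power])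
  have cd: "real (c m) * norm (power_sum (Suc m) - 1) \<le> ?b m" for m
  proof -
    have "real (c m) * norm (power_sum (Suc m) - 1) \<le> real (Suc m) * ((1 / 2) ^ m * tail)"
      using c[of m] norm_power_sum_minus_1[of m] by (intro mult_mono) auto
    then show ?thesis by (simp add: mult_ac)
  qed
  \<comment> \<open>\<open>tail\<close> may be large, so the bound 1 required by
    \<open>norm_power_minus_1_le\<close> is only guaranteed for large m.\<close>
  have "?b \<longlonglongrightarrow> 0"
    by (rule summable_LIMSEQ_zero[OF b])
  then have "eventually (\<lambda>m. ?b m < 1) sequentially"
    by (rule order_tendstoD) simp
  then have "eventually (\<lambda>m. norm (norm (power_sum (Suc m) ^ c m - 1)) \<le> 2 * ?b m) sequentially"
  proof eventually_elim
    case (elim m)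
    then have "real (c m) * norm (power_sum (Suc m) - 1) \<le> 1"
      using cd[of m] by simp
    then have "norm (power_sum (Suc m) ^ c m - 1) \<le> 2 * (real (c m) * norm (power_sum (Suc m) - 1))"
      by (rule norm_power_minus_1_le)
    also have "\<dots> \<le> 2 * ?b m"
      using cd[of m] by simp
    finally show ?case by simp
  qed
  then have "summable (\<lambda>m. norm (power_sum (Suc m) ^ c m - 1))"
    by (rule summable_comparison_test_ev) (rule summable_mult[OF b])
  then show ?thesis
    by (simp add: abs_convergent_prod_conv_summable)
qed

end

section \<open>The generating Dirichlet series\<close>

text \<open>The exponent belonging to m + 1, since the infinite products are indexed from 0.\<close>

definition hook_mult :: "enat \<Rightarrow> nat \<Rightarrow> nat" where
  "hook_mult r m = (case r of enat k \<Rightarrow> min (Suc m) k | \<infinity> \<Rightarrow> Suc m)"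

lemma hook_mult_enat: "hook_mult (enat r) m = min (Suc m) r"
  and hook_mult_infinity: "hook_mult \<infinity> m = Suc m"
  by (simp_all add: hook_mult_def)

lemma hook_mult_le: "hook_mult r m \<le> Suc m"
  by (cases r) (simp_all add: hook_mult_def)

lemma card_hooks: "card {(a, t). enat a < r \<and> a + t = m} = hook_mult r m"
proof -
  have "bij_betw (\<lambda>a. (a, m - a)) {a. enat a < r \<and> a \<le> m} {(a, t). enat a < r \<and> a + t = m}"
    by (rule bij_betw_byWitness[where f' = fst]) auto
  then have "card {(a, t). enat a < r \<and> a + t = m} = card {a. enat a < r \<and> a \<le> m}"
    by (rule bij_betw_same_card[symmetric])
  also have "\<dots> = hook_mult r m"
  proof (cases r)
    case (enat k)
    have "{a. enat a < r \<and> a \<le> m} = {..<min (Suc m) k}"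
      by (auto simp: enat)
    then show ?thesis by (simp add: hook_mult_def enat)
  next
    case infinity
    have "{a. enat a < r \<and> a \<le> m} = {..m}"
      by (auto simp: infinity)
    then show ?thesis by (simp add: hook_mult_def infinity)
  qed
  finally show ?thesis .
qed

definition hooks :: "enat \<Rightarrow> nat \<Rightarrow> (nat \<times> nat) set" where
  "hooks r M = {(a, t). enat a < r \<and> a + t < M}"

text \<open>The size of the hook made of the cell and the cells before it in its row and in its
  column, back to the edges of the quadrant.\<close>

definition hook_length :: "nat \<times> nat \<Rightarrow> nat" where
  "hook_length u = fst u + snd u + 1"

lemma finite_hooks: "finite (hooks r M)"
  unfolding hooks_def by (rule finite_subset[of _ "{..<M} \<times> {..<M}"]) auto

lemma prod_hooks: "(\<Prod>u\<in>hooks r M. g (hook_length u)) = (\<Prod>m<M. g (Suc m) ^ hook_mult r m)"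
  for g :: "nat \<Rightarrow> 'a::comm_monoid_mult"
proof -
  have "(\<Prod>u\<in>hooks r M. g (hook_length u)) =
      (\<Prod>m<M. \<Prod>u\<in>{u \<in> hooks r M. fst u + snd u = m}. g (hook_length u))"
    by (rule prod.group[symmetric, OF finite_hooks]) (auto simp: hooks_def)
  also have "\<dots> = (\<Prod>m<M. g (Suc m) ^ hook_mult r m)"
  proof (rule prod.cong[OF refl])
    fix m assume m: "m \<in> {..<M}"
    have "{u \<in> hooks r M. fst u + snd u = m} = {(a, t). enat a < r \<and> a + t = m}"
      using m by (auto simp: hooks_def)
    then have "(\<Prod>u\<in>{u \<in> hooks r M. fst u + snd u = m}. g (hook_length u)) =
        (\<Prod>u\<in>{(a, t). enat a < r \<and> a + t = m}. g (Suc m))"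
      by (intro prod.cong) (auto simp: hook_length_def)
    then show "(\<Prod>u\<in>{u \<in> hooks r M. fst u + snd u = m}. g (hook_length u)) = g (Suc m) ^ hook_mult r m"
      by (simp add: card_hooks)
  qed
  finally show ?thesis .
qed

text \<open>A cell outside the triangle has hook length greater than \<open>M\<close>, and a
  nontrivial entry there would make the weight exceed \<open>n\<close>.\<close>

lemma array_count_hooks:
  assumes "n \<le> M"
  shows "array_count hook_length (hooks r M) n = a_coeff r n"
proof -
  have "(\<lambda>(a, t). A (a, t) ^ (a + t + 1)) = (\<lambda>u. A u ^ hook_length u)" for A :: "nat \<times> nat \<Rightarrow> nat"
    by (auto simp: hook_length_def)
  then show ?thesis
    unfolding a_coeff_eq_card_plane_partitions card_plane_partitions(2)[OF assms] array_count_def hooks_def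
    by simp
qed

lemma array_count_hooks_le: "array_count hook_length (hooks r M) n \<le> a_coeff r n"
proof -
  have "array_count hook_length (hooks r M) n \<le> array_count hook_length (hooks r (max M n)) n"
    by (rule array_count_mono[OF finite_hooks]) (auto simp: hook_length_def hooks_def)
  also have "\<dots> = a_coeff r n"
    by (rule array_count_hooks) simp
  finally show ?thesis .
qed

context completely_multiplicative
begin

lemma sums_hooks:
  "(\<lambda>n. of_nat (array_count hook_length (hooks r M) n) * F n) sums (\<Prod>m<M. power_sum (Suc m) ^ hook_mult r m)"
  unfolding prod_hooks[symmetric] by (rule sums_array_count[OF finite_hooks]) (simp add: hook_length_def)

end

text \<open>Below \<open>K\<close> the coefficients agree with those of the triangle of size
  \<open>K\<close>. For the norms of \<open>F\<close>, the sum over that triangle is a finite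
  product, and 1 + x <= exp x bounds it independently of \<open>K\<close>.\<close>

lemma (in completely_multiplicative) summable_a_coeff:
  "summable (\<lambda>n. norm (of_nat (a_coeff r n) * F n))"
proof -
  interpret N: completely_multiplicative "\<lambda>n. norm (F n)"
    by (rule completely_multiplicative_norm)
  let ?s = "\<Sum>m. N.tail * (real (Suc m) * (1 / 2) ^ m)"
  have sm: "summable (\<lambda>m. N.tail * (real (Suc m) * (1 / 2) ^ m))"
    by (rule summable_mult[OF summable_Suc_half_power])
  have pos: "0 \<le> N.power_sum (Suc m)" for m
    using N.sums_power_sum[of m] by (rule sums_le[OF _ sums_zero, rotated]) simp
  have le: "N.power_sum (Suc m) ^ hook_mult r m \<le> exp (N.tail * (real (Suc m) * (1 / 2) ^ m))" for m
  proof -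
    have "N.power_sum (Suc m) \<le> 1 + (1 / 2) ^ m * N.tail"
      using N.norm_power_sum_minus_1[of m] by simp
    also have "\<dots> \<le> exp ((1 / 2) ^ m * N.tail)"
      by (rule exp_ge_add_one_self)
    finally have "N.power_sum (Suc m) ^ hook_mult r m \<le> exp ((1 / 2) ^ m * N.tail) ^ hook_mult r m"
      using pos by (intro power_mono)
    also have "\<dots> = exp (real (hook_mult r m) * ((1 / 2) ^ m * N.tail))"
      by (simp add: exp_of_nat_mult)
    also have "\<dots> \<le> exp (real (Suc m) * ((1 / 2) ^ m * N.tail))"
      using hook_mult_le[of r m] N.tail_nonneg by (intro exp_mono mult_right_mono) auto
    finally show ?thesis
      by (simp add: mult_ac)
  qed
  have bound: "(\<Prod>m<M. N.power_sum (Suc m) ^ hook_mult r m) \<le> exp ?s" for M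
  proof -
    have "(\<Prod>m<M. N.power_sum (Suc m) ^ hook_mult r m) \<le> (\<Prod>m<M. exp (N.tail * (real (Suc m) * (1 / 2) ^ m)))"
      using pos le by (intro prod_mono) auto
    also have "\<dots> = exp (\<Sum>m<M. N.tail * (real (Suc m) * (1 / 2) ^ m))"
      by (simp add: exp_sum)
    also have "\<dots> \<le> exp ?s"
      using N.tail_nonneg by (intro exp_mono sum_le_suminf[OF sm]) auto
    finally show ?thesis .
  qed
  show ?thesis
  proof (rule summableI_nonneg_bounded)
    fix K
    have "(\<Sum>n<K. norm (of_nat (a_coeff r n) * F n)) =
        (\<Sum>n<K. of_nat (array_count hook_length (hooks r K) n) * norm (F n))"
      by (rule sum.cong) (simp_all add: array_count_hooks norm_mult)
    also have "\<dots> \<le> (\<Sum>n. of_nat (array_count hook_length (hooks r K) n) * norm (F n))"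
      by (rule sum_le_suminf[OF sums_summable[OF N.sums_hooks]]) auto
    also have "\<dots> = (\<Prod>m<K. N.power_sum (Suc m) ^ hook_mult r m)"
      by (rule sums_unique[OF N.sums_hooks, symmetric])
    also have "\<dots> \<le> exp ?s"
      by (rule bound)
    finally show "(\<Sum>n<K. norm (of_nat (a_coeff r n) * F n)) \<le> exp ?s" .
  qed simp
qed

text \<open>Tannery's theorem for growing triangles: each coefficient becomes constant once M >= n,
  and by \<open>array_count_hooks_le\<close> the full series is a majorant.\<close>

theorem (in completely_multiplicative) suminf_a_coeff:
  "(\<Sum>n. of_nat (a_coeff r n) * F n) = prodinf (\<lambda>m. power_sum (Suc m) ^ hook_mult r m)"
proof (rule LIMSEQ_unique)
  let ?b = "\<lambda>M n. array_count hook_length (hooks r M) n"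
  have "(\<lambda>M. \<Sum>n. of_nat (?b M n) * F n) \<longlonglongrightarrow> (\<Sum>n. of_nat (a_coeff r n) * F n)"
  proof (rule tannerys_theorem[where M = "\<lambda>n. norm (of_nat (a_coeff r n) * F n)", THEN conjunct2, THEN conjunct2])
    fix n
    have "eventually (\<lambda>M. of_nat (?b M n) * F n = of_nat (a_coeff r n) * F n) sequentially"
      using eventually_ge_at_top[of n] by eventually_elim (simp add: array_count_hooks)
    then show "(\<lambda>M. of_nat (?b M n) * F n) \<longlonglongrightarrow> of_nat (a_coeff r n) * F n"
      by (rule tendsto_eventually)
  next
    have "norm (of_nat (?b M n) * F n) \<le> norm (of_nat (a_coeff r n) * F n)" for n M
      using array_count_hooks_le[of r M n] by (auto simp: norm_mult intro!: mult_right_mono)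
    then show "\<forall>\<^sub>F (n, M) in sequentially \<times>\<^sub>F sequentially.
        norm (of_nat (?b M n) * F n) \<le> norm (of_nat (a_coeff r n) * F n)"
      by (simp add: case_prod_unfold)
  qed (use summable_a_coeff in auto)
  then show "(\<lambda>M. \<Prod>m<M. power_sum (Suc m) ^ hook_mult r m) \<longlonglongrightarrow> (\<Sum>n. of_nat (a_coeff r n) * F n)"
    using sums_unique[OF sums_hooks] by simp
  have "convergent_prod (\<lambda>m. power_sum (Suc m) ^ hook_mult r m)"
    by (intro abs_convergent_prod_imp_convergent_prod abs_convergent_prod_power_sum hook_mult_le)
  then have "(\<lambda>M. \<Prod>m\<le>M. power_sum (Suc m) ^ hook_mult r m) \<longlonglongrightarrow> prodinf (\<lambda>m. power_sum (Suc m) ^ hook_mult r m)"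
    by (rule convergent_prod_LIMSEQ)
  then show "(\<lambda>M. \<Prod>m<M. power_sum (Suc m) ^ hook_mult r m) \<longlonglongrightarrow> prodinf (\<lambda>m. power_sum (Suc m) ^ hook_mult r m)"
    unfolding lessThan_Suc_atMost[symmetric] by (rule filterlim_sequentially_Suc[THEN iffD1])
qed

section \<open>Dirichlet characters\<close>

definition character_power :: "(int \<Rightarrow> complex) \<Rightarrow> complex \<Rightarrow> nat \<Rightarrow> complex" where
  "character_power chi s n = chi (int n) * of_nat n powr (- s)"

lemma dirichlet_character_1: "dirichlet_character j chi \<Longrightarrow> chi 1 = 1"
proof -
  assume chi: "dirichlet_character j chi"
  then have "chi (1 * 1) = chi 1 * chi 1" "chi 1 \<noteq> 0"
    unfolding dirichlet_character_def by (blast, simp)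
  then show ?thesis by simp
qed

text \<open>Periodicity makes the character bounded, whereas a value of norm above 1 would have
  unbounded powers, which are again values.\<close>

lemma norm_dirichlet_character_le:
  assumes chi: "dirichlet_character j chi"
  shows "norm (chi a) \<le> 1"
proof (rule ccontr)
  assume "\<not> norm (chi a) \<le> 1"
  then have gt: "1 < norm (chi a)" by simp
  have j: "0 < int j" and per: "chi (a + int j) = chi a" and mult: "chi (a * b) = chi a * chi b" for a b
    using chi by (auto simp: dirichlet_character_def)
  have shift: "chi (b + int k * int j) = chi b" for b and k :: nat
  proof (induction k)
    case (Suc k)
    have "chi (b + int (Suc k) * int j) = chi (b + int k * int j + int j)"
      by (simp add: algebra_simps)
    then show ?case
      using per Suc by simp
  qed simp
  \<comment> \<open>\<open>shift\<close> only adds natural multiples of the modulus, so the shift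
    starts from the residue when b is nonnegative and from b itself when it is negative.\<close>
  have red: "chi b = chi (b mod int j)" for b
  proof (cases "0 \<le> b")
    case True
    then have "b = b mod int j + int (nat (b div int j)) * int j"
      using j by (simp add: pos_imp_zdiv_nonneg_iff)
    then show ?thesis
      using shift[of "b mod int j" "nat (b div int j)"] by simp
  next
    case False
    then have "b + int (nat (- (b div int j))) * int j = b mod int j"
      using j by (simp add: minus_div_mult_eq_mod[symmetric] div_neg_pos_less0 less_imp_le)
    then show ?thesis
      using shift[of b "nat (- (b div int j))"] by simp
  qed
  define B where "B = Max ((\<lambda>b. norm (chi b)) ` {0..<int j})"
  have B: "norm (chi b) \<le> B" for b
    unfolding B_def by (subst red) (rule Max_ge, use j in auto)
  have pow: "chi (a ^ k) = chi a ^ k" for k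
    using dirichlet_character_1[OF chi] by (induction k) (simp_all add: mult)
  obtain k where "B < norm (chi a) ^ k"
    using real_arch_pow[OF gt] by blast
  then show False
    using B[of "a ^ k"] by (simp add: pow norm_power)
qed

lemma powr_power_of_nat:
  assumes "0 < n"
  shows "(of_nat n powr (- s)) ^ m = (of_nat n :: complex) powr (- (of_nat m * s))"
  using assms by (simp add: powr_def exp_of_nat_mult[symmetric] mult_ac)

text \<open>Both analytic conditions come from Re s > 1: the norms are at most n^(-Re s), which is
  summable, and which is at most 1/n <= 1/2 for n >= 2.\<close>

lemma completely_multiplicative_character_power:
  assumes chi: "dirichlet_character j chi" and s: "Re s > 1"
  shows "completely_multiplicative (character_power chi s)"
proof
  let ?F = "character_power chi s"
  have le: "norm (?F n) \<le> real n powr (- Re s)" for n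
  proof -
    have "norm (?F n) = norm (chi (int n)) * real n powr (- Re s)"
      by (simp add: character_power_def norm_mult norm_powr_real_powr)
    also have "\<dots> \<le> 1 * real n powr (- Re s)"
      by (intro mult_right_mono norm_dirichlet_character_le[OF chi]) simp
    finally show ?thesis by simp
  qed
  show "?F 0 = 0" "?F 1 = 1"
    using dirichlet_character_1[OF chi] by (simp_all add: character_power_def)
  show "?F (m * n) = ?F m * ?F n" for m n
  proof -
    have "chi (int m * int n) = chi (int m) * chi (int n)"
      using chi by (simp add: dirichlet_character_def)
    moreover have "of_nat (m * n) powr (- s) = of_nat m powr (- s) * (of_nat n :: complex) powr (- s)"
      using powr_times_real[of "of_nat m" "of_nat n" "- s"] by simp
    ultimately show ?thesis
      by (simp add: character_power_def)
  qed
  show "summable (\<lambda>n. norm (?F n))"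
  proof (rule summable_comparison_test')
    show "summable (\<lambda>n. real n powr (- Re s))"
      using s by (subst summable_real_powr_iff) simp
  qed (use le in simp)
  show "norm (?F n) \<le> 1 / 2" if "2 \<le> n" for n
  proof -
    have "norm (?F n) \<le> real n powr (- Re s)"
      by (rule le)
    also have "\<dots> \<le> real n powr (- 1)"
      using that s by (intro powr_mono) auto
    also have "\<dots> \<le> 1 / 2"
      using that by (simp add: powr_minus_divide field_simps)
    finally show ?thesis .
  qed
qed

context
  fixes chi :: "int \<Rightarrow> complex" and j :: nat and s :: complex
  assumes chi: "dirichlet_character j chi" and s: "Re s > 1"
begin

interpretation completely_multiplicative "character_power chi s"
  by (rule completely_multiplicative_character_power[OF chi s])

lemma dirichlet_L_eq: "dirichlet_L (of_nat (Suc m) * s) (\<lambda>a. chi a ^ Suc m) = power_sum (Suc m)"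
  unfolding dirichlet_L_def power_sum_def character_power_def
  by (simp only: power_mult_distrib powr_power_of_nat[OF zero_less_Suc])

lemma euler_term_powi_eq:
  "prime p \<Longrightarrow> euler_term s chi m p powi - int c = inverse (1 - character_power chi s p ^ m) ^ c"
  by (simp add: euler_term_def character_power_def power_mult_distrib powr_power_of_nat prime_gt_0_nat
      power_int_minus power_inverse)

lemma prime_prodinf_eq:
  "prime_prodinf (\<lambda>p. euler_term s chi (Suc m) p powi - int c) = power_sum (Suc m) ^ c"
  unfolding prime_prodinf_def prodinf_euler_power[symmetric]
  by (rule arg_cong[where f = prodinf]) (simp add: euler_term_powi_eq fun_eq_iff del: power_Suc)

lemma J_term_eq:
  "J_term r s chi n = of_nat (a_coeff r (Suc n)) * character_power chi s (Suc n)"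
  by (simp add: J_term_def character_power_def)

lemma summable_J_term: "summable (\<lambda>n. norm (J_term r s chi n))"
  unfolding J_term_eq using summable_a_coeff[of r] by (subst summable_Suc_iff)

lemma J_eq: "J r s chi = prodinf (\<lambda>m. power_sum (Suc m) ^ hook_mult r m)"
proof -
  have "J r s chi = (\<Sum>n. of_nat (a_coeff r n) * character_power chi s n)"
    unfolding J_def J_term_eq
    using suminf_split_head[OF summable_norm_cancel[OF summable_a_coeff[of r]]] F_0 by simp
  then show ?thesis
    by (simp only: suminf_a_coeff)
qed

lemma abs_convergent_euler_terms:
  assumes "\<And>m. c m \<le> m"
  shows "abs_convergent_prod_on (\<lambda>(m, p). euler_term s chi m p powi - int (c m)) ({1..} \<times> {p. prime p})"
proof -
  have "(\<lambda>u. norm ((case u of (m, p) \<Rightarrow> euler_term s chi m p powi - int (c m)) - 1))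
      summable_on ({1..} \<times> {p. prime p}) \<longleftrightarrow>
    (\<lambda>(m, p). norm (inverse (1 - character_power chi s p ^ m) ^ c m - 1)) summable_on ({1..} \<times> {p. prime p})"
    by (rule summable_on_cong) (auto simp: euler_term_powi_eq)
  then show ?thesis
    using summable_on_euler_factors[OF assms] by (simp add: abs_convergent_prod_on_def)
qed

lemma abs_convergent_euler_terms_fixed:
  assumes "\<And>m. c m \<le> m" and m: "1 \<le> m"
  shows "abs_convergent_prod_on (\<lambda>p. euler_term s chi m p powi - int (c m)) {p. prime p}"
proof -
  have "(\<lambda>u. norm ((case u of (m, p) \<Rightarrow> euler_term s chi m p powi - int (c m)) - 1)) summable_on (Pair m ` {p. prime p})"
    using abs_convergent_euler_terms[OF assms(1), unfolded abs_convergent_prod_on_def]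
    by (rule summable_on_subset_banach) (use m in auto)
  then show ?thesis
    unfolding abs_convergent_prod_on_def by (subst (asm) summable_on_reindex) (auto simp: inj_on_def o_def)
qed

lemma products:
  "abs_convergent_prod (\<lambda>m. prime_prodinf (\<lambda>p. euler_term s chi (Suc m) p powi - int (hook_mult r m)))"
  "abs_convergent_prod (\<lambda>m. dirichlet_L (of_nat (Suc m) * s) (\<lambda>a. chi a ^ Suc m) ^ hook_mult r m)"
  "J r s chi = (\<Prod>m. prime_prodinf (\<lambda>p. euler_term s chi (Suc m) p powi - int (hook_mult r m)))"
  "J r s chi = (\<Prod>m. dirichlet_L (of_nat (Suc m) * s) (\<lambda>a. chi a ^ Suc m) ^ hook_mult r m)"
  unfolding prime_prodinf_eq dirichlet_L_eq J_eq
  using abs_convergent_prod_power_sum[of "hook_mult r", OF hook_mult_le] by simp_all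

end

theorem proposition3p1:
  fixes chi :: "int \<Rightarrow> complex" and j :: nat and s :: complex
  assumes "dirichlet_character j chi" and "Re s > 1"
  shows
    "(\<forall>r::nat. r \<ge> 1 \<longrightarrow>
       summable (\<lambda>n. norm (J_term (enat r) s chi n)) \<and>
       abs_convergent_prod_on (\<lambda>(m, p). euler_term s chi m p powi - int (min m r))
         ({1..} \<times> {p. prime p}) \<and>
       (\<forall>m::nat. m \<ge> 1 \<longrightarrow>
         abs_convergent_prod_on (\<lambda>p. euler_term s chi m p powi - int (min m r)) {p. prime p}) \<and>
       abs_convergent_prod
         (\<lambda>m. prime_prodinf (\<lambda>p. euler_term s chi (Suc m) p powi - int (min (Suc m) r))) \<and>
       abs_convergent_prod
         (\<lambda>m. dirichlet_L (of_nat (Suc m) * s) (\<lambda>a. chi a ^ Suc m) ^ min (Suc m) r) \<and>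
       J (enat r) s chi =
         (\<Prod>m. prime_prodinf (\<lambda>p. euler_term s chi (Suc m) p powi - int (min (Suc m) r))) \<and>
       J (enat r) s chi =
         (\<Prod>m. dirichlet_L (of_nat (Suc m) * s) (\<lambda>a. chi a ^ Suc m) ^ min (Suc m) r)) \<and>
     (summable (\<lambda>n. norm (J_term \<infinity> s chi n)) \<and>
       abs_convergent_prod_on (\<lambda>(m, p). euler_term s chi m p powi - int m)
         ({1..} \<times> {p. prime p}) \<and>
       (\<forall>m::nat. m \<ge> 1 \<longrightarrow>
         abs_convergent_prod_on (\<lambda>p. euler_term s chi m p powi - int m) {p. prime p}) \<and>
       abs_convergent_prod
         (\<lambda>m. prime_prodinf (\<lambda>p. euler_term s chi (Suc m) p powi - int (Suc m))) \<and>
       abs_convergent_prod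
         (\<lambda>m. dirichlet_L (of_nat (Suc m) * s) (\<lambda>a. chi a ^ Suc m) ^ Suc m) \<and>
       J \<infinity> s chi =
         (\<Prod>m. prime_prodinf (\<lambda>p. euler_term s chi (Suc m) p powi - int (Suc m))) \<and>
       J \<infinity> s chi =
         (\<Prod>m. dirichlet_L (of_nat (Suc m) * s) (\<lambda>a. chi a ^ Suc m) ^ Suc m))"
proof (intro conjI allI impI)
  fix r :: nat
  show "summable (\<lambda>n. norm (J_term (enat r) s chi n))" "summable (\<lambda>n. norm (J_term \<infinity> s chi n))"
    by (rule summable_J_term[OF assms])+
  show "abs_convergent_prod_on (\<lambda>(m, p). euler_term s chi m p powi - int (min m r)) ({1..} \<times> {p. prime p})"
    by (rule abs_convergent_euler_terms[OF assms]) simp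
  show "abs_convergent_prod_on (\<lambda>(m, p). euler_term s chi m p powi - int m) ({1..} \<times> {p. prime p})"
    by (rule abs_convergent_euler_terms[OF assms]) simp
  fix m :: nat assume m: "1 \<le> m"
  show "abs_convergent_prod_on (\<lambda>p. euler_term s chi m p powi - int (min m r)) {p. prime p}"
    by (rule abs_convergent_euler_terms_fixed[OF assms _ m]) simp
  show "abs_convergent_prod_on (\<lambda>p. euler_term s chi m p powi - int m) {p. prime p}"
    by (rule abs_convergent_euler_terms_fixed[OF assms _ m]) simp
qed (use products[OF assms, of "enat _", unfolded hook_mult_enat]
    products[OF assms, of \<infinity>, unfolded hook_mult_infinity] in \<open>simp_all del: power_Suc\<close>)

end
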